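(* Let $M$ be a complete minimal hypersurface (of dimension $n$) in the hyperbolic space $\mathbb{H}^{n+1}$, with second fundamental form $A$. If $|A|^2\le\frac{(n+1)^2}{4}$ at every point of $M$, then $M$ is stable.
   Context: $\mathbb{H}^{n+1}$ is the $(n+1)$-dimensional hyperbolic space of constant sectional curvature $-1$. A minimal hypersurface $M$ in $\mathbb{H}^{n+1}$ with second fundamental form $A$ is called stable if for every compactly supported Lipschitz function $f$ on $M$ $$\int_M |\nabla f|^2-(|A|^2-n)f^2\,dv\ge 0,$$ where $dv$ is the volume form of the induced metric. *)

theory Defs
  imports "HOL-Analysis.Analysis"
begin

section \<open>Smooth manifolds\<close>

text \<open>\<open>Ck_on k f S\<close> is intended for open \<open>S\<close> in a finite-dimensional space, where it says that
  \<open>f\<close> is of class \<open>C\<^sup>k\<close> on \<open>S\<close>.\<close>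

primrec Ck_on ::
  "nat \<Rightarrow> ('a::real_normed_vector \<Rightarrow> 'b::real_normed_vector) \<Rightarrow> 'a set \<Rightarrow> bool" where
  "Ck_on 0 f S \<longleftrightarrow> continuous_on S f"
| "Ck_on (Suc k) f S \<longleftrightarrow>
     (\<forall>x\<in>S. f differentiable at x) \<and> (\<forall>v. Ck_on k (\<lambda>x. frechet_derivative f (at x) v) S)"

definition smooth_on ::
  "('a::real_normed_vector \<Rightarrow> 'b::real_normed_vector) \<Rightarrow> 'a set \<Rightarrow> bool" where
  "smooth_on f S \<longleftrightarrow> (\<forall>k. Ck_on k f S)"

text \<open>A chart is a pair of a domain and a coordinate map. The manifold is the whole type \<open>'p\<close>, whose
  type class supplies the Hausdorff property and second countability.\<close>

type_synonym ('p, 'n) chart = "'p set \<times> ('p \<Rightarrow> real^'n)"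

definition chart_inv :: "('p, 'n::finite) chart \<Rightarrow> real^'n \<Rightarrow> 'p" where
  "chart_inv c = inv_into (fst c) (snd c)"

definition smooth_atlas ::
  "('p::{second_countable_topology, t2_space}, 'n::finite) chart set \<Rightarrow> bool" where
  "smooth_atlas \<A> \<longleftrightarrow>
     (\<Union>c\<in>\<A>. fst c) = UNIV \<and>
     (\<forall>c\<in>\<A>. open (fst c) \<and> open (snd c ` fst c) \<and>
        homeomorphism (fst c) (snd c ` fst c) (snd c) (chart_inv c)) \<and>
     (\<forall>c\<in>\<A>. \<forall>d\<in>\<A>. smooth_on (snd d \<circ> chart_inv c) (snd c ` (fst c \<inter> fst d)))"

text \<open>The pointwise quantities below are computed in a chart around the point; their values do not
  depend on which chart is selected.\<close>

definition chart_at :: "('p, 'n::finite) chart set \<Rightarrow> 'p \<Rightarrow> ('p, 'n) chart" where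
  "chart_at \<A> p = (SOME c. c \<in> \<A> \<and> p \<in> fst c)"

definition pderiv_at ::
  "'n::finite \<Rightarrow> (real^'n \<Rightarrow> 'b::real_normed_vector) \<Rightarrow> real^'n \<Rightarrow> 'b" where
  "pderiv_at i f x = frechet_derivative f (at x) (axis i 1)"


section \<open>Hyperbolic space and immersed hypersurfaces\<close>

text \<open>Hyperboloid model: for \<open>CARD('m) = n + 1\<close>, the upper sheet of \<open>\<langle>x, x\<rangle> = -1\<close> in Minkowski space
  \<open>real^'m \<times> real\<close>, whose last factor is timelike, with the metric induced by the Lorentz form.\<close>

definition lorentz :: "(real^'m::finite) \<times> real \<Rightarrow> (real^'m) \<times> real \<Rightarrow> real" where
  "lorentz v w = fst v \<bullet> fst w - snd v * snd w"

definition hyperbolic_space :: "((real^'m::finite) \<times> real) set" where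
  "hyperbolic_space = {x. lorentz x x = - 1 \<and> snd x > 0}"

text \<open>Orthogonal projection onto the tangent space of the hyperboloid at \<open>x\<close>; applied to derivatives
  taken in Minkowski space it yields the Levi-Civita connection of hyperbolic space.\<close>

definition hyp_proj :: "(real^'m::finite) \<times> real \<Rightarrow> (real^'m) \<times> real \<Rightarrow> (real^'m) \<times> real" where
  "hyp_proj x w = w + lorentz w x *\<^sub>R x"

definition immersed_hypersurface ::
  "('p::{second_countable_topology, t2_space}, 'n::finite) chart set \<Rightarrow>
   ('p \<Rightarrow> (real^'m::finite) \<times> real) \<Rightarrow> bool" where
  "immersed_hypersurface \<A> F \<longleftrightarrow>
     CARD('m) = CARD('n) + 1 \<and>
     smooth_atlas \<A> \<and>
     range F \<subseteq> hyperbolic_space \<and>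
     (\<forall>c\<in>\<A>. smooth_on (F \<circ> chart_inv c) (snd c ` fst c) \<and>
        (\<forall>x\<in>snd c ` fst c. inj (frechet_derivative (F \<circ> chart_inv c) (at x))))"


section \<open>First and second fundamental form\<close>

text \<open>In this group \<open>X\<close> is a local parametrization of the hypersurface.\<close>

definition metric_matrix ::
  "(real^'n::finite \<Rightarrow> (real^'m::finite) \<times> real) \<Rightarrow> real^'n \<Rightarrow> real^'n^'n" where
  "metric_matrix X x = (\<chi> i j. lorentz (pderiv_at i X x) (pderiv_at j X x))"

text \<open>The unit normal is unique up to sign. Its sign is chosen pointwise, without any continuity; the
  norm of the second fundamental form and the vanishing of its trace do not depend on it.\<close>

definition unit_normal ::
  "(real^'n::finite \<Rightarrow> (real^'m::finite) \<times> real) \<Rightarrow> real^'n \<Rightarrow> (real^'m) \<times> real" where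
  "unit_normal X x = (SOME \<nu>. lorentz \<nu> \<nu> = 1 \<and> lorentz \<nu> (X x) = 0 \<and>
     (\<forall>i. lorentz \<nu> (pderiv_at i X x) = 0))"

definition second_ff ::
  "(real^'n::finite \<Rightarrow> (real^'m::finite) \<times> real) \<Rightarrow> real^'n \<Rightarrow> real^'n^'n" where
  "second_ff X x = (\<chi> i j.
     lorentz (hyp_proj (X x) (pderiv_at i (pderiv_at j X) x)) (unit_normal X x))"

definition metric_at ::
  "('p, 'n::finite) chart set \<Rightarrow> ('p \<Rightarrow> (real^'m::finite) \<times> real) \<Rightarrow> 'p \<Rightarrow> real^'n^'n" where
  "metric_at \<A> F p = (let c = chart_at \<A> p in metric_matrix (F \<circ> chart_inv c) (snd c p))"

definition second_ff_at ::
  "('p, 'n::finite) chart set \<Rightarrow> ('p \<Rightarrow> (real^'m::finite) \<times> real) \<Rightarrow> 'p \<Rightarrow> real^'n^'n" where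
  "second_ff_at \<A> F p = (let c = chart_at \<A> p in second_ff (F \<circ> chart_inv c) (snd c p))"

definition second_ff_normsq ::
  "('p, 'n::finite) chart set \<Rightarrow> ('p \<Rightarrow> (real^'m::finite) \<times> real) \<Rightarrow> 'p \<Rightarrow> real" where
  "second_ff_normsq \<A> F p =
     (let g' = matrix_inv (metric_at \<A> F p); h = second_ff_at \<A> F p
      in \<Sum>i\<in>UNIV. \<Sum>j\<in>UNIV. \<Sum>k\<in>UNIV. \<Sum>l\<in>UNIV. g'$i$k * g'$j$l * h$i$j * h$k$l)"

definition minimal_hypersurface ::
  "('p, 'n::finite) chart set \<Rightarrow> ('p \<Rightarrow> (real^'m::finite) \<times> real) \<Rightarrow> bool" where
  "minimal_hypersurface \<A> F \<longleftrightarrow>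
     (\<forall>p. let g' = matrix_inv (metric_at \<A> F p); h = second_ff_at \<A> F p
          in (\<Sum>i\<in>UNIV. \<Sum>j\<in>UNIV. g'$i$j * h$i$j) = 0)"


section \<open>Riemannian distance and completeness\<close>

definition piecewise_C1_curve ::
  "('p::topological_space, 'n::finite) chart set \<Rightarrow> (real \<Rightarrow> 'p) \<Rightarrow> bool" where
  "piecewise_C1_curve \<A> \<gamma> \<longleftrightarrow> path \<gamma> \<and>
     (\<forall>c\<in>\<A>. \<forall>a b. 0 \<le> a \<and> a \<le> b \<and> b \<le> 1 \<and> \<gamma> ` {a..b} \<subseteq> fst c \<longrightarrow>
        (snd c \<circ> \<gamma>) piecewise_C1_differentiable_on {a..b})"

text \<open>The length is extended-valued because \<open>piecewise_C1_differentiable_on\<close> does not bound the speed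
  near the finitely many exceptional parameters.\<close>

definition curve_length :: "('p \<Rightarrow> (real^'m::finite) \<times> real) \<Rightarrow> (real \<Rightarrow> 'p) \<Rightarrow> ennreal" where
  "curve_length F \<gamma> =
     (\<integral>\<^sup>+t\<in>{0..1}. ennreal (sqrt (lorentz (vector_derivative (F \<circ> \<gamma>) (at t))
                                         (vector_derivative (F \<circ> \<gamma>) (at t)))) \<partial>lborel)"

text \<open>Points in different connected components have distance \<open>\<infinity>\<close>.\<close>

definition riemannian_dist ::
  "('p::topological_space, 'n::finite) chart set \<Rightarrow> ('p \<Rightarrow> (real^'m::finite) \<times> real) \<Rightarrow>
   'p \<Rightarrow> 'p \<Rightarrow> ennreal" where
  "riemannian_dist \<A> F p q =
     (INF \<gamma>\<in>{\<gamma>. piecewise_C1_curve \<A> \<gamma> \<and> pathstart \<gamma> = p \<and> pathfinish \<gamma> = q}. curve_length F \<gamma>)"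

definition complete_hypersurface ::
  "('p::topological_space, 'n::finite) chart set \<Rightarrow> ('p \<Rightarrow> (real^'m::finite) \<times> real) \<Rightarrow> bool" where
  "complete_hypersurface \<A> F \<longleftrightarrow>
     (\<forall>s :: nat \<Rightarrow> 'p.
        (\<forall>\<epsilon>>0. \<exists>N. \<forall>i\<ge>N. \<forall>j\<ge>N. riemannian_dist \<A> F (s i) (s j) < \<epsilon>) \<longrightarrow>
        (\<exists>p. (\<lambda>i. riemannian_dist \<A> F (s i) p) \<longlonglongrightarrow> 0))"


section \<open>Volume, gradient and stability\<close>

text \<open>The measure \<open>dv\<close> is the unique Borel measure given by \<open>sqrt (det g) dx\<close> in every chart.\<close>

definition volume_measure ::
  "('p::topological_space, 'n::finite) chart set \<Rightarrow> ('p \<Rightarrow> (real^'m::finite) \<times> real) \<Rightarrow>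
   'p measure" where
  "volume_measure \<A> F = (THE \<mu>. sets \<mu> = sets borel \<and>
     (\<forall>c\<in>\<A>. \<forall>B\<in>sets borel. B \<subseteq> fst c \<longrightarrow>
        emeasure \<mu> B =
          (\<integral>\<^sup>+x\<in>snd c ` B. ennreal (sqrt (det (metric_matrix (F \<circ> chart_inv c) x))) \<partial>lborel)))"

definition lipschitz_function ::
  "('p::topological_space, 'n::finite) chart set \<Rightarrow> ('p \<Rightarrow> (real^'m::finite) \<times> real) \<Rightarrow>
   ('p \<Rightarrow> real) \<Rightarrow> bool" where
  "lipschitz_function \<A> F f \<longleftrightarrow>
     (\<exists>L\<ge>0. \<forall>p q. ennreal \<bar>f p - f q\<bar> \<le> ennreal L * riemannian_dist \<A> F p q)"

text \<open>A Lipschitz function is differentiable almost everywhere (Rademacher); on the remaining null set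
  the squared norm of the gradient is set to \<open>0\<close>.\<close>

definition grad_normsq ::
  "('p, 'n::finite) chart set \<Rightarrow> ('p \<Rightarrow> (real^'m::finite) \<times> real) \<Rightarrow> ('p \<Rightarrow> real) \<Rightarrow> 'p \<Rightarrow> real" where
  "grad_normsq \<A> F f p =
     (let c = chart_at \<A> p; u = f \<circ> chart_inv c; x = snd c p; g' = matrix_inv (metric_at \<A> F p)
      in if u differentiable at x
         then \<Sum>i\<in>UNIV. \<Sum>j\<in>UNIV. g'$i$j * pderiv_at i u x * pderiv_at j u x
         else 0)"

definition stable_hypersurface ::
  "('p::topological_space, 'n::finite) chart set \<Rightarrow> ('p \<Rightarrow> (real^'m::finite) \<times> real) \<Rightarrow> bool" where
  "stable_hypersurface \<A> F \<longleftrightarrow>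
     (\<forall>f. lipschitz_function \<A> F f \<and> compact (closure {p. f p \<noteq> 0}) \<longrightarrow>
        (\<integral>p. grad_normsq \<A> F f p - (second_ff_normsq \<A> F p - real CARD('n)) * (f p)\<^sup>2
           \<partial>volume_measure \<A> F) \<ge> 0)"

end

theory Submission
  imports Defs
begin

text \<open>
  Let \<open>u > 0\<close> be the timelike coordinate of the hyperboloid model, restricted to the hypersurface, and let
  \<open>n\<close> be the dimension. Minimality gives \<open>\<Delta> u = n u\<close>, and projecting the timelike unit vector to the
  tangent space gives \<open>|\<nabla>u|\<^sup>2 \<le> u\<^sup>2\<close>. Hence the field \<open>Z = \<nabla>u / u\<close> satisfies \<open>|Z| \<le> 1\<close> and
  \<open>div Z = n - |Z|\<^sup>2\<close>. For \<open>k = (n - 1) / 2\<close>, expanding \<open>|\<nabla>f + k f Z|\<^sup>2 \<ge> 0\<close> yields the pointwise bound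
  \<open>|\<nabla>f|\<^sup>2 - k\<^sup>2 f\<^sup>2 \<ge> - k div (f\<^sup>2 Z)\<close>, and \<open>|A|\<^sup>2 - n \<le> (n + 1)\<^sup>2 / 4 - n = k\<^sup>2\<close>. It remains to see that
  \<open>div (f\<^sup>2 Z)\<close> integrates to \<open>0\<close>. By Rademacher's theorem the divergence of a compactly supported Lipschitz
  field on Euclidean space is an almost everywhere limit of bounded difference quotients, whose integrals vanish by
  translation invariance; a cover of the support by charts transfers this to the hypersurface.
\<close>

section \<open>Rademacher's theorem\<close>

text \<open>Since grad (u^k f) = u^k (grad f + k f Z), the square in the overview is u^(-2k) |grad
  (u^k f)|^2, and u^(-k) acts as a positive supersolution, as in Barta's method. For any k >= 0 the
  same expansion gives |grad f|^2 + k div (f^2 Z) >= k (n - 1 - k) f^2. The choice k = (n - 1) / 2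
  maximises the factor on the right; its maximum k^2 = (n - 1)^2 / 4 is the bottom of the spectrum
  of hyperbolic n-space, and (n + 1)^2 / 4 = k^2 + n is the largest value of |A|^2 that this
  constant absorbs. Two obstacles shape the proof. The function f is only Lipschitz, so its gradient
  exists merely almost everywhere and no smooth divergence theorem applies to f^2 Z. Moreover, all
  pointwise quantities are computed in a chart selected by choice, and dv is a definite description;
  hence gradient products and the minimality condition must be shown to be independent of the chart,
  and the measure must be constructed before anything can be integrated.\<close>

text \<open>The points with value at least \<open>F a\<close> form a compact set, and a climb from
  its maximum would produce a larger member unless that maximum is \<open>b\<close>. One suitable
  step \<open>h\<close> per point is enough, so slope conditions that hold only for some arbitrarily
  small steps can be used.\<close>

lemma le_of_local_climb:
  fixes F :: "real \<Rightarrow> real"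
  assumes "a \<le> b" "continuous_on {a..b} F"
    and climb: "\<And>x. a \<le> x \<Longrightarrow> x < b \<Longrightarrow> \<exists>h>0. x + h \<le> b \<and> F x \<le> F (x + h)"
  shows "F a \<le> F b"
proof -
  define S where "S = {x\<in>{a..b}. F a \<le> F x}"
  have "closed S"
    unfolding S_def by (intro continuous_on_closed_Collect_le assms continuous_on_const) auto
  moreover have "bounded S" by (rule bounded_subset[of "{a..b}"]) (auto simp: S_def)
  ultimately have "compact S" by (simp add: compact_eq_bounded_closed)
  moreover have "a \<in> S" using assms by (auto simp: S_def)
  ultimately obtain s where s: "s \<in> S" "\<And>x. x \<in> S \<Longrightarrow> x \<le> s"
    using compact_attains_sup[of S] by blast
  show ?thesis
  proof (cases "s = b")
    case True then show ?thesis using s by (auto simp: S_def)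
  next
    case False
    then obtain h where "h > 0" "s + h \<le> b" "F s \<le> F (s + h)"
      using climb[of s] s by (auto simp: S_def)
    then have "s + h \<in> S" using s by (auto simp: S_def)
    then show ?thesis using s(2) \<open>h > 0\<close> by fastforce
  qed
qed

text \<open>Takes the place of a Vitali covering argument. The complement of \<open>E\<close> is
  covered by an open set \<open>W\<close> of almost the same measure; \<open>f\<close> is compared
  with a function that has slope \<open>p\<close> plus an extra \<open>L - p\<close> along
  \<open>W\<close>.\<close>

lemma increment_le_of_frequent_slope:
  fixes f :: "real \<Rightarrow> real"
  assumes lip: "\<And>x y. \<bar>f x - f y\<bar> \<le> L * \<bar>x - y\<bar>" and "a \<le> b" "p \<le> L"
    and E: "E \<in> sets borel"
    and slope: "\<And>x \<delta>. x \<in> E \<Longrightarrow> 0 < \<delta> \<Longrightarrow> \<exists>h. 0 < h \<and> h < \<delta> \<and> f (x + h) - f x \<le> p * h"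
  shows "f b - f a \<le> p * (b - a) + (L - p) * measure lborel ({a..b} - E)"
proof -
  have key: "f b - f a \<le> p * (b - a) + (L - p) * (measure lborel ({a..b} - E) + e)" if e: "e > 0" for e
  proof -
    have S: "{a..b} - E \<in> sets lebesgue" using E by auto
    then obtain W where W: "open W" "{a..b} - E \<subseteq> W" "W - ({a..b} - E) \<in> lmeasurable"
        "emeasure lebesgue (W - ({a..b} - E)) < ennreal e"
      using sets_lebesgue_outer_open[OF S e] by metis
    \<comment> \<open>The measure of \<open>W\<close> to the left of \<open>x\<close>: it grows at
      full rate inside \<open>W\<close> and never decreases, which is all that the climbing argument
      uses.\<close>
    define m where "m x = measure lborel (W \<inter> {a..x})" for x
    have fm: "W \<inter> {x..y} \<in> fmeasurable lborel" for x y
      by (rule fmeasurableI2[of "{x..y}"]) (use \<open>open W\<close> in \<open>auto simp: fmeasurable_compact\<close>)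
    have fm': "W \<inter> {x<..y} \<in> fmeasurable lborel" for x y
      by (rule fmeasurableI2[OF fm[of x y]]) (use \<open>open W\<close> in auto)
    have m_add: "m y = m x + measure lborel (W \<inter> {x<..y})" if "a \<le> x" "x \<le> y" for x y
    proof -
      have "W \<inter> {a..y} = (W \<inter> {a..x}) \<union> (W \<inter> {x<..y})" using that by auto
      moreover have "(W \<inter> {a..x}) \<inter> (W \<inter> {x<..y}) = {}" by auto
      ultimately show ?thesis unfolding m_def
        using measure_Un3[OF fm[of a x] fm'[of x y]] by simp
    qed
    have m_lip: "measure lborel (W \<inter> {x<..y}) \<le> y - x" if "x \<le> y" for x y
    proof -
      have "measure lborel (W \<inter> {x<..y}) \<le> measure lborel {x<..y}"
        by (intro measure_mono_fmeasurable) (use \<open>open W\<close> that in \<open>auto simp: fmeasurable_def\<close>)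
      then show ?thesis using that by simp
    qed
    have "1-lipschitz_on {a..b} m"
    proof (rule lipschitz_onI)
      fix x y assume "x \<in> {a..b}" "y \<in> {a..b}"
      then show "dist (m x) (m y) \<le> 1 * dist x y"
        using m_add[of x y] m_add[of y x] m_lip[of x y] m_lip[of y x]
          measure_nonneg[of lborel "W \<inter> {x<..y}"] measure_nonneg[of lborel "W \<inter> {y<..x}"]
        by (cases "x \<le> y") (auto simp: dist_real_def)
    qed auto
    then have cm: "continuous_on {a..b} m" by (rule lipschitz_on_continuous_on)
    have "L-lipschitz_on {a..b} f"
      using lip lip[of 1 0] by (intro lipschitz_onI) (auto simp: dist_real_def)
    then have cf: "continuous_on {a..b} f" by (rule lipschitz_on_continuous_on)
    \<comment> \<open>\<open>F\<close> climbs locally: on \<open>W\<close> at the maximal slope \<open>L\<close> of \<open>f\<close>, off \<open>W\<close> by \<open>slope\<close>.\<close>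
    define F where "F = (\<lambda>x. p * x + (L - p) * m x - f x)"
    have "F a \<le> F b"
    proof (rule le_of_local_climb[of a b F])
      show "continuous_on {a..b} F" unfolding F_def by (intro continuous_intros cm cf)
      fix x assume x: "a \<le> x" "x < b"
      have incr: "F (x + h) - F x = p * h + (L - p) * measure lborel (W \<inter> {x<..x+h}) - (f (x+h) - f x)"
        if "h > 0" for h
        using m_add[of x "x + h"] x that by (simp add: F_def algebra_simps)
      show "\<exists>h>0. x + h \<le> b \<and> F x \<le> F (x + h)"
      proof (cases "x \<in> E")
        case True
        then obtain h where h: "0 < h" "h < b - x" "f (x + h) - f x \<le> p * h"
          using slope[of x "b - x"] x by auto
        have "(L - p) * measure lborel (W \<inter> {x<..x+h}) \<ge> 0" using \<open>p \<le> L\<close> by simp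
        then have "F x \<le> F (x + h)" using incr[OF h(1)] h by linarith
        then show ?thesis using h by (intro exI[of _ h]) auto
      next
        case False
        then have "x \<in> W" using W x by auto
        then obtain d where d: "d > 0" "cball x d \<subseteq> W" using \<open>open W\<close> open_contains_cball by blast
        define h where "h = min d (b - x)"
        have h: "h > 0" "x + h \<le> b" "{x<..x+h} \<subseteq> W"
          using d x by (auto simp: h_def subset_iff dist_real_def)
        then have "W \<inter> {x<..x+h} = {x<..x+h}" by auto
        then have "F (x + h) - F x = L * h - (f (x+h) - f x)"
          using incr[OF h(1)] h by (simp add: algebra_simps)
        then have "F x \<le> F (x + h)" using lip[of "x + h" x] h by auto
        then show ?thesis using h by blast
      qed
    qed fact
    moreover have "m a \<ge> 0" by (simp add: m_def)
    moreover have "m b \<le> measure lborel ({a..b} - E) + e"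
    proof -
      have "W - ({a..b} - E) \<in> sets borel" using \<open>open W\<close> E by auto
      then have lt: "emeasure lborel (W - ({a..b} - E)) < ennreal e" using W(4) by simp
      have le: "measure lborel (W - ({a..b} - E)) \<le> e"
        unfolding measure_def by (rule enn2real_leI) (use lt e in auto)
      have fin: "W - ({a..b} - E) \<in> fmeasurable lborel"
        by (rule fmeasurableI) (use \<open>W - ({a..b} - E) \<in> sets borel\<close> order.strict_trans[OF lt] in auto)
      have fin2: "{a..b} - E \<in> fmeasurable lborel"
        by (rule fmeasurableI2[of "{a..b}"]) (use E in \<open>auto simp: fmeasurable_compact\<close>)
      have "m b \<le> measure lborel (({a..b} - E) \<union> (W - ({a..b} - E)))"
        unfolding m_def
        by (rule measure_mono_fmeasurable[OF _ _ fmeasurable.Un[OF fin2 fin]]) (use \<open>open W\<close> in auto)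
      also have "\<dots> \<le> measure lborel ({a..b} - E) + measure lborel (W - ({a..b} - E))"
        using fin fin2 by (intro measure_Un_le) auto
      finally show ?thesis using le by linarith
    qed
    ultimately have "f b - f a \<le> p * (b - a) + (L - p) * m b - (L - p) * m a"
      by (simp add: F_def algebra_simps)
    also have "\<dots> \<le> p * (b - a) + (L - p) * m b" using \<open>p \<le> L\<close> \<open>m a \<ge> 0\<close> by simp
    also have "\<dots> \<le> p * (b - a) + (L - p) * (measure lborel ({a..b} - E) + e)"
      using \<open>m b \<le> _\<close> \<open>p \<le> L\<close> by (simp add: mult_left_mono)
    finally show ?thesis .
  qed
  \<comment> \<open>The tolerance enters multiplied by \<open>L - p\<close>, so it is rescaled by
    this factor; for \<open>p = L\<close> the whole error term vanishes.\<close>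
  have "f b - f a \<le> p * (b - a) + (L - p) * measure lborel ({a..b} - E) + e" if "e > 0" for e
  proof (cases "p = L")
    case True then show ?thesis using key[of 1] that by simp
  next
    case False
    then have "L - p > 0" using \<open>p \<le> L\<close> by simp
    then have "(L - p) * (e / (L - p)) = e" by simp
    then show ?thesis using key[of "e / (L - p)"] that \<open>L - p > 0\<close> by (simp add: distrib_left)
  qed
  then show ?thesis by (rule field_le_epsilon)
qed

text \<open>An elementary form of the density theorem. The bound passes from intervals to open sets
  through their components; an open set that approximates \<open>E\<close> from outside has little
  measure off \<open>E\<close>, hence little measure at all.\<close>

lemma null_set_of_lower_density:
  fixes E :: "real set"
  assumes E: "E \<in> sets borel" and "\<kappa> > 0"
    and dens: "\<And>a b. a \<le> b \<Longrightarrow> \<kappa> * (b - a) \<le> measure lborel ({a..b} - E)"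
  shows "E \<in> null_sets lborel"
proof -
  have open_le: "ennreal \<kappa> * emeasure lborel U \<le> emeasure lborel (U - E)" if U: "open U" "bounded U" for U
  proof -
    have comp: "ennreal \<kappa> * emeasure lborel C \<le> emeasure lborel (C - E)" if C: "C \<in> components U" for C
    proof -
      have "open C" "connected C" "C \<noteq> {}" "bounded C"
        using C U open_components in_components_connected in_components_nonempty
            bounded_subset[OF _ in_components_subset] by blast+
      have bdd: "bdd_below C" "bdd_above C" using \<open>bounded C\<close> by (auto simp: bounded_imp_bdd_below bounded_imp_bdd_above)
      define a b where "a = Inf C" and "b = Sup C"
      have "C \<subseteq> {a..b}" using bdd by (auto simp: a_def b_def cInf_lower cSup_upper)
      have "{a<..<b} \<subseteq> C"
      proof
        fix x assume x: "x \<in> {a<..<b}"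
        then obtain c d where "c \<in> C" "c < x" "d \<in> C" "x < d"
          using cInf_lessD[OF \<open>C \<noteq> {}\<close>, of x] less_cSupD[OF \<open>C \<noteq> {}\<close>, of x] by (auto simp: a_def b_def)
        then show "x \<in> C" using connected_contains_Icc[OF \<open>connected C\<close>, of c d] by auto
      qed
      have "a \<le> b" using \<open>C \<subseteq> {a..b}\<close> \<open>C \<noteq> {}\<close> by auto
      have "emeasure lborel C \<le> emeasure lborel {a..b}"
        using \<open>C \<subseteq> {a..b}\<close> by (intro emeasure_mono) auto
      then have "ennreal \<kappa> * emeasure lborel C \<le> ennreal (\<kappa> * (b - a))"
        using \<open>a \<le> b\<close> \<open>\<kappa> > 0\<close> by (simp add: ennreal_mult mult_left_mono)
      also have "\<dots> \<le> ennreal (measure lborel ({a..b} - E))"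
        using dens[OF \<open>a \<le> b\<close>] by (simp add: ennreal_leI)
      also have "\<dots> = emeasure lborel ({a..b} - E)"
      proof (rule emeasure_eq_ennreal_measure[symmetric])
        have "emeasure lborel ({a..b} - E) \<le> emeasure lborel {a..b}" by (intro emeasure_mono) auto
        then show "emeasure lborel ({a..b} - E) \<noteq> top" using \<open>a \<le> b\<close> by (auto simp: top_unique)
      qed
      also have "\<dots> \<le> emeasure lborel ((C - E) \<union> {a, b})"
        using \<open>{a<..<b} \<subseteq> C\<close> \<open>open C\<close> E by (intro emeasure_mono) auto
      also have "\<dots> \<le> emeasure lborel (C - E) + emeasure lborel {a, b}"
        using \<open>open C\<close> E by (intro emeasure_subadditive) auto
      also have "emeasure lborel {a, b} = 0" by (intro emeasure_lborel_countable) auto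
      finally show ?thesis by simp
    qed
    have opn: "C \<in> components U \<Longrightarrow> open C" for C using U open_components by blast
    have cnt: "countable (components U)"
      by (rule countable_disjoint_open_subsets) (use opn pairwise_disjoint_components[of U] in \<open>auto simp: pairwise_def disjnt_def\<close>)
    have disj: "disjoint_family_on (\<lambda>C. C) (components U)"
      using pairwise_disjoint_components[of U] by (auto simp: disjoint_family_on_def pairwise_def disjnt_def)
    have "ennreal \<kappa> * emeasure lborel U = ennreal \<kappa> * emeasure lborel (\<Union>C\<in>components U. C)"
      by (simp add: Union_components[symmetric])
    also have "\<dots> = (\<integral>\<^sup>+C. ennreal \<kappa> * emeasure lborel C \<partial>count_space (components U))"
      using cnt disj opn by (subst emeasure_UN_countable) (auto simp: nn_integral_cmult)
    also have "\<dots> \<le> (\<integral>\<^sup>+C. emeasure lborel (C - E) \<partial>count_space (components U))"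
      by (intro nn_integral_mono) (use comp in auto)
    also have "\<dots> = emeasure lborel (\<Union>C\<in>components U. C - E)"
      using cnt disj opn E by (subst emeasure_UN_countable) (auto simp: disjoint_family_on_def)
    also have "(\<Union>C\<in>components U. C - E) = U - E" using Union_components[of U] by auto
    finally show ?thesis .
  qed
  \<comment> \<open>Cutting to bounded pieces makes the components in \<open>open_le\<close> bounded
    intervals with real end points.\<close>
  have "E \<inter> {- real n<..<real n} \<in> null_sets lborel" for n
  proof -
    define E' where "E' = E \<inter> {- real n<..<real n}"
    have E': "E' \<in> sets borel" using E by (auto simp: E'_def)
    have "ennreal \<kappa> * emeasure lborel E' \<le> 0 + ennreal e" if e: "e > 0" for e
    proof -
      have "E' \<in> sets lebesgue" using E' by auto
      then obtain W where W: "open W" "E' \<subseteq> W" "emeasure lebesgue (W - E') < ennreal e"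
        using sets_lebesgue_outer_open[OF _ e] by metis
      define U where "U = W \<inter> {- real n<..<real n}"
      have U: "open U" "bounded U" "E' \<subseteq> U" using W by (auto simp: U_def E'_def bounded_Int)
      have "ennreal \<kappa> * emeasure lborel E' \<le> ennreal \<kappa> * emeasure lborel U"
        using U by (intro mult_left_mono emeasure_mono) auto
      also have "\<dots> \<le> emeasure lborel (U - E)" using open_le U by blast
      also have "\<dots> \<le> emeasure lborel (W - E')"
        using W E' by (intro emeasure_mono) (auto simp: U_def E'_def)
      also have "\<dots> \<le> ennreal e" using W E' by (auto simp: less_imp_le)
      finally show ?thesis by simp
    qed
    then have "ennreal \<kappa> * emeasure lborel E' \<le> 0" by (rule ennreal_le_epsilon)
    then show ?thesis using E' \<open>\<kappa> > 0\<close> by (auto simp: E'_def null_sets_def)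
  qed
  then have "(\<Union>n. E \<inter> {- real n<..<real n}) \<in> null_sets lborel" by blast
  moreover have "(\<Union>n. E \<inter> {- real n<..<real n}) = E"
  proof -
    have "\<exists>n. x \<in> {- real n<..<real n}" for x
      using reals_Archimedean2[of "\<bar>x\<bar>"] by (auto simp: abs_less_iff) (metis minus_less_iff)
    then show ?thesis by auto
  qed
  ultimately show ?thesis by simp
qed

text \<open>The increment estimate for \<open>f\<close> with slope \<open>p\<close> bounds the
  increment from above, the one for \<open>- f\<close> with slope \<open>- q\<close> from below.
  Their sum shows that \<open>E\<close> misses a fixed proportion of every interval. A point of
  \<open>E\<close> is used only to place \<open>p\<close> and \<open>q\<close> within the range of
  slopes that \<open>L\<close> permits.\<close>

lemma null_set_of_slope_gap:
  fixes f :: "real \<Rightarrow> real"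
  assumes lip: "\<And>x y. \<bar>f x - f y\<bar> \<le> L * \<bar>x - y\<bar>" and "p < q"
    and E: "E \<in> sets borel"
    and lo: "\<And>x \<delta>. x \<in> E \<Longrightarrow> 0 < \<delta> \<Longrightarrow> \<exists>h. 0 < h \<and> h < \<delta> \<and> f (x + h) - f x \<le> p * h"
    and hi: "\<And>x \<delta>. x \<in> E \<Longrightarrow> 0 < \<delta> \<Longrightarrow> \<exists>h. 0 < h \<and> h < \<delta> \<and> q * h \<le> f (x + h) - f x"
  shows "E \<in> null_sets lborel"
proof (cases "E = {}")
  case False
  then obtain x where x: "x \<in> E" by blast
  obtain h where "0 < h" "f (x + h) - f x \<le> p * h" using lo[OF x, of 1] by auto
  then have "- L * h \<le> p * h" using lip[of "x + h" x] by (auto simp: abs_le_iff)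
  then have pL: "- L \<le> p" using \<open>h > 0\<close> mult_le_cancel_right_pos by blast
  obtain h where "0 < h" "q * h \<le> f (x + h) - f x" using hi[OF x, of 1] by auto
  moreover have "f (x + h) - f x \<le> L * h" using lip[of "x + h" x] \<open>0 < h\<close> by simp
  ultimately have "q * h \<le> L * h" by linarith
  then have qL: "q \<le> L" using \<open>h > 0\<close> mult_le_cancel_right_pos by blast
  \<comment> \<open>The sum of the two error coefficients \<open>L - p\<close> and
    \<open>L - - q\<close>.\<close>
  define M where "M = 2 * L + q - p"
  have "M > 0" using pL qL \<open>p < q\<close> by (auto simp: M_def)
  show ?thesis
  proof (rule null_set_of_lower_density[OF E, of "(q - p) / M"])
    show "(q - p) / M > 0" using \<open>M > 0\<close> \<open>p < q\<close> by simp
    fix a b :: real assume "a \<le> b"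
    have 1: "f b - f a \<le> p * (b - a) + (L - p) * measure lborel ({a..b} - E)"
      by (rule increment_le_of_frequent_slope[OF lip \<open>a \<le> b\<close> _ E lo]) (use qL \<open>p < q\<close> in auto)
    have 2: "- f b - - f a \<le> - q * (b - a) + (L - - q) * measure lborel ({a..b} - E)"
    proof (rule increment_le_of_frequent_slope[OF _ \<open>a \<le> b\<close> _ E])
      show "\<bar>- f x - - f y\<bar> \<le> L * \<bar>x - y\<bar>" for x y using lip[of x y] by (simp add: abs_minus_commute)
      show "- q \<le> L" using pL \<open>p < q\<close> by simp
      fix x \<delta> :: real assume "x \<in> E" "0 < \<delta>"
      from hi[OF this] show "\<exists>h>0. h < \<delta> \<and> - f (x + h) - - f x \<le> - q * h" by auto
    qed
    from 1 2 have "(q - p) * (b - a) \<le> M * measure lborel ({a..b} - E)"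
      by (simp add: M_def algebra_simps)
    then show "(q - p) / M * (b - a) \<le> measure lborel ({a..b} - E)"
      using \<open>M > 0\<close> by (simp add: field_simps)
  qed
qed auto

text \<open>Boundedness makes the lower and upper limits finite; without a limit they differ, and
  two rationals fit between them. Rationality keeps the family of exceptional sets
  countable.\<close>

lemma tendsto_or_slope_gap:
  fixes g :: "real \<Rightarrow> real"
  assumes bd: "\<And>t. t > 0 \<Longrightarrow> \<bar>g t\<bar> \<le> B"
    and no_lim: "\<not> (\<exists>l. (g \<longlongrightarrow> l) (at_right 0))"
  shows "\<exists>p\<in>\<rat>. \<exists>q\<in>\<rat>. p < q \<and> (\<exists>\<^sub>F t in at_right 0. g t < p) \<and> (\<exists>\<^sub>F t in at_right 0. q < g t)"
proof -
  define l u where "l = Liminf (at_right 0) (\<lambda>t. ereal (g t))" and "u = Limsup (at_right 0) (\<lambda>t. ereal (g t))"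
  have ev: "eventually (\<lambda>t. t > 0) (at_right (0::real))" by (simp add: eventually_at_right_less)
  have lo: "- B \<le> g t" and up: "g t \<le> B" if "t > 0" for t
    using bd[OF that] by (auto simp: abs_le_iff)
  have "ereal (- B) \<le> l" unfolding l_def
    by (rule Liminf_bounded) (use ev lo in \<open>auto elim!: eventually_mono\<close>)
  moreover have "u \<le> ereal B" unfolding u_def
    by (rule Limsup_bounded) (use ev up in \<open>auto elim!: eventually_mono\<close>)
  moreover have "l \<le> u" unfolding l_def u_def by (rule Liminf_le_Limsup) simp
  ultimately obtain l' u' where lu: "l = ereal l'" "u = ereal u'"
    by (cases l; cases u) auto
  have "l \<noteq> u"
  proof
    assume "l = u"
    then have "((\<lambda>t. ereal (g t)) \<longlongrightarrow> ereal l') (at_right 0)"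
      using lu by (intro Liminf_eq_Limsup) (auto simp: l_def u_def)
    then show False using no_lim by auto
  qed
  then have "l' < u'" using \<open>l \<le> u\<close> lu by auto
  then obtain p where p: "p \<in> \<rat>" "l' < p" "p < u'" using Rats_dense_in_real by blast
  then obtain q where q: "q \<in> \<rat>" "p < q" "q < u'" using Rats_dense_in_real by blast
  have "\<exists>\<^sub>F t in at_right 0. g t < p"
  proof (rule ccontr)
    assume "\<not> ?thesis"
    then have "\<forall>\<^sub>F t in at_right 0. ereal p \<le> ereal (g t)" by (simp add: frequently_def not_less)
    then have "ereal p \<le> l" unfolding l_def by (rule Liminf_bounded)
    then show False using p lu by simp
  qed
  moreover have "\<exists>\<^sub>F t in at_right 0. q < g t"
  proof (rule ccontr)
    assume "\<not> ?thesis"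
    then have "\<forall>\<^sub>F t in at_right 0. ereal (g t) \<le> ereal q" by (simp add: frequently_def not_less)
    then have "u \<le> ereal q" unfolding u_def by (rule Limsup_bounded)
    then show False using q lu by simp
  qed
  ultimately show ?thesis using p q by blast
qed

text \<open>Continuity in the step allows rational steps, so that the exceptional sets become
  countable combinations of open sets and are Borel.\<close>

lemma frequently_at_right_rat:
  fixes g :: "real \<Rightarrow> real"
  assumes "continuous_on {0<..} g" "open U" "\<exists>\<^sub>F t in at_right 0. g t \<in> U" "\<delta> > 0"
  shows "\<exists>h\<in>\<rat>. 0 < h \<and> h < \<delta> \<and> g h \<in> U"
proof -
  have "\<exists>\<^sub>F t in at_right 0. g t \<in> U \<and> t \<in> {0<..<\<delta>}"
    using assms(3) eventually_at_right_real[OF \<open>\<delta> > 0\<close>] by (rule frequently_eventually_frequently)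
  then obtain t where t: "g t \<in> U" "0 < t" "t < \<delta>"
    using frequently_ex by fastforce
  have "open ({0<..<\<delta>} \<inter> g -` U)"
  proof (rule continuous_open_preimage)
    show "continuous_on {0<..<\<delta>} g" by (rule continuous_on_subset[OF assms(1)]) (simp add: subset_iff)
  qed (use assms(2) in auto)
  moreover have "t \<in> {0<..<\<delta>} \<inter> g -` U" using t by auto
  ultimately obtain e where e: "e > 0" "ball t e \<subseteq> {0<..<\<delta>} \<inter> g -` U"
    using open_contains_ball by metis
  obtain h where "h \<in> \<rat>" "t < h" "h < t + e" using Rats_dense_in_real[of t "t + e"] e by auto
  then have "h \<in> ball t e" by (auto simp: dist_real_def)
  then have "h \<in> {0<..<\<delta>} \<inter> g -` U" using e by blast
  then show ?thesis using \<open>h \<in> \<rat>\<close> by auto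
qed

text \<open>Averaging over translates in direction \<open>v\<close> replaces Fubini in coordinates adapted to \<open>v\<close>.\<close>

lemma null_set_of_line_null:
  fixes E :: "'a::euclidean_space set"
  assumes E[measurable]: "E \<in> sets borel"
    and lines: "\<And>x. {t::real. x + t *\<^sub>R v \<in> E} \<in> null_sets lborel"
  shows "E \<in> null_sets lborel"
proof -
  have tr: "(\<integral>\<^sup>+x. indicator E (x + t *\<^sub>R v) \<partial>lborel) = emeasure lborel E" for t
  proof -
    have "emeasure lborel E = (\<integral>\<^sup>+x. indicator E x \<partial>distr lborel borel ((+) (t *\<^sub>R v)))"
      by (simp add: lborel_distr_plus)
    also have "\<dots> = (\<integral>\<^sup>+x. indicator E (x + t *\<^sub>R v) \<partial>lborel)"
      by (subst nn_integral_distr) (auto simp: add.commute)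
    finally show ?thesis by simp
  qed
  \<comment> \<open>Integrating a constant over a parameter interval of length 1 creates the double
    integral whose order is then exchanged.\<close>
  have "emeasure lborel E = (\<integral>\<^sup>+t. emeasure lborel E * indicator {0..1::real} t \<partial>lborel)"
    by (simp add: nn_integral_cmult)
  also have "\<dots> = (\<integral>\<^sup>+t. (\<integral>\<^sup>+x. indicator E (x + t *\<^sub>R v) * indicator {0..1} t \<partial>lborel) \<partial>lborel)"
    by (subst nn_integral_multc) (auto simp: tr)
  also have "\<dots> = (\<integral>\<^sup>+x. (\<integral>\<^sup>+t. indicator E (x + t *\<^sub>R v) * indicator {0..1} t \<partial>lborel) \<partial>lborel)"
    by (rule lborel_pair.Fubini') measurable
  also have "\<dots> = (\<integral>\<^sup>+x. 0 \<partial>(lborel :: 'a measure))"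
  proof (rule nn_integral_cong)
    fix x :: 'a
    have "AE t in lborel. t \<notin> {t. x + t *\<^sub>R v \<in> E}" using lines[of x] by (rule AE_not_in)
    then have "(\<integral>\<^sup>+t. indicator E (x + t *\<^sub>R v) * indicator {0..1} t \<partial>lborel) = (\<integral>\<^sup>+t. 0 \<partial>(lborel::real measure))"
      by (intro nn_integral_cong_AE) (auto elim!: eventually_mono simp: indicator_def)
    then show "(\<integral>\<^sup>+t. indicator E (x + t *\<^sub>R v) * indicator {0..1} t \<partial>lborel) = 0" by simp
  qed
  finally show ?thesis using E by (auto simp: null_sets_def)
qed

section \<open>Directional derivatives almost everywhere\<close>

text \<open>A point without one-sided derivative lies in some \<open>E p q\<close> with rational
  \<open>p < q\<close>. Each of these sets meets every line in direction \<open>v\<close> in a null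
  set by the slope gap, so it is null.\<close>

lemma AE_directional_derivative:
  fixes f :: "'a::euclidean_space \<Rightarrow> real"
  assumes lip: "\<And>x y. \<bar>f x - f y\<bar> \<le> L * norm (x - y)"
  shows "AE x in lborel. \<exists>l. ((\<lambda>t. (f (x + t *\<^sub>R v) - f x) / t) \<longlongrightarrow> l) (at_right 0)"
proof -
  have "L \<ge> 0"
  proof -
    obtain b :: 'a where "b \<in> Basis" using nonempty_Basis by blast
    then show ?thesis using lip[of b 0] by simp
  qed
  have "L-lipschitz_on UNIV f"
    using lip \<open>L \<ge> 0\<close> by (intro lipschitz_onI) (auto simp: dist_real_def dist_norm)
  then have cf: "continuous_on UNIV f" by (rule lipschitz_on_continuous_on)
  have cf': "continuous_on A (\<lambda>x. f (g x))" if "continuous_on A g" for A :: "'b::topological_space set" and g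
    using continuous_on_compose2[OF cf that] by auto
  \<comment> \<open>The points at which slopes below \<open>p\<close> and slopes above
    \<open>q\<close> both occur for arbitrarily small steps.\<close>
  define E where "E p q = (\<Inter>k::nat. (\<Union>h\<in>{h\<in>\<rat>. 0 < h \<and> h < 1 / real (Suc k)}. {x. (f (x + h *\<^sub>R v) - f x) / h < p}) \<inter>
      (\<Union>h\<in>{h\<in>\<rat>. 0 < h \<and> h < 1 / real (Suc k)}. {x. q < (f (x + h *\<^sub>R v) - f x) / h}))" for p q :: real
  have E_sets: "E p q \<in> sets borel" for p q
  proof -
    have "open {x. (f (x + h *\<^sub>R v) - f x) / h < p}" "open {x. q < (f (x + h *\<^sub>R v) - f x) / h}"
      if "h > 0" for h :: real
      using that by (auto intro!: open_Collect_less continuous_intros cf')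
    then show ?thesis unfolding E_def
      by (intro sets.countable_INT'' sets.Int borel_open open_UN ballI) auto
  qed
  have E_null: "E p q \<in> null_sets lborel" if "p < q" for p q
  proof (rule null_set_of_line_null[OF E_sets])
    fix x
    let ?S = "{t::real. x + t *\<^sub>R v \<in> E p q}"
    have inE: "\<exists>h>0. h < \<delta> \<and> (f (y + h *\<^sub>R v) - f y) / h < p" "\<exists>h>0. h < \<delta> \<and> q < (f (y + h *\<^sub>R v) - f y) / h"
      if "y \<in> E p q" "\<delta> > 0" for y and \<delta> :: real
    proof -
      obtain k where k: "1 / real (Suc k) < \<delta>" using nat_approx_posE[OF \<open>\<delta> > 0\<close>] by metis
      from \<open>y \<in> E p q\<close> obtain h1 h2 where "0 < h1" "h1 < 1 / real (Suc k)" "(f (y + h1 *\<^sub>R v) - f y) / h1 < p"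
        "0 < h2" "h2 < 1 / real (Suc k)" "q < (f (y + h2 *\<^sub>R v) - f y) / h2"
        unfolding E_def by blast
      with k show "\<exists>h>0. h < \<delta> \<and> (f (y + h *\<^sub>R v) - f y) / h < p"
          "\<exists>h>0. h < \<delta> \<and> q < (f (y + h *\<^sub>R v) - f y) / h"
        using order.strict_trans by blast+
    qed
    show "?S \<in> null_sets lborel"
    proof (rule null_set_of_slope_gap[of "\<lambda>t. f (x + t *\<^sub>R v)" "L * norm v" p q])
      show "\<bar>f (x + s *\<^sub>R v) - f (x + t *\<^sub>R v)\<bar> \<le> L * norm v * \<bar>s - t\<bar>" for s t
        using lip[of "x + s *\<^sub>R v" "x + t *\<^sub>R v"] by (simp add: scaleR_diff_left[symmetric] mult_ac)
      have [measurable]: "E p q \<in> sets borel" by (rule E_sets)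
      show "?S \<in> sets borel" by measurable
      fix t \<delta> :: real assume "t \<in> ?S" "\<delta> > 0"
      then have y: "x + t *\<^sub>R v \<in> E p q" by simp
      have shift: "x + (t + h) *\<^sub>R v = x + t *\<^sub>R v + h *\<^sub>R v" for h by (simp add: scaleR_add_left)
      show "\<exists>h>0. h < \<delta> \<and> f (x + (t + h) *\<^sub>R v) - f (x + t *\<^sub>R v) \<le> p * h"
        using inE(1)[OF y \<open>\<delta> > 0\<close>] unfolding shift by (metis divide_less_eq less_imp_le)
      show "\<exists>h>0. h < \<delta> \<and> q * h \<le> f (x + (t + h) *\<^sub>R v) - f (x + t *\<^sub>R v)"
        using inE(2)[OF y \<open>\<delta> > 0\<close>] unfolding shift by (metis less_divide_eq less_imp_le)
    qed fact
  qed
  have "countable {pq::real\<times>real. pq \<in> \<rat> \<times> \<rat> \<and> fst pq < snd pq}"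
    by (rule countable_subset[of _ "\<rat> \<times> \<rat>"]) (auto simp: countable_rat)
  then have "(\<Union>pq\<in>{pq::real\<times>real. pq \<in> \<rat> \<times> \<rat> \<and> fst pq < snd pq}. E (fst pq) (snd pq)) \<in> null_sets lborel"
    by (rule null_sets_UN') (auto intro: E_null)
  then show ?thesis
  proof (rule AE_I', intro subsetI)
    fix x assume "x \<in> {x \<in> space lborel. \<not> (\<exists>l. ((\<lambda>t. (f (x + t *\<^sub>R v) - f x) / t) \<longlongrightarrow> l) (at_right 0))}"
    then have nl: "\<not> (\<exists>l. ((\<lambda>t. (f (x + t *\<^sub>R v) - f x) / t) \<longlongrightarrow> l) (at_right 0))" by simp
    let ?g = "\<lambda>t. (f (x + t *\<^sub>R v) - f x) / t"
    have "\<exists>p\<in>\<rat>. \<exists>q\<in>\<rat>. p < q \<and> (\<exists>\<^sub>F t in at_right 0. ?g t < p) \<and> (\<exists>\<^sub>F t in at_right 0. q < ?g t)"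
    proof (rule tendsto_or_slope_gap[OF _ nl])
      show "\<bar>?g t\<bar> \<le> L * norm v" if "t > 0" for t
        using lip[of "x + t *\<^sub>R v" x] that by (simp add: abs_divide field_simps)
    qed
    then obtain p q where pq: "p \<in> \<rat>" "q \<in> \<rat>" "p < q" "\<exists>\<^sub>F t in at_right 0. ?g t \<in> {..<p}" "\<exists>\<^sub>F t in at_right 0. ?g t \<in> {q<..}"
      by auto
    have cg: "continuous_on {0<..} ?g"
      by (intro continuous_intros cf') auto
    have "x \<in> E p q"
      unfolding E_def
    proof (intro INT_I IntI)
      fix k
      have k: "0 < 1 / real (Suc k)" by simp
      show "x \<in> (\<Union>h\<in>{h\<in>\<rat>. 0 < h \<and> h < 1 / real (Suc k)}. {x. (f (x + h *\<^sub>R v) - f x) / h < p})"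
        using frequently_at_right_rat[OF cg _ pq(4) k] by auto
      show "x \<in> (\<Union>h\<in>{h\<in>\<rat>. 0 < h \<and> h < 1 / real (Suc k)}. {x. q < (f (x + h *\<^sub>R v) - f x) / h})"
        using frequently_at_right_rat[OF cg _ pq(5) k] by auto
    qed
    then show "x \<in> (\<Union>pq\<in>{pq::real\<times>real. pq \<in> \<rat> \<times> \<rat> \<and> fst pq < snd pq}. E (fst pq) (snd pq))"
      using pq by auto
  qed
qed

lemma integral_lborel_translate:
  fixes g :: "'a::euclidean_space \<Rightarrow> real"
  assumes "g \<in> borel_measurable borel"
  shows "(\<integral>x. g (x + c) \<partial>lborel) = (\<integral>x. g x \<partial>lborel)"
proof -
  have "(\<integral>x. g x \<partial>lborel) = (\<integral>x. g x \<partial>distr lborel borel ((+) c))"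
    by (simp add: lborel_distr_plus)
  also have "\<dots> = (\<integral>x. g (c + x) \<partial>lborel)"
    by (rule integral_distr) (use assms in auto)
  finally show ?thesis by (simp add: add.commute)
qed

text \<open>Continuous cutoffs built from the distance to the complement converge to the indicator
  of an open set. Hence the finite measures with densities the positive and the negative part of
  \<open>h\<close> agree on all open sets, which generate the Borel sets and are stable under
  intersection.\<close>

lemma AE_zero_of_integral_continuous:
  fixes h :: "'a::euclidean_space \<Rightarrow> real"
  assumes h: "integrable lborel h"
    and zero: "\<And>\<phi>. continuous_on UNIV \<phi> \<Longrightarrow> (\<And>x. 0 \<le> \<phi> x \<and> \<phi> x \<le> 1) \<Longrightarrow> (\<integral>x. \<phi> x * h x \<partial>lborel) = 0"
  shows "AE x in lborel. h x = 0"
proof -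
  have [measurable]: "h \<in> borel_measurable borel" using h by auto
  have U0: "(\<integral>x. indicator U x * h x \<partial>lborel) = 0" if "open U" for U
  \<comment> \<open>The whole space is treated apart because \<open>infdist\<close> to the empty set
    is 0 by convention, so the cutoffs would vanish.\<close>
  proof (cases "U = UNIV")
    case True
    then show ?thesis using zero[of "\<lambda>_. 1"] by simp
  next
    case False
    define \<phi> where "\<phi> k x = min 1 (real k * infdist x (- U))" for k x
    have "(\<lambda>k. \<integral>x. \<phi> k x * h x \<partial>lborel) \<longlonglongrightarrow> (\<integral>x. indicator U x * h x \<partial>lborel)"
    proof (rule integral_dominated_convergence[where w="\<lambda>x. \<bar>h x\<bar>"])
      show "(\<lambda>x. indicator U x * h x) \<in> borel_measurable lborel" using \<open>open U\<close> by (intro borel_measurable_times borel_measurable_indicator) auto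
      have "continuous_on UNIV (\<phi> k)" for k unfolding \<phi>_def by (intro continuous_intros)
      then have [measurable]: "\<phi> k \<in> borel_measurable borel" for k by (simp add: borel_measurable_continuous_onI)
      show "(\<lambda>x. \<phi> k x * h x) \<in> borel_measurable lborel" for k by measurable
      show "integrable lborel (\<lambda>x. \<bar>h x\<bar>)" using h by simp
      have "\<bar>\<phi> k x\<bar> \<le> 1" for k x by (simp add: \<phi>_def infdist_nonneg)
      then have "\<bar>\<phi> k x * h x\<bar> \<le> 1 * \<bar>h x\<bar>" for k x unfolding abs_mult by (rule mult_right_mono) simp
      then show "AE x in lborel. norm (\<phi> k x * h x) \<le> \<bar>h x\<bar>" for k by simp
      have "(\<lambda>k. \<phi> k x) \<longlonglongrightarrow> indicator U x" for x
      proof (cases "x \<in> U")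
        case True
        have "infdist x (- U) > 0"
          using in_closed_iff_infdist_zero[of "- U" x] \<open>open U\<close> \<open>U \<noteq> UNIV\<close> True infdist_nonneg[of x "- U"]
          by (auto simp: less_le)
        then obtain N :: nat where "1 < real N * infdist x (- U)" using reals_Archimedean3 by blast
        then have "\<phi> k x = 1" if "k \<ge> N" for k
          using that mult_right_mono[of "real N" "real k" "infdist x (- U)"] infdist_nonneg[of x "- U"]
          by (auto simp: \<phi>_def)
        then show ?thesis using True by (intro tendsto_eventually) (auto simp: eventually_sequentially)
      next
        case False
        then show ?thesis by (simp add: \<phi>_def)
      qed
      then show "AE x in lborel. (\<lambda>k. \<phi> k x * h x) \<longlonglongrightarrow> indicator U x * h x"
        by (intro AE_I2 tendsto_mult tendsto_const)
    qed
    moreover have "(\<integral>x. \<phi> k x * h x \<partial>lborel) = 0" for k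
      by (rule zero) (auto simp: \<phi>_def infdist_nonneg intro!: continuous_intros)
    ultimately show ?thesis by (simp add: LIMSEQ_const_iff)
  qed
  define M1 where "M1 = density lborel (\<lambda>x. ennreal (h x))"
  define M2 where "M2 = density lborel (\<lambda>x. ennreal (- h x))"
  have fin: "(\<integral>\<^sup>+x. ennreal (h x) * indicator U x \<partial>lborel) < \<infinity>" "(\<integral>\<^sup>+x. ennreal (- h x) * indicator U x \<partial>lborel) < \<infinity>" for U
  proof -
    have fh: "(\<integral>\<^sup>+x. ennreal (norm (h x)) \<partial>lborel) < \<infinity>" using h by (simp add: integrable_iff_bounded)
    show "(\<integral>\<^sup>+x. ennreal (h x) * indicator U x \<partial>lborel) < \<infinity>"
      by (rule le_less_trans[OF nn_integral_mono fh]) (auto simp: indicator_def intro: ennreal_leI)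
    show "(\<integral>\<^sup>+x. ennreal (- h x) * indicator U x \<partial>lborel) < \<infinity>"
      by (rule le_less_trans[OF nn_integral_mono fh]) (auto simp: indicator_def intro: ennreal_leI)
  qed
  have eqU: "emeasure M1 U = emeasure M2 U" if "open U" for U
  proof -
    have int: "integrable lborel (\<lambda>x. indicator U x * h x)"
      by (rule Bochner_Integration.integrable_bound[OF h]) (use that in \<open>auto simp: abs_mult mult_left_le_one_le\<close>)
    have e: "ennreal (indicator U x * h x) = ennreal (h x) * indicator U x"
      "ennreal (- (indicator U x * h x)) = ennreal (- h x) * indicator U x" for x
      by (auto simp: indicator_def)
    have "enn2real (\<integral>\<^sup>+x. ennreal (h x) * indicator U x \<partial>lborel) - enn2real (\<integral>\<^sup>+x. ennreal (- h x) * indicator U x \<partial>lborel) = 0"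
      using U0[OF that] real_lebesgue_integral_def[OF int] by (simp only: e)
    then have "(\<integral>\<^sup>+x. ennreal (h x) * indicator U x \<partial>lborel) = (\<integral>\<^sup>+x. ennreal (- h x) * indicator U x \<partial>lborel)"
      using fin[of U] by (metis eq_iff_diff_eq_0 ennreal_enn2real infinity_ennreal_def)
    then show ?thesis using that by (simp add: M1_def M2_def emeasure_density)
  qed
  have "M1 = M2"
  proof (rule measure_eqI_generator_eq[where E="{U. open U}" and \<Omega>=UNIV and A="\<lambda>_. UNIV"])
    show "Int_stable {U::'a set. open U}" by (auto simp: Int_stable_def)
    show "sets M1 = sigma_sets UNIV {U. open U}" "sets M2 = sigma_sets UNIV {U. open U}"
      by (simp_all add: M1_def M2_def borel_def)
    show "emeasure M1 UNIV \<noteq> \<infinity>" using fin(1)[of UNIV] by (simp add: M1_def emeasure_density)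
  qed (use eqU in auto)
  then have "AE x in lborel. ennreal (h x) = ennreal (- h x)"
    unfolding M1_def M2_def by (intro sigma_finite_measure.density_unique[OF sigma_finite_lborel]) auto
  then show ?thesis
  proof eventually_elim
    case (elim x)
    show ?case
    proof (rule ccontr)
      assume "h x \<noteq> 0"
      then show False using elim by (cases "h x > 0") (auto simp: ennreal_neg ennreal_eq_0_iff)
    qed
  qed
qed

lemma integrable_indicator_cball: "integrable lborel (indicator (cball c r) :: 'a::euclidean_space \<Rightarrow> real)"
proof (rule integrable_real_indicator)
  show "emeasure lborel (cball c r) < \<infinity>" by (rule emeasure_lborel_cball_finite)
qed simp

section \<open>Difference quotients of Lipschitz functions with bounded support\<close>

definition forward_quotient :: "('a::real_vector \<Rightarrow> real) \<Rightarrow> 'a \<Rightarrow> nat \<Rightarrow> 'a \<Rightarrow> real" where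
  "forward_quotient f v k x = (f (x + (1 / real (Suc k)) *\<^sub>R v) - f x) / (1 / real (Suc k))"

text \<open>\<open>lim\<close> along a sequence of steps gives a Borel function defined everywhere,
  also at points without a limit, so it can be integrated as it stands.\<close>

definition forward_derivative :: "('a::real_vector \<Rightarrow> real) \<Rightarrow> 'a \<Rightarrow> 'a \<Rightarrow> real" where
  "forward_derivative f v x = lim (\<lambda>k. forward_quotient f v k x)"

lemma forward_derivative_eq:
  assumes "((\<lambda>t. (f (x + t *\<^sub>R v) - f x) / t) \<longlongrightarrow> l) (at_right 0)"
  shows "(\<lambda>k. forward_quotient f v k x) \<longlonglongrightarrow> l" "forward_derivative f v x = l"
proof -
  have "filterlim (\<lambda>k. 1 / real (Suc k)) (at_right 0) sequentially"
    unfolding filterlim_at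
    using LIMSEQ_inverse_real_of_nat by (auto simp: inverse_eq_divide eventually_sequentially)
  from filterlim_compose[OF assms this]
  show *: "(\<lambda>k. forward_quotient f v k x) \<longlonglongrightarrow> l" by (simp add: forward_quotient_def)
  then show "forward_derivative f v x = l" by (simp add: forward_derivative_def limI)
qed

locale lipschitz_bounded_support =
  fixes f :: "'a::euclidean_space \<Rightarrow> real" and L R :: real
  assumes lip: "\<bar>f x - f y\<bar> \<le> L * norm (x - y)"
    and supp: "R < norm x \<Longrightarrow> f x = 0"
begin

lemma continuous_f: "continuous_on UNIV f"
proof -
  obtain b :: 'a where "b \<in> Basis" using nonempty_Basis by blast
  then have "L \<ge> 0" using lip[of b 0] by simp
  then have "L-lipschitz_on UNIV f"
    using lip by (intro lipschitz_onI) (auto simp: dist_real_def dist_norm)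
  then show ?thesis by (rule lipschitz_on_continuous_on)
qed

lemma measurable_f[measurable]: "f \<in> borel_measurable borel"
  using continuous_f by (rule borel_measurable_continuous_onI)

lemma measurable_forward_quotient[measurable]: "forward_quotient f v k \<in> borel_measurable borel"
  unfolding forward_quotient_def[abs_def] by measurable

lemma measurable_forward_derivative[measurable]: "forward_derivative f v \<in> borel_measurable borel"
  unfolding forward_derivative_def[abs_def] by measurable

text \<open>A step moves a point by at most \<open>norm v\<close>, so both values in the quotient
  vanish outside this ball. The absolute value is there because \<open>R\<close> may be
  negative.\<close>

abbreviation bound :: "'a \<Rightarrow> 'a \<Rightarrow> real" where
  "bound v x \<equiv> (L * norm v) * indicator (cball 0 (\<bar>R\<bar> + norm v)) x"

lemma integrable_bound: "integrable lborel (bound v)"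
  by (intro integrable_mult_right integrable_indicator_cball)

lemma quotient_bound: "\<bar>forward_quotient f v k x\<bar> \<le> bound v x"
proof (cases "norm x \<le> \<bar>R\<bar> + norm v")
  case True
  have "\<bar>f (x + (1 / real (Suc k)) *\<^sub>R v) - f x\<bar> \<le> L * norm v * (1 / real (Suc k))"
    using lip[of "x + (1 / real (Suc k)) *\<^sub>R v" x] by simp
  then have "\<bar>f (x + (1 / real (Suc k)) *\<^sub>R v) - f x\<bar> / (1 / real (Suc k)) \<le> L * norm v"
    by (subst pos_divide_le_eq) auto
  then show ?thesis using True by (simp add: forward_quotient_def abs_mult)
next
  case False
  have "norm ((1 / real (Suc k)) *\<^sub>R v) \<le> norm v"
    by (simp add: field_simps mult_le_cancel_left1)
  then have "R < norm (x + (1 / real (Suc k)) *\<^sub>R v)" "R < norm x"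
    using False norm_diff_ineq[of x "(1 / real (Suc k)) *\<^sub>R v"] abs_ge_self[of R] norm_ge_zero[of v] by linarith+
  then have "f (x + (1 / real (Suc k)) *\<^sub>R v) = 0" "f x = 0" by (simp_all add: supp)
  then show ?thesis using False by (simp add: forward_quotient_def)
qed

lemma AE_forward_limit:
  "AE x in lborel. (\<lambda>k. forward_quotient f v k x) \<longlonglongrightarrow> forward_derivative f v x"
  using AE_directional_derivative[OF lip, of v]
proof eventually_elim
  case (elim x)
  then obtain l where "((\<lambda>t. (f (x + t *\<^sub>R v) - f x) / t) \<longlongrightarrow> l) (at_right 0)" by blast
  from forward_derivative_eq[OF this] show ?case by simp
qed

lemma AE_forward_bound: "AE x in lborel. \<bar>forward_derivative f v x\<bar> \<le> bound v x"
  using AE_forward_limit[of v]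
proof eventually_elim
  case (elim x)
  then have "(\<lambda>k. \<bar>forward_quotient f v k x\<bar>) \<longlonglongrightarrow> \<bar>forward_derivative f v x\<bar>" by (rule tendsto_rabs)
  then show ?case by (rule LIMSEQ_le_const2) (use quotient_bound in auto)
qed

lemma integrable_forward: "integrable lborel (forward_derivative f v)"
  by (rule Bochner_Integration.integrable_bound[OF integrable_bound[of v]])
     (use AE_forward_bound[of v] in \<open>auto elim!: eventually_mono\<close>)

text \<open>Dominated convergence with \<open>bound\<close>. The test function may vary with
  \<open>k\<close>, since the proof of additivity shifts it by a step that tends to 0.\<close>

lemma integral_forward_test:
  assumes [measurable]: "\<And>k. \<phi> k \<in> borel_measurable borel" "\<psi> \<in> borel_measurable borel"
    and bd: "\<And>k x. \<bar>\<phi> k x\<bar> \<le> 1" and lim: "\<And>x. (\<lambda>k. \<phi> k x) \<longlonglongrightarrow> \<psi> x"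
  shows "(\<lambda>k. \<integral>x. \<phi> k x * forward_quotient f v k x \<partial>lborel) \<longlonglongrightarrow> (\<integral>x. \<psi> x * forward_derivative f v x \<partial>lborel)"
proof (rule integral_dominated_convergence[where w="bound v"])
  have "\<bar>\<phi> k x\<bar> * \<bar>forward_quotient f v k x\<bar> \<le> 1 * bound v x" for k x
    by (rule mult_mono[OF bd quotient_bound]) auto
  then show "AE x in lborel. norm (\<phi> k x * forward_quotient f v k x) \<le> bound v x" for k
    by (simp add: abs_mult)
  show "AE x in lborel. (\<lambda>k. \<phi> k x * forward_quotient f v k x) \<longlonglongrightarrow> \<psi> x * forward_derivative f v x"
    using AE_forward_limit[of v] by eventually_elim (intro tendsto_mult lim)
  show "integrable lborel (bound v)" by (rule integrable_bound)
qed (use measurable_forward_quotient measurable_forward_derivative assms in \<open>auto intro!: borel_measurable_times\<close>)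

lemma integral_forward_quotient: "(\<integral>x. forward_quotient f v k x \<partial>lborel) = 0"
proof -
  have f_int: "integrable lborel (\<lambda>x. f (x + c))" for c
  proof (rule Bochner_Integration.integrable_bound)
    show "integrable lborel (\<lambda>x. (\<bar>f 0\<bar> + L * (\<bar>R\<bar> + norm c + norm c)) * indicator (cball 0 (\<bar>R\<bar> + norm c)) x)"
      by (intro integrable_mult_right integrable_indicator_cball)
    obtain b :: 'a where "b \<in> Basis" using nonempty_Basis by blast
    then have "L \<ge> 0" using lip[of b 0] by simp
    have "\<bar>f (x + c)\<bar> \<le> \<bar>(\<bar>f 0\<bar> + L * (\<bar>R\<bar> + norm c + norm c)) * indicator (cball 0 (\<bar>R\<bar> + norm c)) x\<bar>" for x
    proof (cases "norm x \<le> \<bar>R\<bar> + norm c")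
      case True
      have "\<bar>f (x + c)\<bar> \<le> \<bar>f 0\<bar> + L * norm (x + c)" using lip[of "x + c" 0] by simp
      also have "L * norm (x + c) \<le> L * (\<bar>R\<bar> + norm c + norm c)"
        using \<open>L \<ge> 0\<close> True norm_triangle_ineq[of x c] by (intro mult_left_mono) auto
      finally show ?thesis using True by simp
    next
      case False
      then have "R < norm (x + c)" using norm_diff_ineq[of x c] by auto
      then show ?thesis by (simp add: supp)
    qed
    then show "AE x in lborel. norm (f (x + c)) \<le> norm ((\<bar>f 0\<bar> + L * (\<bar>R\<bar> + norm c + norm c)) * indicator (cball 0 (\<bar>R\<bar> + norm c)) x :: real)"
      by simp
  qed measurable
  have "(\<integral>x. f (x + c) - f x \<partial>lborel) = 0" for c
    using f_int[of c] f_int[of 0] integral_lborel_translate[OF measurable_f, of c] by simp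
  then show ?thesis by (simp add: forward_quotient_def)
qed

lemma integral_forward_derivative: "(\<integral>x. forward_derivative f v x \<partial>lborel) = 0"
  using integral_forward_test[of "\<lambda>_ _. 1" "\<lambda>_. 1" v]
  by (simp add: integral_forward_quotient LIMSEQ_const_iff)

text \<open>Shifting the difference quotient in direction \<open>v\<close> by the vanishing step in direction \<open>w\<close> moves the
  shift to the continuous test function, where it disappears in the limit.\<close>

lemma AE_forward_derivative_add:
  "AE x in lborel. forward_derivative f (v + w) x = forward_derivative f v x + forward_derivative f w x"
proof -
  define h where "h x = forward_derivative f (v + w) x - (forward_derivative f v x + forward_derivative f w x)" for x
  have h_int: "integrable lborel h"
    unfolding h_def[abs_def] by (intro Bochner_Integration.integrable_diff Bochner_Integration.integrable_add integrable_forward)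
  have "AE x in lborel. h x = 0"
  proof (rule AE_zero_of_integral_continuous[OF h_int])
    fix \<phi> :: "'a \<Rightarrow> real" assume c\<phi>: "continuous_on UNIV \<phi>" and \<phi>: "\<And>x. 0 \<le> \<phi> x \<and> \<phi> x \<le> 1"
    have [measurable]: "\<phi> \<in> borel_measurable borel" using c\<phi> by (rule borel_measurable_continuous_onI)
    have \<phi>': "\<bar>\<phi> x\<bar> \<le> 1" for x using \<phi>[of x] by auto
    have prod_int: "integrable lborel (\<lambda>x. g x * F x)"
      if "integrable lborel F" "g \<in> borel_measurable borel" "\<And>x. \<bar>g x\<bar> \<le> 1" for g F :: "'a \<Rightarrow> real"
    proof (rule Bochner_Integration.integrable_bound[OF that(1)])
      have "\<bar>g x\<bar> * \<bar>F x\<bar> \<le> 1 * \<bar>F x\<bar>" for x by (intro mult_right_mono that) auto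
      then show "AE x in lborel. norm (g x * F x) \<le> norm (F x)" by (simp add: abs_mult)
      show "(\<lambda>x. g x * F x) \<in> borel_measurable lborel" using that by auto
    qed
    have q_int: "integrable lborel (\<lambda>x. forward_quotient f u k x)" for u k
      by (rule Bochner_Integration.integrable_bound[OF integrable_bound[of u]])
         (use order_trans[OF quotient_bound abs_ge_self] in auto)
    define c where "c k = (1 / real (Suc k)) *\<^sub>R w" for k
    \<comment> \<open>The increment along \<open>v + w\<close> is split at the intermediate point
      reached by the step along \<open>w\<close>; the remaining increment is a quotient along
      \<open>v\<close> based at that point.\<close>
    have shift: "\<phi> x * forward_quotient f (v + w) k x =
        \<phi> (x + c k - c k) * forward_quotient f v k (x + c k) + \<phi> x * forward_quotient f w k x" for k x
      by (simp add: forward_quotient_def c_def algebra_simps add_divide_distrib diff_divide_distrib)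
    have "(\<integral>x. \<phi> x * forward_quotient f (v + w) k x \<partial>lborel) =
        (\<integral>x. \<phi> (x - c k) * forward_quotient f v k x \<partial>lborel) + (\<integral>x. \<phi> x * forward_quotient f w k x \<partial>lborel)" for k
    proof -
      let ?G = "\<lambda>x. \<phi> (x - c k) * forward_quotient f v k x"
      have "?G \<in> borel_measurable borel" by measurable
      from integral_lborel_translate[OF this, of "c k"]
      have 1: "(\<integral>x. ?G (x + c k) \<partial>lborel) = (\<integral>x. ?G x \<partial>lborel)" .
      have Wi: "integrable lborel (\<lambda>x. \<phi> x * forward_quotient f w k x)" "integrable lborel (\<lambda>x. \<phi> x * forward_quotient f (v + w) k x)"
        by (rule prod_int[OF q_int]; use \<phi>' in auto)+
      have eq: "?G (x + c k) = \<phi> x * forward_quotient f (v + w) k x - \<phi> x * forward_quotient f w k x" for x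
        using shift[of x k] by simp
      have "(\<integral>x. ?G (x + c k) \<partial>lborel) = (\<integral>x. \<phi> x * forward_quotient f (v + w) k x \<partial>lborel) - (\<integral>x. \<phi> x * forward_quotient f w k x \<partial>lborel)"
        unfolding eq by (rule Bochner_Integration.integral_diff[OF Wi(2,1)])
      then show ?thesis using 1 by simp
    qed
    moreover have "(\<lambda>k. \<integral>x. \<phi> x * forward_quotient f (v + w) k x \<partial>lborel) \<longlonglongrightarrow> (\<integral>x. \<phi> x * forward_derivative f (v + w) x \<partial>lborel)"
      by (rule integral_forward_test) (use \<phi>' in auto)
    moreover have "(\<lambda>k. (\<integral>x. \<phi> (x - c k) * forward_quotient f v k x \<partial>lborel) + (\<integral>x. \<phi> x * forward_quotient f w k x \<partial>lborel))
        \<longlonglongrightarrow> (\<integral>x. \<phi> x * forward_derivative f v x \<partial>lborel) + (\<integral>x. \<phi> x * forward_derivative f w x \<partial>lborel)"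
    proof (intro tendsto_add integral_forward_test)
      have "c \<longlonglongrightarrow> 0 *\<^sub>R w" unfolding c_def[abs_def]
        by (intro tendsto_intros) (use LIMSEQ_inverse_real_of_nat in \<open>simp add: inverse_eq_divide\<close>)
      then have "(\<lambda>k. x - c k) \<longlonglongrightarrow> x - 0" for x by (intro tendsto_intros) simp
      then show "(\<lambda>k. \<phi> (x - c k)) \<longlonglongrightarrow> \<phi> x" for x
        using c\<phi> by (auto simp: continuous_on_eq_continuous_at intro: isCont_tendsto_compose)
    qed (use \<phi>' in auto)
    ultimately have eq: "(\<integral>x. \<phi> x * forward_derivative f (v + w) x \<partial>lborel) =
       (\<integral>x. \<phi> x * forward_derivative f v x \<partial>lborel) + (\<integral>x. \<phi> x * forward_derivative f w x \<partial>lborel)"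
      using LIMSEQ_unique by simp
    have i: "integrable lborel (\<lambda>x. \<phi> x * forward_derivative f u x)" for u
      by (rule prod_int[OF integrable_forward]) (use \<phi>' in auto)
    show "(\<integral>x. \<phi> x * h x \<partial>lborel) = 0"
      using eq i by (simp add: h_def algebra_simps)
  qed
  then show ?thesis by eventually_elim (simp add: h_def)
qed

end

section \<open>From directional derivatives to the total derivative\<close>

context lipschitz_bounded_support
begin

text \<open>Outside one null set, derivatives in all rational directions exist and are additive, so
  they are the values of a linear map \<open>S\<close>. Finitely many rational directions
  approximate the unit sphere, and the Lipschitz bound controls the error of replacing a direction
  by a nearby one; this makes the convergence uniform in the direction.\<close>

lemma AE_differentiable: "AE x in lborel. f differentiable (at x)"
proof -
  obtain b0 :: 'a where "b0 \<in> Basis" using nonempty_Basis by blast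
  then have L0: "L \<ge> 0" using lip[of b0 0] by simp
  \<comment> \<open>Directions with rational coordinates: countable, so that the exceptional null
    sets can be united, and dense.\<close>
  define D :: "'a set" where "D = {v. \<forall>b\<in>Basis. v \<bullet> b \<in> \<rat>}"
  have "D \<subseteq> (\<lambda>c. \<Sum>b\<in>Basis. c b *\<^sub>R b) ` (Basis \<rightarrow>\<^sub>E \<rat>)"
  proof
    fix v assume "v \<in> D"
    then have "restrict (\<lambda>b. v \<bullet> b) Basis \<in> Basis \<rightarrow>\<^sub>E \<rat>" by (auto simp: D_def)
    moreover have "v = (\<Sum>b\<in>Basis. restrict (\<lambda>b. v \<bullet> b) Basis b *\<^sub>R b)"
      by (simp add: euclidean_representation)
    ultimately show "v \<in> (\<lambda>c. \<Sum>b\<in>Basis. c b *\<^sub>R b) ` (Basis \<rightarrow>\<^sub>E \<rat>)" by blast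
  qed
  then have cD: "countable D"
    by (rule countable_subset) (intro countable_image countable_PiE finite_Basis countable_rat)
  have D_basis: "r *\<^sub>R b \<in> D" if "r \<in> \<rat>" "b \<in> Basis" for r b
    using that by (auto simp: D_def inner_Basis)
  have D_sum: "v \<in> D \<Longrightarrow> w \<in> D \<Longrightarrow> v + w \<in> D" for v w by (auto simp: D_def inner_add_left)
  have "AE x in lborel. \<forall>v\<in>D. \<exists>l. ((\<lambda>t. (f (x + t *\<^sub>R v) - f x) / t) \<longlongrightarrow> l) (at_right 0)"
    using AE_directional_derivative[OF lip] by (simp add: AE_ball_countable[OF cD])
  moreover have "AE x in lborel. \<forall>v\<in>D. \<forall>w\<in>D. forward_derivative f (v + w) x = forward_derivative f v x + forward_derivative f w x"
    using AE_forward_derivative_add by (simp add: AE_ball_countable[OF cD])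
  ultimately show ?thesis
  proof eventually_elim
    case (elim x)
    define T where "T v = forward_derivative f v x" for v
    have Tlim: "((\<lambda>t. (f (x + t *\<^sub>R v) - f x) / t) \<longlongrightarrow> T v) (at_right 0)" if v: "v \<in> D" for v
    proof -
      obtain l where l: "((\<lambda>t. (f (x + t *\<^sub>R v) - f x) / t) \<longlongrightarrow> l) (at_right 0)" using elim(1) v by blast
      then show ?thesis using forward_derivative_eq(2)[OF l] by (simp add: T_def)
    qed
    have T_add: "T (v + w) = T v + T w" if "v \<in> D" "w \<in> D" for v w
      using elim(2) that by (auto simp: T_def)
    have "0 \<in> D" by (simp add: D_def)
    then have T0: "T 0 = 0" using T_add[of 0 0] by simp
    have T_pos: "T (r *\<^sub>R v) = r * T v" if "r \<in> \<rat>" "r > 0" "v \<in> D" for r v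
    proof -
      have rv: "r *\<^sub>R v \<in> D" using that by (auto simp: D_def)
      have "filterlim (\<lambda>t. r * t) (at_right 0) (at_right 0)"
        unfolding filterlim_at using \<open>r > 0\<close>
        by (auto intro!: tendsto_eq_intros eventually_mono[OF eventually_at_right_less])
      from filterlim_compose[OF Tlim[OF \<open>v \<in> D\<close>] this]
      have "((\<lambda>t. r * ((f (x + (r * t) *\<^sub>R v) - f x) / (r * t))) \<longlongrightarrow> r * T v) (at_right 0)"
        by (intro tendsto_intros)
      then have "((\<lambda>t. (f (x + t *\<^sub>R (r *\<^sub>R v)) - f x) / t) \<longlongrightarrow> r * T v) (at_right 0)"
        using \<open>r > 0\<close> by (simp add: mult.commute)
      from tendsto_unique[OF _ Tlim[OF rv] this] show ?thesis by simp
    qed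
    have T_scale: "T (r *\<^sub>R v) = r * T v" if "r \<in> \<rat>" "v \<in> D" for r v
    proof -
      consider "r > 0" | "r = 0" | "r < 0" by linarith
      then show ?thesis
      proof cases
        \<comment> \<open>The limits are one-sided, so negative factors are reached through
          additivity: the values at \<open>(- r) *\<^sub>R v\<close> and
          \<open>r *\<^sub>R v\<close> add up to \<open>T 0 = 0\<close>.\<close>
        case 3
        have "(- r) *\<^sub>R v \<in> D" "r *\<^sub>R v \<in> D" using that by (auto simp: D_def)
        from T_add[OF this] have "T ((- r) *\<^sub>R v) + T (r *\<^sub>R v) = 0"
          using T0 by (simp add: scaleR_left_distrib[symmetric])
        then show ?thesis using T_pos[of "- r" v] that 3 by simp
      qed (use T_pos that T0 in auto)
    qed
    define S where "S v = (\<Sum>b\<in>Basis. (v \<bullet> b) * T b)" for v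
    have TS: "T v = S v" if "v \<in> D" for v
    proof -
      have "(\<Sum>b\<in>B. (v \<bullet> b) *\<^sub>R b) \<in> D \<and> T (\<Sum>b\<in>B. (v \<bullet> b) *\<^sub>R b) = (\<Sum>b\<in>B. (v \<bullet> b) * T b)"
        if "finite B" "B \<subseteq> Basis" for B
        using that
      proof (induction B)
        case empty then show ?case using \<open>0 \<in> D\<close> T0 by simp
      next
        case (insert b B)
        have vb: "v \<bullet> b \<in> \<rat>" "b \<in> Basis" "b \<in> D"
          using \<open>v \<in> D\<close> insert D_basis[of 1 b] by (auto simp: D_def)
        then show ?case
          using insert D_basis[OF vb(1,2)] D_sum T_add T_scale[OF vb(1,3)] by simp
      qed
      from this[OF finite_Basis subset_refl] show ?thesis by (simp add: S_def euclidean_representation)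
    qed
    have S_lin: "linear S"
      by (rule linearI) (simp_all add: S_def inner_add_left algebra_simps sum.distrib sum_distrib_left)
    then obtain K where K: "K > 0" "\<And>v. \<bar>S v\<bar> \<le> K * norm v"
      using linear_bounded_pos[OF S_lin] by (auto simp: mult.commute)
    have dense: "\<exists>d\<in>D. dist u d < e" if "e > 0" for u :: 'a and e
    proof -
      let ?e = "e / (2 * DIM('a))"
      have "\<forall>b\<in>(Basis :: 'a set). \<exists>r\<in>\<rat>. u \<bullet> b < r \<and> r < u \<bullet> b + ?e"
        using \<open>e > 0\<close> by (intro ballI Rats_dense_in_real) auto
      then obtain r where r: "\<And>b. b \<in> (Basis :: 'a set) \<Longrightarrow> r b \<in> \<rat> \<and> u \<bullet> b < r b \<and> r b < u \<bullet> b + ?e" by metis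
      define d where "d = (\<Sum>b\<in>Basis. r b *\<^sub>R b)"
      have db: "d \<bullet> b = r b" if "b \<in> Basis" for b using that by (simp add: d_def)
      then have "d \<in> D" using r by (simp add: D_def)
      have "dist u d \<le> (\<Sum>b\<in>Basis. \<bar>(u - d) \<bullet> b\<bar>)" unfolding dist_norm by (rule norm_le_l1)
      also have "\<dots> \<le> (\<Sum>b\<in>(Basis :: 'a set). ?e)"
        by (intro sum_mono) (use r db in \<open>force simp: inner_diff_left\<close>)
      also have "\<dots> < e" using \<open>e > 0\<close> by simp
      finally show ?thesis using \<open>d \<in> D\<close> by blast
    qed
    have "(f has_derivative S) (at x)"
      unfolding has_derivative_at_alt
    proof (intro conjI allI impI)
      show "bounded_linear S" using S_lin by (simp add: linear_conv_bounded_linear)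
      fix e :: real assume "e > 0"
      \<comment> \<open>Three errors occur, each relative to the distance \<open>t\<close>:
        \<open>L * \<eta>\<close> for moving \<open>f\<close> to the direction \<open>d\<close>,
        \<open>\<eta>\<close> for the difference quotient along \<open>d\<close>, and
        \<open>K * \<eta>\<close> for moving \<open>S\<close> back.\<close>
      define \<eta> where "\<eta> = e / (L + K + 1)"
      have "\<eta> > 0" using \<open>e > 0\<close> L0 K by (simp add: \<eta>_def)
      have sph: "sphere (0::'a) 1 \<subseteq> (\<Union>d\<in>D. ball d \<eta>)" using dense[OF \<open>\<eta> > 0\<close>] by (auto simp: dist_commute)
      obtain D0 where D0: "D0 \<subseteq> D" "finite D0" "sphere (0::'a) 1 \<subseteq> (\<Union>d\<in>D0. ball d \<eta>)"
        by (rule compactE_image[OF compact_sphere _ sph]) auto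
      have "\<forall>d\<in>D0. \<forall>\<^sub>F t in at_right 0. \<bar>(f (x + t *\<^sub>R d) - f x) / t - S d\<bar> < \<eta>"
        using Tlim TS D0(1) tendstoD[OF _ \<open>\<eta> > 0\<close>] by (fastforce simp: dist_real_def)
      then have "\<forall>\<^sub>F t in at_right 0. \<forall>d\<in>D0. \<bar>(f (x + t *\<^sub>R d) - f x) / t - S d\<bar> < \<eta>"
        using D0(2) by (simp add: eventually_ball_finite)
      then obtain \<delta> where \<delta>: "\<delta> > 0" "\<And>t d. 0 < t \<Longrightarrow> t < \<delta> \<Longrightarrow> d \<in> D0 \<Longrightarrow> \<bar>(f (x + t *\<^sub>R d) - f x) / t - S d\<bar> < \<eta>"
        unfolding eventually_at_right_field by auto
      show "\<exists>d>0. \<forall>y. norm (y - x) < d \<longrightarrow> norm (f y - f x - S (y - x)) \<le> e * norm (y - x)"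
      proof (intro exI[of _ \<delta>] conjI allI impI)
        fix y assume y: "norm (y - x) < \<delta>"
        show "norm (f y - f x - S (y - x)) \<le> e * norm (y - x)"
        proof (cases "y = x")
          case True then show ?thesis using linear_0[OF S_lin] by simp
        next
          case False
          define t where "t = norm (y - x)"
          have t: "0 < t" "t < \<delta>" using y False by (auto simp: t_def)
          define u where "u = (1 / t) *\<^sub>R (y - x)"
          have yu: "y = x + t *\<^sub>R u" using t by (simp add: u_def)
          have "norm u = 1" using t by (simp add: u_def t_def)
          then obtain d where d: "d \<in> D0" "dist d u < \<eta>" using D0(3) by (auto simp: subset_iff)
          have 1: "\<bar>f y - f (x + t *\<^sub>R d)\<bar> \<le> L * (t * \<eta>)"
          proof -
            have "\<bar>f y - f (x + t *\<^sub>R d)\<bar> \<le> L * norm (t *\<^sub>R (u - d))"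
              using lip[of y "x + t *\<^sub>R d"] by (simp add: yu scaleR_diff_right)
            also have "\<dots> \<le> L * (t * \<eta>)"
              using d t L0 by (intro mult_left_mono) (auto simp: dist_norm norm_minus_commute)
            finally show ?thesis .
          qed
          have 2: "\<bar>f (x + t *\<^sub>R d) - f x - t * S d\<bar> \<le> t * \<eta>"
          proof -
            have "\<bar>f (x + t *\<^sub>R d) - f x - t * S d\<bar> = t * \<bar>(f (x + t *\<^sub>R d) - f x) / t - S d\<bar>"
              using t by (simp add: abs_mult_pos[symmetric] field_simps abs_mult)
            also have "\<dots> \<le> t * \<eta>" using \<delta>(2)[OF t d(1)] t by (intro mult_left_mono) auto
            finally show ?thesis .
          qed
          have 3: "\<bar>t * S d - S (y - x)\<bar> \<le> K * (t * \<eta>)"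
          proof -
            have "t * S d - S (y - x) = S (t *\<^sub>R (d - u))"
              using S_lin by (simp add: yu linear_diff linear_scale linear_add right_diff_distrib)
            then have "\<bar>t * S d - S (y - x)\<bar> \<le> K * norm (t *\<^sub>R (d - u))" using K(2) by metis
            also have "\<dots> \<le> K * (t * \<eta>)"
              using d t K(1) by (intro mult_left_mono) (auto simp: dist_norm)
            finally show ?thesis .
          qed
          have "\<bar>f y - f x - S (y - x)\<bar> \<le> (L + K + 1) * \<eta> * t"
            using 1 2 3 by (simp add: algebra_simps)
          also have "(L + K + 1) * \<eta> = e" using L0 K by (simp add: \<eta>_def)
          finally show ?thesis by (simp add: t_def)
        qed
      qed (use \<delta> in auto)
    qed
    then show ?case by (rule differentiableI)
  qed
qed

lemma forward_derivative_eq_frechet: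
  assumes "f differentiable (at x)"
  shows "forward_derivative f v x = frechet_derivative f (at x) v"
proof (rule forward_derivative_eq(2))
  let ?D = "frechet_derivative f (at x)"
  have D: "(f has_derivative ?D) (at x)" using assms by (simp add: frechet_derivative_works)
  have "((\<lambda>t. f (x + t *\<^sub>R v)) has_derivative (\<lambda>t. ?D (t *\<^sub>R v))) (at 0)"
    by (rule has_derivative_compose[of "\<lambda>t. x + t *\<^sub>R v" "\<lambda>t. t *\<^sub>R v"]) (auto intro!: derivative_eq_intros D)
  moreover have "?D (t *\<^sub>R v) = ?D v * t" for t
    using linear_scale[OF has_derivative_linear[OF D], of t v] by simp
  ultimately have "((\<lambda>t. f (x + t *\<^sub>R v)) has_field_derivative ?D v) (at 0)"
    by (simp add: has_field_derivative_def mult_commute_abs)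
  then have "((\<lambda>t. (f (x + t *\<^sub>R v) - f x) / t) \<longlongrightarrow> ?D v) (at 0)"
    by (simp add: DERIV_def)
  then show "((\<lambda>t. (f (x + t *\<^sub>R v) - f x) / t) \<longlongrightarrow> ?D v) (at_right 0)"
    by (rule tendsto_mono[rotated]) (simp add: at_le)
qed

end

section \<open>Calculus of continuously differentiable maps\<close>

text \<open>This is \<open>Ck_on 1\<close> unfolded, so continuity of the derivative is recorded for
  each fixed direction.\<close>

definition C1_on :: "('a::real_normed_vector \<Rightarrow> 'b::real_normed_vector) \<Rightarrow> 'a set \<Rightarrow> bool" where
  "C1_on f S \<longleftrightarrow> (\<forall>x\<in>S. f differentiable at x) \<and> (\<forall>v. continuous_on S (\<lambda>x. frechet_derivative f (at x) v))"

lemma C1_onI: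
  assumes "\<And>x. x \<in> S \<Longrightarrow> (f has_derivative f' x) (at x)" "\<And>v. continuous_on S (\<lambda>x. f' x v)"
  shows "C1_on f S"
  unfolding C1_on_def
proof (intro conjI ballI allI)
  show "f differentiable at x" if "x \<in> S" for x using assms(1)[OF that] by (rule differentiableI)
  fix v
  show "continuous_on S (\<lambda>x. frechet_derivative f (at x) v)"
    using assms(2)[of v] by (rule continuous_on_eq) (use frechet_derivative_at[OF assms(1)] in auto)
qed

lemma C1_onD:
  assumes "C1_on f S"
  shows "x \<in> S \<Longrightarrow> (f has_derivative frechet_derivative f (at x)) (at x)"
    and "continuous_on S (\<lambda>x. frechet_derivative f (at x) v)"
    and "continuous_on S f"
proof -
  have d: "f differentiable at x" if "x \<in> S" for x using assms that by (simp add: C1_on_def)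
  then show "x \<in> S \<Longrightarrow> (f has_derivative frechet_derivative f (at x)) (at x)"
    by (simp add: frechet_derivative_works[symmetric])
  show "continuous_on S (\<lambda>x. frechet_derivative f (at x) v)" using assms by (simp add: C1_on_def)
  show "continuous_on S f"
    by (rule differentiable_imp_continuous_on) (auto simp: differentiable_on_def intro: differentiable_at_withinI d)
qed

lemma Ck_on_2D:
  assumes "Ck_on 2 f S"
  shows "C1_on f S" "C1_on (\<lambda>x. frechet_derivative f (at x) v) S"
proof -
  have *: "\<And>x. x \<in> S \<Longrightarrow> f differentiable at x" "\<And>v. C1_on (\<lambda>x. frechet_derivative f (at x) v) S"
    using assms by (simp_all add: numeral_2_eq_2 C1_on_def)
  then show "C1_on (\<lambda>x. frechet_derivative f (at x) v) S" by blast
  show "C1_on f S" unfolding C1_on_def[of f] using * C1_onD(3) by blast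
qed

lemma C1_on_cong:
  assumes "C1_on f S" "open S" "\<And>x. x \<in> S \<Longrightarrow> f x = g x"
  shows "C1_on g S"
proof (rule C1_onI)
  show "(g has_derivative frechet_derivative f (at x)) (at x)" if "x \<in> S" for x
    by (rule has_derivative_transform_within_open[OF C1_onD(1)[OF assms(1) that] assms(2) that assms(3)])
qed (rule C1_onD(2)[OF assms(1)])

lemma frechet_derivative_bounded_linear:
  assumes "bounded_linear h" "f differentiable at x"
  shows "frechet_derivative (\<lambda>y. h (f y)) (at x) v = h (frechet_derivative f (at x) v)"
proof -
  have "((\<lambda>y. h (f y)) has_derivative (\<lambda>v. h (frechet_derivative f (at x) v))) (at x)"
    by (rule bounded_linear.has_derivative[OF assms(1)]) (use assms in \<open>simp add: frechet_derivative_works\<close>)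
  from fun_cong[OF frechet_derivative_at[OF this, symmetric]] show ?thesis .
qed

lemma C1_on_const: "C1_on (\<lambda>_. c) S"
  by (rule C1_onI[where f'="\<lambda>_ _. 0"]) auto

lemma C1_on_add:
  assumes "C1_on f S" "C1_on g S" shows "C1_on (\<lambda>x. f x + g x) S"
  by (rule C1_onI[where f'="\<lambda>x v. frechet_derivative f (at x) v + frechet_derivative g (at x) v"])
    (auto intro!: has_derivative_add continuous_intros C1_onD[OF assms(1)] C1_onD[OF assms(2)])

lemma C1_on_sum:
  assumes "\<And>i. i \<in> I \<Longrightarrow> C1_on (f i) S" shows "C1_on (\<lambda>x. \<Sum>i\<in>I. f i x) S"
proof (cases "finite I")
  case True
  then show ?thesis using assms by (induction I) (auto intro!: C1_on_const C1_on_add)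
qed (simp add: C1_on_const)

lemma C1_on_bounded_linear:
  assumes "bounded_linear h" "C1_on f S" shows "C1_on (\<lambda>x. h (f x)) S"
  by (rule C1_onI[where f'="\<lambda>x v. h (frechet_derivative f (at x) v)"])
    (auto intro!: bounded_linear.has_derivative[OF assms(1)] bounded_linear.continuous_on[OF assms(1)] C1_onD[OF assms(2)])

lemma C1_on_bounded_bilinear:
  assumes "bounded_bilinear h" "C1_on f S" "C1_on g S" shows "C1_on (\<lambda>x. h (f x) (g x)) S"
  by (rule C1_onI[where f'="\<lambda>x v. h (f x) (frechet_derivative g (at x) v) + h (frechet_derivative f (at x) v) (g x)"])
    (auto intro!: bounded_bilinear.FDERIV[OF assms(1)] continuous_intros bounded_bilinear.continuous_on[OF assms(1)]
      C1_onD[OF assms(2)] C1_onD[OF assms(3)])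

lemmas C1_on_mult = C1_on_bounded_bilinear[OF bounded_bilinear_mult]

lemma C1_on_prod:
  fixes f :: "'i \<Rightarrow> 'a::real_normed_vector \<Rightarrow> real"
  assumes "\<And>i. i \<in> I \<Longrightarrow> C1_on (f i) S" shows "C1_on (\<lambda>x. \<Prod>i\<in>I. f i x) S"
proof (cases "finite I")
  case True
  then show ?thesis using assms by (induction I) (auto intro!: C1_on_const C1_on_mult)
qed (simp add: C1_on_const)

lemma C1_on_real_compose:
  fixes f :: "'a::real_normed_vector \<Rightarrow> real"
  assumes "C1_on f S" and "\<And>x. x \<in> S \<Longrightarrow> (h has_real_derivative h' (f x)) (at (f x))"
    and "continuous_on (f ` S) h'"
  shows "C1_on (\<lambda>x. h (f x)) S"
proof (rule C1_onI[where f'="\<lambda>x v. h' (f x) * frechet_derivative f (at x) v"])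
  fix x assume "x \<in> S"
  show "((\<lambda>x. h (f x)) has_derivative (\<lambda>v. h' (f x) * frechet_derivative f (at x) v)) (at x)"
    by (rule has_derivative_compose[OF C1_onD(1)[OF assms(1) \<open>x \<in> S\<close>]])
      (use assms(2)[OF \<open>x \<in> S\<close>] in \<open>simp add: has_field_derivative_def\<close>)
qed (intro continuous_intros continuous_on_compose2[OF assms(3)] C1_onD[OF assms(1)] order_refl)

lemma C1_on_inverse:
  fixes f :: "'a::real_normed_vector \<Rightarrow> real"
  assumes "C1_on f S" "\<And>x. x \<in> S \<Longrightarrow> f x \<noteq> 0" shows "C1_on (\<lambda>x. inverse (f x)) S"
  by (rule C1_on_real_compose[OF assms(1), where h'="\<lambda>y. - (inverse y * inverse y)"])
    (use assms(2) in \<open>auto intro!: derivative_eq_intros continuous_intros\<close>)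

lemma C1_on_sqrt:
  fixes f :: "'a::real_normed_vector \<Rightarrow> real"
  assumes "C1_on f S" "\<And>x. x \<in> S \<Longrightarrow> f x > 0" shows "C1_on (\<lambda>x. sqrt (f x)) S"
  by (rule C1_on_real_compose[OF assms(1), where h'="\<lambda>y. inverse (sqrt y) / 2"])
    (use assms(2) in \<open>auto intro!: DERIV_real_sqrt continuous_intros simp: less_imp_neq[symmetric] dest!: less_imp_neq\<close>)

text \<open>The derivative is known to be continuous only direction by direction, so its operator
  norm is bounded by the sum of the norms of its values on \<open>Basis\<close>. Convexity then
  permits the mean value inequality.\<close>

lemma C1_on_lipschitz_compact:
  fixes f :: "'a::euclidean_space \<Rightarrow> 'b::real_normed_vector"
  assumes f: "C1_on f S" and K: "compact K" "convex K" "K \<subseteq> S"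
  obtains L where "L \<ge> 0" "\<And>x y. x \<in> K \<Longrightarrow> y \<in> K \<Longrightarrow> norm (f x - f y) \<le> L * norm (x - y)"
proof -
  let ?D = "\<lambda>x. frechet_derivative f (at x)"
  have D: "(f has_derivative ?D x) (at x)" if "x \<in> K" for x using C1_onD(1)[OF f] that K by blast
  have "continuous_on K (\<lambda>x. \<Sum>b\<in>Basis. norm (?D x b))"
    by (intro continuous_intros continuous_on_subset[OF C1_onD(2)[OF f] K(3)])
  then have "compact ((\<lambda>x. \<Sum>b\<in>Basis. norm (?D x b)) ` K)" using K(1) by (rule compact_continuous_image)
  then have "bounded ((\<lambda>x. \<Sum>b\<in>Basis. norm (?D x b)) ` K)" by (rule compact_imp_bounded)
  then obtain L where L: "\<And>x. x \<in> K \<Longrightarrow> \<bar>\<Sum>b\<in>Basis. norm (?D x b)\<bar> \<le> L"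
    by (auto simp: bounded_iff)
  have on: "onorm (?D x) \<le> \<bar>L\<bar>" if "x \<in> K" for x
  proof (rule onorm_le)
    fix v
    have lin: "linear (?D x)" using D[OF that] by (rule has_derivative_linear)
    have "norm (?D x v) = norm (\<Sum>b\<in>Basis. (v \<bullet> b) *\<^sub>R ?D x b)"
      by (subst (1) euclidean_representation[of v, symmetric]) (simp add: linear_sum[OF lin] linear_scale[OF lin])
    also have "\<dots> \<le> (\<Sum>b\<in>Basis. norm v * norm (?D x b))"
      by (rule order_trans[OF norm_sum]) (auto intro!: sum_mono mult_right_mono Basis_le_norm)
    also have "\<dots> = norm v * (\<Sum>b\<in>Basis. norm (?D x b))" by (simp add: sum_distrib_left)
    also have "\<dots> \<le> norm v * \<bar>L\<bar>" using L[OF that] by (intro mult_left_mono) auto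
    finally show "norm (?D x v) \<le> \<bar>L\<bar> * norm v" by (simp add: mult.commute)
  qed
  show thesis
  proof (rule that[of "\<bar>L\<bar>"])
    fix x y assume "x \<in> K" "y \<in> K"
    then show "norm (f x - f y) \<le> \<bar>L\<bar> * norm (x - y)"
      by (intro differentiable_bound[OF K(2), of f ?D] on) (auto intro: has_derivative_at_withinI D)
  qed simp
qed

section \<open>Symmetry of second derivatives\<close>

text \<open>The second difference is an increment of \<open>\<phi>\<close> along \<open>v\<close>;
  the mean value theorem along \<open>v\<close> leaves an increment of a first derivative along
  \<open>w\<close>, to which it is applied again.\<close>

lemma mixed_difference_mean_value:
  fixes f :: "'a::real_normed_vector \<Rightarrow> real"
  assumes f: "Ck_on 2 f S" and "0 < t"
    and sub: "\<And>a b. 0 \<le> a \<Longrightarrow> a \<le> t \<Longrightarrow> 0 \<le> b \<Longrightarrow> b \<le> t \<Longrightarrow> x + a *\<^sub>R v + b *\<^sub>R w \<in> S"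
  obtains a b where "0 \<le> a" "a \<le> t" "0 \<le> b" "b \<le> t"
    "f (x + t *\<^sub>R v + t *\<^sub>R w) - f (x + t *\<^sub>R v) - f (x + t *\<^sub>R w) + f x =
      t\<^sup>2 * frechet_derivative (\<lambda>y. frechet_derivative f (at y) v) (at (x + a *\<^sub>R v + b *\<^sub>R w)) w"
proof -
  let ?D = "\<lambda>y. frechet_derivative f (at y) v"
  have d1: "((\<lambda>s. f (y + s *\<^sub>R v)) has_real_derivative ?D (y + s *\<^sub>R v)) (at s)" if "y + s *\<^sub>R v \<in> S" for y s
  proof -
    have D: "(f has_derivative frechet_derivative f (at (y + s *\<^sub>R v))) (at (y + s *\<^sub>R v))"
      using C1_onD(1)[OF Ck_on_2D(1)[OF f] that] .
    have "((\<lambda>s. f (y + s *\<^sub>R v)) has_derivative (\<lambda>h. frechet_derivative f (at (y + s *\<^sub>R v)) (h *\<^sub>R v))) (at s)"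
      by (rule has_derivative_compose[of "\<lambda>s. y + s *\<^sub>R v" "\<lambda>h. h *\<^sub>R v" s UNIV f, OF _ D])
        (auto intro!: derivative_eq_intros)
    then show ?thesis
      by (simp add: has_field_derivative_def linear_scale[OF has_derivative_linear[OF D]] mult_commute_abs)
  qed
  have d2: "((\<lambda>s. ?D (y + s *\<^sub>R w)) has_real_derivative frechet_derivative ?D (at (y + s *\<^sub>R w)) w) (at s)"
    if "y + s *\<^sub>R w \<in> S" for y s
  proof -
    have D: "(?D has_derivative frechet_derivative ?D (at (y + s *\<^sub>R w))) (at (y + s *\<^sub>R w))"
      using C1_onD(1)[OF Ck_on_2D(2)[OF f] that] .
    have "((\<lambda>s. ?D (y + s *\<^sub>R w)) has_derivative (\<lambda>h. frechet_derivative ?D (at (y + s *\<^sub>R w)) (h *\<^sub>R w))) (at s)"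
      by (rule has_derivative_compose[of "\<lambda>s. y + s *\<^sub>R w" "\<lambda>h. h *\<^sub>R w" s UNIV ?D, OF _ D])
        (auto intro!: derivative_eq_intros)
    then show ?thesis
      by (simp add: has_field_derivative_def linear_scale[OF has_derivative_linear[OF D]] mult_commute_abs)
  qed
  define \<phi> where "\<phi> = (\<lambda>s. f ((x + t *\<^sub>R w) + s *\<^sub>R v) - f (x + s *\<^sub>R v))"
  have "\<exists>a>0. a < t \<and> \<phi> t - \<phi> 0 = (t - 0) * (?D ((x + t *\<^sub>R w) + a *\<^sub>R v) - ?D (x + a *\<^sub>R v))"
  proof (rule MVT2[OF \<open>0 < t\<close>])
    fix s assume s: "0 \<le> s" "s \<le> t"
    have "x + t *\<^sub>R w + s *\<^sub>R v \<in> S" "x + s *\<^sub>R v \<in> S"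
      using sub[of s t] sub[of s 0] s by (simp_all add: add_ac)
    then show "(\<phi> has_real_derivative ?D ((x + t *\<^sub>R w) + s *\<^sub>R v) - ?D (x + s *\<^sub>R v)) (at s)"
      unfolding \<phi>_def by (intro DERIV_diff d1)
  qed
  then obtain a where a: "0 < a" "a < t" "\<phi> t - \<phi> 0 = t * (?D ((x + t *\<^sub>R w) + a *\<^sub>R v) - ?D (x + a *\<^sub>R v))" by auto
  have "\<exists>b>0. b < t \<and> ?D ((x + a *\<^sub>R v) + t *\<^sub>R w) - ?D ((x + a *\<^sub>R v) + 0 *\<^sub>R w) =
      (t - 0) * frechet_derivative ?D (at (x + a *\<^sub>R v + b *\<^sub>R w)) w"
    by (rule MVT2[OF \<open>0 < t\<close>]) (use d2 sub a in auto)
  then obtain b where b: "0 < b" "b < t" "?D ((x + a *\<^sub>R v) + t *\<^sub>R w) - ?D (x + a *\<^sub>R v) =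
      t * frechet_derivative ?D (at (x + a *\<^sub>R v + b *\<^sub>R w)) w" by auto
  show thesis
    by (rule that[of a b]) (use a b in \<open>simp_all add: \<phi>_def add_ac power2_eq_square\<close>)
qed

text \<open>The second difference is symmetric in \<open>v\<close> and \<open>w\<close>, so both
  mixed derivatives take a common value at two points arbitrarily close to \<open>x\<close>. By
  continuity each is within half of the supposed gap of its value at \<open>x\<close>, a
  contradiction.\<close>

lemma mixed_derivatives_commute_real:
  fixes f :: "'a::real_normed_vector \<Rightarrow> real"
  assumes f: "Ck_on 2 f S" and "open S" "x \<in> S"
  shows "frechet_derivative (\<lambda>y. frechet_derivative f (at y) v) (at x) w =
    frechet_derivative (\<lambda>y. frechet_derivative f (at y) w) (at x) v"
proof (rule ccontr)
  let ?A = "\<lambda>z. frechet_derivative (\<lambda>y. frechet_derivative f (at y) v) (at z) w"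
  let ?B = "\<lambda>z. frechet_derivative (\<lambda>y. frechet_derivative f (at y) w) (at z) v"
  assume "?A x \<noteq> ?B x"
  define e where "e = \<bar>?A x - ?B x\<bar> / 2"
  have "e > 0" using \<open>?A x \<noteq> ?B x\<close> by (simp add: e_def)
  have cA: "isCont ?A x" and cB: "isCont ?B x"
    using C1_onD(2)[OF Ck_on_2D(2)[OF f]] assms(2,3) by (auto simp: continuous_on_eq_continuous_at)
  obtain d1 where d1: "d1 > 0" "\<And>z. dist z x < d1 \<Longrightarrow> dist (?A z) (?A x) < e"
    using cA \<open>e > 0\<close> unfolding continuous_at_eps_delta by (metis dist_commute)
  obtain d2 where d2: "d2 > 0" "\<And>z. dist z x < d2 \<Longrightarrow> dist (?B z) (?B x) < e"
    using cB \<open>e > 0\<close> unfolding continuous_at_eps_delta by (metis dist_commute)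
  obtain d3 where d3: "d3 > 0" "ball x d3 \<subseteq> S" using assms(2,3) open_contains_ball by blast
  define d where "d = min d1 (min d2 d3)"
  have "d > 0" using d1 d2 d3 by (simp add: d_def)
  \<comment> \<open>Small enough for the parallelogram spanned by \<open>t *\<^sub>R v\<close> and
    \<open>t *\<^sub>R w\<close> to stay within \<open>d\<close> of \<open>x\<close>; the 1 keeps
    the denominator positive.\<close>
  define t where "t = d / (norm v + norm w + 1)"
  have np: "norm v + norm w + 1 > 0" by (simp add: add_nonneg_pos)
  have "t > 0" using \<open>d > 0\<close> np by (simp add: t_def)
  have close: "dist (x + a *\<^sub>R v + b *\<^sub>R w) x < d" if "0 \<le> a" "a \<le> t" "0 \<le> b" "b \<le> t" for a b
  proof -
    have "dist (x + a *\<^sub>R v + b *\<^sub>R w) x \<le> a * norm v + b * norm w"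
      using norm_triangle_ineq[of "a *\<^sub>R v" "b *\<^sub>R w"] that by (simp add: dist_norm add.assoc)
    also have "\<dots> \<le> t * norm v + t * norm w"
      using that by (intro add_mono mult_right_mono) auto
    also have "\<dots> < t * (norm v + norm w + 1)" using \<open>t > 0\<close> by (simp add: algebra_simps)
    also have "\<dots> = d" using np by (simp add: t_def)
    finally show ?thesis .
  qed
  have sub: "x + a *\<^sub>R v + b *\<^sub>R w \<in> S" if "0 \<le> a" "a \<le> t" "0 \<le> b" "b \<le> t" for a b
    using close[OF that] d3 by (auto simp: d_def dist_commute)
  obtain a b where ab: "0 \<le> a" "a \<le> t" "0 \<le> b" "b \<le> t"
    "f (x + t *\<^sub>R v + t *\<^sub>R w) - f (x + t *\<^sub>R v) - f (x + t *\<^sub>R w) + f x = t\<^sup>2 * ?A (x + a *\<^sub>R v + b *\<^sub>R w)"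
    by (rule mixed_difference_mean_value[OF f \<open>t > 0\<close> sub])
  have sub': "x + a *\<^sub>R w + b *\<^sub>R v \<in> S" if "0 \<le> a" "a \<le> t" "0 \<le> b" "b \<le> t" for a b
    using sub[of b a] that by (simp add: add_ac)
  obtain a' b' where ab': "0 \<le> a'" "a' \<le> t" "0 \<le> b'" "b' \<le> t"
    "f (x + t *\<^sub>R w + t *\<^sub>R v) - f (x + t *\<^sub>R w) - f (x + t *\<^sub>R v) + f x = t\<^sup>2 * ?B (x + a' *\<^sub>R w + b' *\<^sub>R v)"
    by (rule mixed_difference_mean_value[OF f \<open>t > 0\<close> sub'])
  have "t\<^sup>2 * ?A (x + a *\<^sub>R v + b *\<^sub>R w) = t\<^sup>2 * ?B (x + a' *\<^sub>R w + b' *\<^sub>R v)"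
  proof -
    have e: "x + t *\<^sub>R w + t *\<^sub>R v = x + t *\<^sub>R v + t *\<^sub>R w" by (simp add: add_ac)
    show ?thesis using ab(5) ab'(5)[unfolded e] by linarith
  qed
  then have "?A (x + a *\<^sub>R v + b *\<^sub>R w) = ?B (x + b' *\<^sub>R v + a' *\<^sub>R w)"
    using \<open>t > 0\<close> by (simp add: add_ac)
  moreover have "dist (?A (x + a *\<^sub>R v + b *\<^sub>R w)) (?A x) < e"
    using close[OF ab(1-4)] by (intro d1) (simp add: d_def)
  moreover have "dist (?B (x + b' *\<^sub>R v + a' *\<^sub>R w)) (?B x) < e"
    using close[OF ab'(3,4,1,2)] by (intro d2) (simp add: d_def)
  ultimately show False by (auto simp: e_def dist_real_def abs_if split: if_splits)
qed

lemma mixed_derivatives_commute: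
  fixes f :: "'a::real_normed_vector \<Rightarrow> 'b::euclidean_space"
  assumes f: "Ck_on 2 f S" and S: "open S" "x \<in> S"
  shows "frechet_derivative (\<lambda>y. frechet_derivative f (at y) v) (at x) w =
    frechet_derivative (\<lambda>y. frechet_derivative f (at y) w) (at x) v"
proof (rule euclidean_eqI)
  fix b :: 'b
  let ?g = "\<lambda>y. f y \<bullet> b"
  note h = bounded_linear_inner_left[of b]
  have D: "frechet_derivative f (at y) u \<bullet> b = frechet_derivative ?g (at y) u" if "y \<in> S" for y u
    by (rule frechet_derivative_bounded_linear[OF h, symmetric]) (use Ck_on_2D(1)[OF f] that in \<open>simp add: C1_on_def\<close>)
  have C1: "C1_on (\<lambda>y. frechet_derivative f (at y) u \<bullet> b) S" for u
    by (rule C1_on_bounded_linear[OF h Ck_on_2D(2)[OF f]])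
  have "Ck_on 2 ?g S"
    using C1_on_bounded_linear[OF h Ck_on_2D(1)[OF f]] C1_on_cong[OF C1 S(1) D]
    by (simp add: numeral_2_eq_2 C1_on_def)
  moreover have "frechet_derivative (\<lambda>y. frechet_derivative ?g (at y) u) (at x) u' =
      frechet_derivative (\<lambda>y. frechet_derivative f (at y) u) (at x) u' \<bullet> b" for u u'
  proof -
    have e: "frechet_derivative (\<lambda>y. frechet_derivative ?g (at y) u) (at x) =
        frechet_derivative (\<lambda>y. frechet_derivative f (at y) u \<bullet> b) (at x)"
      by (rule frechet_derivative_transform_within_open[OF _ S D, symmetric]) (use C1 S in \<open>simp_all add: C1_on_def\<close>)
    show ?thesis
      unfolding e by (rule frechet_derivative_bounded_linear[OF h]) (use Ck_on_2D(2)[OF f] S(2) in \<open>simp add: C1_on_def\<close>)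
  qed
  ultimately show "frechet_derivative (\<lambda>y. frechet_derivative f (at y) v) (at x) w \<bullet> b =
      frechet_derivative (\<lambda>y. frechet_derivative f (at y) w) (at x) v \<bullet> b"
    using mixed_derivatives_commute_real[of ?g S x v w] S by simp
qed

section \<open>Derivatives of determinants and of inverse matrices\<close>

text \<open>Jacobi's formula. Differentiating the Leibniz expansion gives, for each
  \<open>i\<close>, the determinant with row \<open>i\<close> replaced by its derivative; written as
  a combination of the rows of \<open>A x\<close>, that row contributes only its \<open>i\<close>-th
  coefficient.\<close>

lemma has_derivative_det:
  fixes A :: "'a::real_normed_vector \<Rightarrow> real^'n^'n"
  assumes A: "\<And>i j. ((\<lambda>x. A x $ i $ j) has_derivative A' i j) (at x)" and B: "B ** A x = mat 1"
  shows "((\<lambda>x. det (A x)) has_derivative (\<lambda>v. det (A x) * (\<Sum>i\<in>UNIV. \<Sum>j\<in>UNIV. A' i j v * B $ j $ i))) (at x)"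
proof -
  let ?P = "{p. p permutes (UNIV :: 'n set)}"
  have "((\<lambda>x. det (A x)) has_derivative
      (\<lambda>v. \<Sum>p\<in>?P. of_int (sign p) * (\<Sum>i\<in>UNIV. A' i (p i) v * (\<Prod>j\<in>UNIV - {i}. A x $ j $ p j)))) (at x)"
    unfolding det_def by (intro has_derivative_sum has_derivative_mult_right has_derivative_prod A)
  moreover have "(\<Sum>p\<in>?P. of_int (sign p) * (\<Sum>i\<in>UNIV. A' i (p i) v * (\<Prod>j\<in>UNIV - {i}. A x $ j $ p j))) =
      det (A x) * (\<Sum>i\<in>UNIV. \<Sum>j\<in>UNIV. A' i j v * B $ j $ i)" for v
  proof -
    have row: "(\<Sum>p\<in>?P. of_int (sign p) * (A' i (p i) v * (\<Prod>j\<in>UNIV - {i}. A x $ j $ p j))) =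
        det (A x) * (\<Sum>j\<in>UNIV. A' i j v * B $ j $ i)" for i
    proof -
      \<comment> \<open>The coefficients of the differentiated row in terms of the rows of
        \<open>A x\<close>; they come from multiplying by the left inverse \<open>B\<close>.\<close>
      define c :: "real^'n" where "c = (\<chi> k. \<Sum>j\<in>UNIV. A' i j v * B $ j $ k)"
      have c: "(\<Sum>k\<in>UNIV. c $ k *s row k (A x)) = (\<chi> j. A' i j v)"
      proof -
        have "(\<Sum>k\<in>UNIV. c $ k * A x $ k $ j) = A' i j v" for j
        proof -
          have "(\<Sum>k\<in>UNIV. c $ k * A x $ k $ j) = (\<Sum>k\<in>UNIV. \<Sum>l\<in>UNIV. A' i l v * (B $ l $ k * A x $ k $ j))"
            by (simp add: c_def sum_distrib_right mult.assoc)
          also have "\<dots> = (\<Sum>l\<in>UNIV. A' i l v * (B ** A x) $ l $ j)"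
            by (subst sum.swap) (simp add: matrix_matrix_mult_def sum_distrib_left)
          also have "\<dots> = A' i j v" by (simp add: B mat_def if_distrib sum.delta cong: if_cong)
          finally show ?thesis .
        qed
        then show ?thesis by (simp add: vec_eq_iff row_def)
      qed
      have "(\<Sum>p\<in>?P. of_int (sign p) * (A' i (p i) v * (\<Prod>j\<in>UNIV - {i}. A x $ j $ p j))) =
          det (\<chi> k. if k = i then (\<Sum>k\<in>UNIV. c $ k *s row k (A x)) else row k (A x))"
        unfolding c det_def
      proof (intro sum.cong refl arg_cong2[where f="(*)"])
        fix p
        have "(\<Prod>j\<in>UNIV. (\<chi> k. if k = i then \<chi> j. A' i j v else row k (A x)) $ j $ p j) =
            (\<chi> k. if k = i then \<chi> j. A' i j v else row k (A x)) $ i $ p i *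
            (\<Prod>j\<in>UNIV - {i}. (\<chi> k. if k = i then \<chi> j. A' i j v else row k (A x)) $ j $ p j)"
          by (rule prod.remove) auto
        also have "\<dots> = A' i (p i) v * (\<Prod>j\<in>UNIV - {i}. A x $ j $ p j)"
          by (intro arg_cong2[where f="(*)"] prod.cong) (auto simp: row_def)
        finally show "A' i (p i) v * (\<Prod>j\<in>UNIV - {i}. A x $ j $ p j) =
            (\<Prod>j\<in>UNIV. (\<chi> k. if k = i then \<chi> j. A' i j v else row k (A x)) $ j $ p j)" by simp
      qed
      also have "\<dots> = c $ i * det (A x)" by (rule cramer_lemma_transpose)
      finally show ?thesis by (simp add: c_def mult.commute)
    qed
    have "(\<Sum>p\<in>?P. of_int (sign p) * (\<Sum>i\<in>UNIV. A' i (p i) v * (\<Prod>j\<in>UNIV - {i}. A x $ j $ p j))) =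
      (\<Sum>i\<in>UNIV. \<Sum>p\<in>?P. of_int (sign p) * (A' i (p i) v * (\<Prod>j\<in>UNIV - {i}. A x $ j $ p j)))"
      by (simp only: sum_distrib_left) (rule sum.swap)
    then show ?thesis by (simp add: row sum_distrib_left)
  qed
  ultimately show ?thesis by simp
qed

lemma C1_on_det:
  fixes A :: "'a::real_normed_vector \<Rightarrow> real^'n^'n"
  assumes "\<And>i j. C1_on (\<lambda>x. A x $ i $ j) S"
  shows "C1_on (\<lambda>x. det (A x)) S"
  unfolding det_def by (intro C1_on_sum C1_on_mult C1_on_const C1_on_prod assms)

lemma matrix_inv_inverse:
  fixes A :: "real^'n^'n"
  assumes "det A \<noteq> 0"
  shows "A ** matrix_inv A = mat 1" "matrix_inv A ** A = mat 1"
proof -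
  have "\<exists>B. A ** B = mat 1 \<and> B ** A = mat 1" using assms by (simp add: invertible_det_nz[symmetric] invertible_def)
  then show "A ** matrix_inv A = mat 1" "matrix_inv A ** A = mat 1"
    unfolding matrix_inv_def by (metis (mono_tags, lifting) someI_ex)+
qed

text \<open>Cramer's rule for a column of the inverse. It exhibits the entries as quotients of
  polynomials in the entries of \<open>A\<close>, so differentiability is inherited.\<close>

lemma matrix_inv_component:
  fixes A :: "real^'n^'n"
  assumes "det A \<noteq> 0"
  shows "matrix_inv A $ i $ j = det (\<chi> k l. if l = i then axis j 1 $ k else A $ k $ l) / det A"
proof -
  have inv: "A ** matrix_inv A = mat 1" using assms by (rule matrix_inv_inverse)
  have "A *v (matrix_inv A *v axis j 1) = axis j 1"
    by (simp add: matrix_vector_mul_assoc inv)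
  then have "matrix_inv A *v axis j 1 = (\<chi> k. det (\<chi> i l. if l = k then axis j 1 $ i else A $ i $ l) / det A)"
    by (simp add: cramer[OF assms])
  then have "(matrix_inv A *v axis j 1) $ i = det (\<chi> k l. if l = i then axis j 1 $ k else A $ k $ l) / det A"
    by simp
  then show ?thesis by (simp add: matrix_vector_mul_component column_def matrix_vector_mult_basis)
qed

lemma C1_on_matrix_inv:
  fixes A :: "'a::real_normed_vector \<Rightarrow> real^'n^'n"
  assumes A: "\<And>i j. C1_on (\<lambda>x. A x $ i $ j) S" and nz: "\<And>x. x \<in> S \<Longrightarrow> det (A x) \<noteq> 0" and "open S"
  shows "C1_on (\<lambda>x. matrix_inv (A x) $ i $ j) S"
proof -
  have e: "C1_on (\<lambda>x. (\<chi> k l. if l = i then axis j 1 $ k else A x $ k $ l) $ k $ l) S" for k l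
    by (cases "l = i") (auto intro: C1_on_const A)
  have "C1_on (\<lambda>x. det (\<chi> k l. if l = i then axis j 1 $ k else A x $ k $ l) * inverse (det (A x))) S"
    by (intro C1_on_mult C1_on_inverse C1_on_det A nz e)
  then show ?thesis
    by (rule C1_on_cong[OF _ \<open>open S\<close>]) (simp add: matrix_inv_component nz divide_inverse)
qed

section \<open>Minimal parametrizations in the hyperboloid model\<close>

lemma differentiable_bounded_linear:
  assumes "bounded_linear h" "f differentiable at x" shows "(\<lambda>y. h (f y)) differentiable at x"
  using bounded_linear.has_derivative[OF assms(1)] assms(2) unfolding differentiable_def by blast

lemma differentiable_bounded_bilinear:
  assumes "bounded_bilinear h" "f differentiable at x" "g differentiable at x"
  shows "(\<lambda>y. h (f y) (g y)) differentiable at x"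
  using bounded_bilinear.FDERIV[OF assms(1)] assms(2,3) unfolding differentiable_def by blast

lemma pderiv_at_bilinear:
  assumes "bounded_bilinear h" "f differentiable at x" "g differentiable at x"
  shows "pderiv_at i (\<lambda>y. h (f y) (g y)) x = h (f x) (pderiv_at i g x) + h (pderiv_at i f x) (g x)"
proof -
  have D: "((\<lambda>y. h (f y) (g y)) has_derivative
      (\<lambda>v. h (f x) (frechet_derivative g (at x) v) + h (frechet_derivative f (at x) v) (g x))) (at x)"
    by (rule bounded_bilinear.FDERIV[OF assms(1)]) (use assms in \<open>simp_all add: frechet_derivative_works\<close>)
  show ?thesis unfolding pderiv_at_def by (rule fun_cong[OF frechet_derivative_at[OF D, symmetric]])
qed

lemmas pderiv_at_mult = pderiv_at_bilinear[OF bounded_bilinear_mult]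
lemmas pderiv_at_scaleR = pderiv_at_bilinear[OF bounded_bilinear_scaleR]

lemma pderiv_at_linear:
  assumes "bounded_linear h" "f differentiable at x"
  shows "pderiv_at i (\<lambda>y. h (f y)) x = h (pderiv_at i f x)"
  unfolding pderiv_at_def by (rule frechet_derivative_bounded_linear[OF assms])

lemma pderiv_at_sum:
  assumes "\<And>j. j \<in> J \<Longrightarrow> f j differentiable at x"
  shows "pderiv_at i (\<lambda>y. \<Sum>j\<in>J. f j y) x = (\<Sum>j\<in>J. pderiv_at i (f j) x)"
proof -
  have D: "((\<lambda>y. \<Sum>j\<in>J. f j y) has_derivative (\<lambda>v. \<Sum>j\<in>J. frechet_derivative (f j) (at x) v)) (at x)"
    by (rule has_derivative_sum) (use assms in \<open>simp_all add: frechet_derivative_works\<close>)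
  show ?thesis unfolding pderiv_at_def by (rule fun_cong[OF frechet_derivative_at[OF D, symmetric]])
qed

lemma pderiv_at_cong:
  assumes "open S" "x \<in> S" "\<And>y. y \<in> S \<Longrightarrow> f y = g y" "f differentiable at x"
  shows "pderiv_at i f x = pderiv_at i g x"
  unfolding pderiv_at_def using frechet_derivative_transform_within_open[OF assms(4,1,2,3)] by simp

lemma pderiv_at_const: "pderiv_at i (\<lambda>_. c) x = 0"
  by (simp add: pderiv_at_def)

lemma C1_on_differentiable: "C1_on f S \<Longrightarrow> x \<in> S \<Longrightarrow> f differentiable at x"
  by (simp add: C1_on_def)

lemma frechet_derivative_sum_pderiv:
  fixes f :: "real^'n::finite \<Rightarrow> 'b::real_normed_vector"
  assumes "f differentiable at x"
  shows "frechet_derivative f (at x) v = (\<Sum>i\<in>UNIV. v $ i *\<^sub>R pderiv_at i f x)"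
proof -
  have lin: "linear (frechet_derivative f (at x))"
    using assms by (rule linear_frechet_derivative)
  have "v = (\<Sum>i\<in>UNIV. v $ i *\<^sub>R axis i 1)"
    by (simp add: vec_eq_iff axis_def if_distrib sum.delta' cong: if_cong)
  then have "frechet_derivative f (at x) v = frechet_derivative f (at x) (\<Sum>i\<in>UNIV. v $ i *\<^sub>R axis i 1)" by simp
  also have "\<dots> = (\<Sum>i\<in>UNIV. v $ i *\<^sub>R pderiv_at i f x)"
    by (simp add: linear_sum[OF lin] linear_scale[OF lin] pderiv_at_def)
  finally show ?thesis .
qed

section \<open>The Lorentz form\<close>

lemma bounded_bilinear_lorentz: "bounded_bilinear lorentz"
proof
  fix a a' b b' :: "(real^'m::finite) \<times> real" and r :: real
  show "lorentz (a + a') b = lorentz a b + lorentz a' b" "lorentz a (b + b') = lorentz a b + lorentz a b'"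
    "lorentz (r *\<^sub>R a) b = r *\<^sub>R lorentz a b" "lorentz a (r *\<^sub>R b) = r *\<^sub>R lorentz a b"
    by (simp_all add: lorentz_def algebra_simps inner_add_left inner_add_right)
  have "norm (lorentz a b) \<le> norm a * norm b * 2" for a b :: "(real^'m::finite) \<times> real"
  proof -
    have n: "norm (fst a) \<le> norm a" "norm (fst b) \<le> norm b" "\<bar>snd a\<bar> \<le> norm a" "\<bar>snd b\<bar> \<le> norm b"
      using norm_fst_le[of "fst a" "snd a"] norm_fst_le[of "fst b" "snd b"]
        norm_snd_le[of "snd a" "fst a"] norm_snd_le[of "snd b" "fst b"] by simp_all
    have "\<bar>fst a \<bullet> fst b\<bar> \<le> norm a * norm b"
      using Cauchy_Schwarz_ineq2[of "fst a" "fst b"] mult_mono[OF n(1,2)] by simp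
    moreover have "\<bar>snd a * snd b\<bar> \<le> norm a * norm b"
      using mult_mono[OF n(3,4)] by (simp add: abs_mult)
    ultimately show ?thesis by (simp add: lorentz_def)
  qed
  then show "\<exists>K. \<forall>a b :: (real^'m::finite) \<times> real. norm (lorentz a b) \<le> norm a * norm b * K" by blast
qed

interpretation lorentz: bounded_bilinear lorentz by (rule bounded_bilinear_lorentz)

lemma lorentz_commute: "lorentz v w = lorentz w v"
  by (simp add: lorentz_def inner_commute mult.commute)

lemma lorentz_self: "lorentz v v = (norm (fst v))\<^sup>2 - (snd v)\<^sup>2"
  unfolding lorentz_def power2_norm_eq_inner by (simp add: power2_eq_square)

text \<open>The complement of a timelike vector is spacelike: otherwise Cauchy-Schwarz for the space
  components, combined with \<open>(norm (fst x))\<^sup>2 = (snd x)\<^sup>2 - 1\<close>, forces the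
  time component of \<open>v\<close>, and then \<open>v\<close> itself, to vanish.\<close>

lemma lorentz_pos_of_orthogonal:
  assumes x: "x \<in> hyperbolic_space" and "lorentz v x = 0" "v \<noteq> 0"
  shows "lorentz v v > 0"
proof (rule ccontr)
  assume "\<not> ?thesis"
  then have le: "(norm (fst v))\<^sup>2 \<le> (snd v)\<^sup>2" by (simp add: lorentz_self)
  have nx: "(norm (fst x))\<^sup>2 = (snd x)\<^sup>2 - 1"
    using x by (simp add: hyperbolic_space_def lorentz_self)
  have "(snd v)\<^sup>2 * (snd x)\<^sup>2 = (fst v \<bullet> fst x)\<^sup>2"
    using assms(2) by (simp add: lorentz_def power_mult_distrib[symmetric])
  also have "\<dots> \<le> (norm (fst v))\<^sup>2 * (norm (fst x))\<^sup>2"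
    using Cauchy_Schwarz_ineq[of "fst v" "fst x"] by (simp add: power2_norm_eq_inner)
  also have "\<dots> \<le> (snd v)\<^sup>2 * ((snd x)\<^sup>2 - 1)"
    unfolding nx[symmetric] using le by (intro mult_right_mono) auto
  finally have "(snd v)\<^sup>2 \<le> 0" by (simp add: algebra_simps)
  then have "snd v = 0" by simp
  then have "fst v = 0" using le by simp
  then show False using \<open>snd v = 0\<close> \<open>v \<noteq> 0\<close> by (simp add: prod_eq_iff)
qed

lemma lorentz_nondegenerate:
  assumes "\<And>v. lorentz w v = 0"
  shows "w = 0"
proof -
  \<comment> \<open>Testing with the time reflection of \<open>w\<close> turns the form into the
    Euclidean square.\<close>
  have "fst w \<bullet> fst w + snd w * snd w = 0"
    using assms[of "(fst w, - snd w)"] by (simp add: lorentz_def)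
  then have "fst w \<bullet> fst w = 0" "snd w * snd w = 0"
    using add_nonneg_eq_0_iff[of "fst w \<bullet> fst w" "snd w * snd w"] by auto
  then show ?thesis by (simp add: prod_eq_iff)
qed

section \<open>Positive definite matrices\<close>

lemma matrix_inner_expand:
  fixes A :: "real^'n::finite^'n"
  shows "a \<bullet> (A *v b) = (\<Sum>i\<in>UNIV. \<Sum>j\<in>UNIV. A $ i $ j * a $ i * b $ j)"
  by (simp add: inner_vec_def matrix_vector_mult_def sum_distrib_left mult_ac)

locale positive_definite =
  fixes A :: "real^'n::finite^'n"
  assumes sym: "A $ i $ j = A $ j $ i"
    and pos: "v \<noteq> 0 \<Longrightarrow> v \<bullet> (A *v v) > 0"
begin

lemma det_nonzero: "det A \<noteq> 0"
proof
  assume "det A = 0"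
  then obtain v where "v \<noteq> 0" "A *v v = 0"
    using invertible_det_nz[of A] invertible_left_inverse[of A] matrix_left_invertible_ker[of A] by auto
  then show False using pos[of v] by simp
qed

lemma inner_commute_matrix: "a \<bullet> (A *v b) = b \<bullet> (A *v a)"
  unfolding matrix_inner_expand by (subst sum.swap) (simp add: sym mult_ac)

lemma inv_right: "A *v (matrix_inv A *v a) = a" and inv_left: "matrix_inv A *v (A *v a) = a"
  by (simp_all add: matrix_vector_mul_assoc matrix_inv_inverse[OF det_nonzero])

lemma inv_inner_commute: "a \<bullet> (matrix_inv A *v b) = b \<bullet> (matrix_inv A *v a)"
  using inner_commute_matrix[of "matrix_inv A *v a" "matrix_inv A *v b"] by (simp add: inv_right inner_commute)

lemma inv_sym: "matrix_inv A $ i $ j = matrix_inv A $ j $ i"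
proof -
  have "matrix_inv A $ i $ j = axis i 1 \<bullet> (matrix_inv A *v axis j 1)" for i j
    by (simp add: inner_axis' matrix_vector_mul_component column_def matrix_vector_mult_basis)
  then show ?thesis using inv_inner_commute by metis
qed

lemma inv_nonneg: "a \<bullet> (matrix_inv A *v a) \<ge> 0"
proof -
  have "a \<bullet> (matrix_inv A *v a) = (matrix_inv A *v a) \<bullet> (A *v (matrix_inv A *v a))"
    by (simp add: inv_right inner_commute)
  also have "\<dots> \<ge> 0" using pos[of "matrix_inv A *v a"] by (cases "matrix_inv A *v a = 0") auto
  finally show ?thesis .
qed

text \<open>The segment from the identity to \<open>A\<close> consists of positive definite, hence
  invertible, matrices. The determinant starts at 1 and never vanishes along it, so it stays
  positive.\<close>

lemma det_pos: "det A > 0"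
proof (rule ccontr)
  assume neg: "\<not> det A > 0"
  define H where "H t = (1 - t) *\<^sub>R mat 1 + t *\<^sub>R A" for t :: real
  have Hv: "H t *v v = (1 - t) *\<^sub>R v + t *\<^sub>R (A *v v)" for t v
    by (simp add: H_def matrix_vector_mult_add_rdistrib scaleR_matrix_vector_assoc[symmetric])
  have nz: "det (H t) \<noteq> 0" if "0 \<le> t" "t \<le> 1" for t
  proof
    assume "det (H t) = 0"
    then obtain v where v: "v \<noteq> 0" "H t *v v = 0"
      using invertible_det_nz[of "H t"] invertible_left_inverse[of "H t"] matrix_left_invertible_ker[of "H t"] by auto
    have "v \<bullet> (H t *v v) = (1 - t) * (v \<bullet> v) + t * (v \<bullet> (A *v v))"
      by (simp add: Hv inner_add_right)
    also have "\<dots> > 0"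
    proof (cases "t = 0")
      case True then show ?thesis using v(1) by simp
    next
      case False
      then have "t * (v \<bullet> (A *v v)) > 0" using that pos[OF v(1)] by simp
      moreover have "(1 - t) * (v \<bullet> v) \<ge> 0" using that by simp
      ultimately show ?thesis by linarith
    qed
    finally show False using v(2) by simp
  qed
  have "continuous_on {0..1} (\<lambda>t. det (H t))"
    unfolding det_def H_def by (auto intro!: continuous_intros)
  moreover have "H 0 = mat 1" "H 1 = A" by (simp_all add: H_def)
  ultimately have "\<exists>t\<ge>0. t \<le> 1 \<and> det (H t) = 0"
    using neg by (intro IVT2') auto
  then show False using nz by auto
qed

end

section \<open>Geometry of a single parametrization\<close>

text \<open>Collects what the local geometry uses of one chart, so that the differential identities
  can be computed on an open set of coordinates without reference to the manifold.\<close>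

locale hyperbolic_parametrization =
  fixes X :: "real^'n::finite \<Rightarrow> (real^'m::finite) \<times> real" and \<Omega> :: "(real^'n) set"
  assumes dims: "CARD('m) = CARD('n) + 1"
    and open_\<Omega>: "open \<Omega>"
    and smooth: "Ck_on 2 X \<Omega>"
    and hyp: "x \<in> \<Omega> \<Longrightarrow> X x \<in> hyperbolic_space"
    and immersion: "x \<in> \<Omega> \<Longrightarrow> inj (frechet_derivative X (at x))"
begin

abbreviation P :: "'n \<Rightarrow> real^'n \<Rightarrow> (real^'m) \<times> real" where "P i \<equiv> pderiv_at i X"
abbreviation G :: "real^'n \<Rightarrow> real^'n^'n" where "G \<equiv> metric_matrix X"
abbreviation Gi :: "real^'n \<Rightarrow> real^'n^'n" where "Gi x \<equiv> matrix_inv (G x)"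
abbreviation u :: "real^'n \<Rightarrow> real" where "u x \<equiv> snd (X x)"
abbreviation w :: "real^'n \<Rightarrow> real" where "w x \<equiv> sqrt (det (G x))"
abbreviation du :: "real^'n \<Rightarrow> real^'n" where "du x \<equiv> (\<chi> i. snd (P i x))"

lemma C1_X: "C1_on X \<Omega>" using smooth by (rule Ck_on_2D)
lemma C1_P: "C1_on (P i) \<Omega>" using Ck_on_2D(2)[OF smooth, of "axis i 1"] by (simp add: pderiv_at_def[abs_def])

lemma diff_X: "x \<in> \<Omega> \<Longrightarrow> X differentiable at x" using C1_X by (rule C1_on_differentiable)
lemma diff_P: "x \<in> \<Omega> \<Longrightarrow> P i differentiable at x" using C1_P by (rule C1_on_differentiable)

lemma u_pos: "x \<in> \<Omega> \<Longrightarrow> u x > 0" using hyp by (simp add: hyperbolic_space_def)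

lemma lorentz_X_X: "x \<in> \<Omega> \<Longrightarrow> lorentz (X x) (X x) = - 1" using hyp by (simp add: hyperbolic_space_def)

lemma lorentz_P_X:
  assumes "x \<in> \<Omega>" shows "lorentz (P i x) (X x) = 0"
proof -
  have "pderiv_at i (\<lambda>y. lorentz (X y) (X y)) x = pderiv_at i (\<lambda>y. - 1) x"
    by (rule pderiv_at_cong[OF open_\<Omega> assms])
      (use lorentz_X_X assms in \<open>auto intro!: C1_on_differentiable[OF C1_on_bounded_bilinear[OF bounded_bilinear_lorentz C1_X C1_X]]\<close>)
  then show ?thesis
    using pderiv_at_bilinear[OF bounded_bilinear_lorentz diff_X[OF assms] diff_X[OF assms], of i]
    by (simp add: pderiv_at_const lorentz_commute[of "X x"])
qed

lemma G_comp: "G x $ i $ j = lorentz (P i x) (P j x)" by (simp add: metric_matrix_def)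

lemma lorentz_P_sum: "lorentz (P i x) (\<Sum>j\<in>UNIV. v $ j *\<^sub>R P j x) = (G x *v v) $ i"
  by (simp add: lorentz.sum_right lorentz.scaleR_right matrix_vector_mult_def G_comp mult.commute)

lemma lorentz_sum_sum: "lorentz (\<Sum>i\<in>UNIV. v $ i *\<^sub>R P i x) (\<Sum>j\<in>UNIV. v' $ j *\<^sub>R P j x) = v \<bullet> (G x *v v')"
  by (simp add: lorentz.sum_left lorentz.scaleR_left lorentz_P_sum inner_vec_def)

text \<open>Tangent vectors are Lorentz orthogonal to the timelike position vector and therefore
  spacelike; injectivity of the differential excludes a zero tangent vector with nonzero
  coordinates.\<close>

lemma G_pos:
  assumes "x \<in> \<Omega>" shows "positive_definite (G x)"
proof
  show "G x $ i $ j = G x $ j $ i" for i j by (simp add: G_comp lorentz_commute)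
  fix v :: "real^'n" assume "v \<noteq> 0"
  let ?D = "frechet_derivative X (at x)"
  have D: "?D v = (\<Sum>i\<in>UNIV. v $ i *\<^sub>R P i x)" by (rule frechet_derivative_sum_pderiv[OF diff_X[OF assms]])
  have "?D 0 = 0" using linear_0[OF linear_frechet_derivative[OF diff_X[OF assms]]] .
  then have "?D v \<noteq> 0" using immersion[OF assms] \<open>v \<noteq> 0\<close> by (metis injD)
  moreover have "lorentz (?D v) (X x) = 0"
    by (simp add: D lorentz.sum_left lorentz.scaleR_left lorentz_P_X assms)
  ultimately have "lorentz (?D v) (?D v) > 0" using lorentz_pos_of_orthogonal[OF hyp[OF assms]] by blast
  then show "v \<bullet> (G x *v v) > 0" by (simp add: D lorentz_sum_sum)
qed

lemmas det_G_pos = positive_definite.det_pos[OF G_pos]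

lemma C1_G: "C1_on (\<lambda>x. G x $ i $ j) \<Omega>"
  unfolding G_comp by (rule C1_on_bounded_bilinear[OF bounded_bilinear_lorentz C1_P C1_P])

lemma C1_Gi: "C1_on (\<lambda>x. Gi x $ i $ j) \<Omega>"
  by (rule C1_on_matrix_inv[OF C1_G _ open_\<Omega>]) (use det_G_pos in force)

lemma C1_w: "C1_on w \<Omega>"
  by (intro C1_on_sqrt C1_on_det C1_G det_G_pos)

lemma w_pos: "x \<in> \<Omega> \<Longrightarrow> w x > 0" using det_G_pos by simp

text \<open>A predicate instead of the selected vector: a normal chosen in one chart is reused in
  another, where the selection might return the opposite sign.\<close>

definition unit_normal_at :: "real^'n \<Rightarrow> (real^'m) \<times> real \<Rightarrow> bool" where
  "unit_normal_at x \<nu> \<longleftrightarrow> lorentz \<nu> \<nu> = 1 \<and> lorentz \<nu> (X x) = 0 \<and> (\<forall>i. lorentz \<nu> (P i x) = 0)"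

text \<open>Orthogonality to the tangent vectors and to \<open>X x\<close> amounts to n + 1 linear
  conditions in dimension n + 2. A nonzero solution is spacelike because it is orthogonal to
  \<open>X x\<close>, so it can be normalised.\<close>

lemma unit_normal_exists:
  assumes "x \<in> \<Omega>" shows "unit_normal_at x (unit_normal X x)"
proof -
  define \<Phi> where "\<Phi> W = (\<chi> i. lorentz W (P i x), lorentz W (X x))" for W
  have lin: "linear \<Phi>"
    by (rule linearI) (simp_all add: \<Phi>_def vec_eq_iff lorentz.add_left lorentz.scaleR_left)
  have "\<not> inj \<Phi>"
  proof
    assume "inj \<Phi>"
    then have "dim (range \<Phi>) = DIM((real^'m) \<times> real)"
      using dim_image_eq[OF lin, of UNIV] by (simp add: dim_UNIV)
    moreover have "dim (range \<Phi>) \<le> DIM((real^'n) \<times> real)" by (rule dim_subset_UNIV)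
    ultimately show False using dims by simp
  qed
  then obtain W where W: "W \<noteq> 0" "\<Phi> W = 0" using linear_injective_0[OF lin] by blast
  then have o: "lorentz W (X x) = 0" "\<And>i. lorentz W (P i x) = 0" by (auto simp: \<Phi>_def prod_eq_iff vec_eq_iff)
  then have pos: "lorentz W W > 0" using lorentz_pos_of_orthogonal[OF hyp[OF assms]] W by blast
  define \<nu> where "\<nu> = (1 / sqrt (lorentz W W)) *\<^sub>R W"
  have "lorentz \<nu> \<nu> = 1 \<and> lorentz \<nu> (X x) = 0 \<and> (\<forall>i. lorentz \<nu> (P i x) = 0)"
    using pos o by (simp add: \<nu>_def lorentz.scaleR_left lorentz.scaleR_right field_simps)
  then show ?thesis unfolding unit_normal_def unit_normal_at_def by (rule someI)
qed

text \<open>The n tangent vectors, the position and the normal are linearly independent, hence a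
  basis of Minkowski space, and the form is nondegenerate. Vector identities are thereby reduced to
  Lorentz products with these basis vectors.\<close>

lemma zero_if_orthogonal:
  assumes x: "x \<in> \<Omega>" and \<nu>: "unit_normal_at x \<nu>"
    and W: "lorentz W \<nu> = 0" "lorentz W (X x) = 0" "\<And>i. lorentz W (P i x) = 0"
  shows "W = 0"
proof -
  interpret positive_definite "G x" by (rule G_pos[OF x])
  define \<Theta> :: "(real^'n) \<times> real \<times> real \<Rightarrow> (real^'m) \<times> real" where
    "\<Theta> t = (\<Sum>j\<in>UNIV. fst t $ j *\<^sub>R P j x) + fst (snd t) *\<^sub>R X x + snd (snd t) *\<^sub>R \<nu>" for t
  have lin: "linear \<Theta>"
    by (rule linearI) (simp_all add: \<Theta>_def scaleR_add_left sum.distrib scaleR_sum_right algebra_simps)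
  have "inj \<Theta>"
    unfolding linear_injective_0[OF lin]
  proof (intro allI impI)
    fix t assume t: "\<Theta> t = 0"
    have \<nu>P: "lorentz (P i x) \<nu> = 0" "lorentz (X x) \<nu> = 0" "lorentz \<nu> \<nu> = 1" for i
      using \<nu> by (auto simp: unit_normal_at_def lorentz_commute)
    have "(G x *v fst t) $ i = lorentz (P i x) (\<Theta> t)" for i
      by (simp only: \<Theta>_def lorentz.add_right lorentz_P_sum lorentz.scaleR_right lorentz_P_X[OF x] \<nu>P) simp
    then have "G x *v fst t = 0" by (simp add: t vec_eq_iff lorentz.zero_right)
    then have "fst t = 0" using inv_left[of "fst t"] by simp
    have "lorentz (X x) (\<Theta> t) = - fst (snd t)"
      using \<open>fst t = 0\<close> by (simp add: \<Theta>_def lorentz.add_right lorentz.scaleR_right lorentz_X_X[OF x] \<nu>P)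
    moreover have "lorentz \<nu> (\<Theta> t) = snd (snd t)"
      using \<open>fst t = 0\<close> \<nu> by (simp add: \<Theta>_def lorentz.add_right lorentz.scaleR_right unit_normal_at_def)
    ultimately show "t = 0" using \<open>fst t = 0\<close> t by (simp add: lorentz.zero_right prod_eq_iff)
  qed
  then have "dim (range \<Theta>) = DIM((real^'m) \<times> real)"
    using dim_image_eq[OF lin, of UNIV] dims by (simp add: dim_UNIV)
  then have full: "range \<Theta> = UNIV"
    using dim_eq_full[of "range \<Theta>"] linear_subspace_image[OF lin subspace_UNIV] by (metis span_eq_iff)
  have "lorentz W (\<Theta> t) = 0" for t
    by (simp add: \<Theta>_def lorentz.add_right lorentz.scaleR_right lorentz.sum_right W)
  then have "lorentz W v = 0" for v using full by (metis surjD)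
  then show ?thesis by (rule lorentz_nondegenerate)
qed

text \<open>The component \<open>W\<close> of the time vector \<open>e\<close> that is normal to the
  hypersurface inside hyperbolic space has Lorentz square u^2 - 1 - |grad u|^2. It is orthogonal to
  \<open>X x\<close>, so this square is nonnegative.\<close>

lemma gradient_bound:
  assumes x: "x \<in> \<Omega>" shows "du x \<bullet> (Gi x *v du x) \<le> (u x)\<^sup>2"
proof -
  interpret positive_definite "G x" by (rule G_pos[OF x])
  define a where "a = Gi x *v du x"
  define \<xi> where "\<xi> = (\<Sum>j\<in>UNIV. a $ j *\<^sub>R P j x)"
  define e :: "(real^'m) \<times> real" where "e = (0, 1)"
  have e: "lorentz v e = - snd v" for v :: "(real^'m) \<times> real" by (simp add: e_def lorentz_def)
  have \<xi>P: "lorentz (P i x) \<xi> = snd (P i x)" for i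
    by (simp add: \<xi>_def lorentz_P_sum a_def inv_right)
  have \<xi>X: "lorentz \<xi> (X x) = 0"
    by (simp add: \<xi>_def lorentz.sum_left lorentz.scaleR_left lorentz_P_X[OF x])
  have \<xi>e: "lorentz \<xi> e = - (du x \<bullet> a)"
    by (simp add: e \<xi>_def snd_sum inner_vec_def mult.commute)
  \<comment> \<open>As \<open>lorentz v e = - snd v\<close>, the tangential part of \<open>e\<close>
    is \<open>- \<xi>\<close>; as \<open>lorentz (X x) (X x) = - 1\<close>, its part along the
    position is \<open>u x *\<^sub>R X x\<close>. Both are removed.\<close>
  define W where "W = e + \<xi> - u x *\<^sub>R X x"
  have WX: "lorentz W (X x) = 0"
    using e[of "X x"] by (simp add: W_def lorentz.add_left lorentz.diff_left lorentz.scaleR_left \<xi>X lorentz_X_X[OF x] lorentz_commute[of e])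
  have PW: "lorentz (P i x) W = 0" for i
    by (simp add: W_def lorentz.add_right lorentz.diff_right lorentz.scaleR_right e \<xi>P lorentz_P_X[OF x])
  then have WP: "lorentz W (P i x) = 0" for i by (simp add: lorentz_commute)
  have "0 \<le> lorentz W W"
    using lorentz_pos_of_orthogonal[OF hyp[OF x] WX] by (cases "W = 0") (auto simp: lorentz.zero_right)
  also have "lorentz W W = lorentz W e + lorentz W \<xi> - u x * lorentz W (X x)"
    by (subst (2) W_def) (simp add: lorentz.add_right lorentz.diff_right lorentz.scaleR_right)
  also have "lorentz W \<xi> = 0" by (simp add: \<xi>_def lorentz.sum_right lorentz.scaleR_right WP)
  also have "lorentz W e = - 1 - du x \<bullet> a + (u x)\<^sup>2"
  proof -
    have "lorentz W e = lorentz e e + lorentz \<xi> e - u x * lorentz (X x) e"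
      by (simp add: W_def lorentz.add_left lorentz.diff_left lorentz.scaleR_left)
    moreover have "lorentz e e = - 1" by (simp add: e_def lorentz_def)
    ultimately show ?thesis using \<xi>e e[of "X x"] by (simp add: power2_eq_square)
  qed
  finally show ?thesis by (simp add: WX a_def)
qed

text \<open>The frame dual to \<open>P\<close> with respect to \<open>G\<close>; its height components are those of the gradient of \<open>u\<close>.\<close>

definition dual :: "'n \<Rightarrow> real^'n \<Rightarrow> (real^'m) \<times> real" where
  "dual i x = (\<Sum>j\<in>UNIV. Gi x $ i $ j *\<^sub>R P j x)"

lemma C1_dual: "C1_on (dual i) \<Omega>"
  unfolding dual_def[abs_def]
  by (intro C1_on_sum C1_on_bounded_bilinear[OF bounded_bilinear_scaleR] C1_Gi C1_P)

lemma diff_dual: "x \<in> \<Omega> \<Longrightarrow> dual i differentiable at x" using C1_dual by (rule C1_on_differentiable)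

lemma lorentz_dual_P:
  assumes "x \<in> \<Omega>" shows "lorentz (dual i x) (P k x) = (if i = k then 1 else 0)"
proof -
  interpret positive_definite "G x" by (rule G_pos[OF assms])
  have "lorentz (dual i x) (P k x) = (Gi x ** G x) $ i $ k"
    by (simp add: dual_def lorentz.sum_left lorentz.scaleR_left matrix_matrix_mult_def G_comp)
  then show ?thesis by (simp add: matrix_inv_inverse[OF det_nonzero] mat_def)
qed

lemma lorentz_dual_X: "x \<in> \<Omega> \<Longrightarrow> lorentz (dual i x) (X x) = 0"
  by (simp add: dual_def lorentz.sum_left lorentz.scaleR_left lorentz_P_X)

text \<open>Differentiating the duality relation trades derivatives of the inverse metric for second
  derivatives of \<open>X\<close>, so Christoffel symbols never have to be written out.\<close>

lemma lorentz_pderiv_dual_P: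
  assumes "x \<in> \<Omega>" shows "lorentz (pderiv_at l (dual i) x) (P k x) = - lorentz (dual i x) (pderiv_at l (P k) x)"
proof -
  have "pderiv_at l (\<lambda>y. lorentz (dual i y) (P k y)) x = pderiv_at l (\<lambda>y. if i = k then 1 else 0) x"
    by (rule pderiv_at_cong[OF open_\<Omega> assms lorentz_dual_P])
      (use assms in \<open>auto intro!: C1_on_differentiable[OF C1_on_bounded_bilinear[OF bounded_bilinear_lorentz C1_dual C1_P]]\<close>)
  then show ?thesis
    using pderiv_at_bilinear[OF bounded_bilinear_lorentz diff_dual[OF assms] diff_P[OF assms], of l i k]
    by (simp add: pderiv_at_const)
qed

lemma lorentz_pderiv_dual_X:
  assumes "x \<in> \<Omega>" shows "lorentz (pderiv_at l (dual i) x) (X x) = - (if i = l then 1 else 0)"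
proof -
  have "pderiv_at l (\<lambda>y. lorentz (dual i y) (X y)) x = pderiv_at l (\<lambda>y. 0) x"
    by (rule pderiv_at_cong[OF open_\<Omega> assms lorentz_dual_X])
      (use assms in \<open>auto intro!: C1_on_differentiable[OF C1_on_bounded_bilinear[OF bounded_bilinear_lorentz C1_dual C1_X]]\<close>)
  then show ?thesis
    using pderiv_at_bilinear[OF bounded_bilinear_lorentz diff_dual[OF assms] diff_X[OF assms], of l i]
      lorentz_dual_P[OF assms, of i l]
    by (simp add: pderiv_at_const)
qed

lemma pderiv_P_commute:
  assumes "x \<in> \<Omega>" shows "pderiv_at i (P j) x = pderiv_at j (P i) x"
  using mixed_derivatives_commute[OF smooth open_\<Omega> assms] by (simp add: pderiv_at_def[abs_def])

text \<open>Jacobi's formula for the metric. The product rule yields two sums that agree by symmetry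
  of \<open>Gi\<close>, which cancels the factor 1/2 from the square root. The sum in the statement
  is the contracted Christoffel symbol.\<close>

lemma pderiv_w:
  assumes x: "x \<in> \<Omega>"
  shows "pderiv_at k w x = w x * (\<Sum>i\<in>UNIV. lorentz (dual i x) (pderiv_at k (P i) x))"
proof -
  interpret positive_definite "G x" by (rule G_pos[OF x])
  have G': "((\<lambda>y. G y $ i $ j) has_derivative frechet_derivative (\<lambda>y. G y $ i $ j) (at x)) (at x)" for i j
    by (rule C1_onD(1)[OF C1_G x])
  define dG where "dG i j = pderiv_at k (\<lambda>y. G y $ i $ j) x" for i j
  have dG: "dG i j = lorentz (P i x) (pderiv_at k (P j) x) + lorentz (pderiv_at k (P i) x) (P j x)" for i j
    unfolding dG_def G_comp by (rule pderiv_at_bilinear[OF bounded_bilinear_lorentz diff_P[OF x] diff_P[OF x]])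
  let ?dd = "\<lambda>v. det (G x) * (\<Sum>i\<in>UNIV. \<Sum>j\<in>UNIV. frechet_derivative (\<lambda>y. G y $ i $ j) (at x) v * Gi x $ j $ i)"
  have "((\<lambda>y. det (G y)) has_derivative ?dd) (at x)"
    by (rule has_derivative_det[OF G' matrix_inv_inverse(2)[OF det_nonzero]])
  moreover have "(sqrt has_derivative (\<lambda>h. inverse (w x) / 2 * h)) (at (det (G x)))"
    using DERIV_real_sqrt[OF det_pos] unfolding has_field_derivative_def .
  ultimately have D: "(w has_derivative (\<lambda>v. inverse (w x) / 2 * ?dd v)) (at x)"
    by (rule has_derivative_compose)
  have "pderiv_at k w x = inverse (w x) / 2 * (det (G x) * (\<Sum>i\<in>UNIV. \<Sum>j\<in>UNIV. dG i j * Gi x $ j $ i))"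
    using fun_cong[OF frechet_derivative_at[OF D, symmetric], of "axis k 1"] by (simp add: pderiv_at_def dG_def)
  also have "(\<Sum>i\<in>UNIV. \<Sum>j\<in>UNIV. dG i j * Gi x $ j $ i) =
      (\<Sum>i\<in>UNIV. \<Sum>j\<in>UNIV. lorentz (P i x) (pderiv_at k (P j) x) * Gi x $ j $ i) +
      (\<Sum>i\<in>UNIV. \<Sum>j\<in>UNIV. lorentz (pderiv_at k (P i) x) (P j x) * Gi x $ j $ i)"
    by (simp add: dG distrib_right sum.distrib)
  also have "(\<Sum>i\<in>UNIV. \<Sum>j\<in>UNIV. lorentz (P i x) (pderiv_at k (P j) x) * Gi x $ j $ i) =
      (\<Sum>i\<in>UNIV. lorentz (dual i x) (pderiv_at k (P i) x))"
    by (subst sum.swap) (simp add: dual_def lorentz.sum_left lorentz.scaleR_left mult.commute)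
  also have "(\<Sum>i\<in>UNIV. \<Sum>j\<in>UNIV. lorentz (pderiv_at k (P i) x) (P j x) * Gi x $ j $ i) =
      (\<Sum>i\<in>UNIV. lorentz (dual i x) (pderiv_at k (P i) x))"
    by (simp add: dual_def lorentz.sum_left lorentz.scaleR_left mult.commute inv_sym[of _ _] lorentz_commute[of "P _ x"])
  also have "inverse (w x) / 2 * (det (G x) * ((\<Sum>i\<in>UNIV. lorentz (dual i x) (pderiv_at k (P i) x)) +
      (\<Sum>i\<in>UNIV. lorentz (dual i x) (pderiv_at k (P i) x)))) =
      inverse (w x) * det (G x) * (\<Sum>i\<in>UNIV. lorentz (dual i x) (pderiv_at k (P i) x))"
    by simp
  also have "inverse (w x) * det (G x) = w x"
    using det_pos by (simp add: real_div_sqrt divide_inverse[symmetric] mult.commute)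
  finally show ?thesis .
qed

text \<open>This is \<open>\<Delta> X = n X\<close>: both sides have the same Lorentz products with the basis \<open>P i\<close>, \<open>X\<close>, \<open>\<nu>\<close>.\<close>

lemma laplace_X:
  assumes x: "x \<in> \<Omega>" and \<nu>: "unit_normal_at x \<nu>"
    and minimal: "(\<Sum>i\<in>UNIV. \<Sum>j\<in>UNIV. Gi x $ i $ j * lorentz (pderiv_at i (P j) x) \<nu>) = 0"
  shows "(\<Sum>i\<in>UNIV. pderiv_at i (\<lambda>y. w y *\<^sub>R dual i y) x) = (w x * real CARD('n)) *\<^sub>R X x"
proof -
  have d: "pderiv_at i (\<lambda>y. w y *\<^sub>R dual i y) x = w x *\<^sub>R pderiv_at i (dual i) x + pderiv_at i w x *\<^sub>R dual i x" for i
    by (rule pderiv_at_scaleR[OF C1_on_differentiable[OF C1_w x] diff_dual[OF x]])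
  define V where "V = (\<Sum>i\<in>UNIV. pderiv_at i (\<lambda>y. w y *\<^sub>R dual i y) x)"
  have V: "lorentz V Z = (\<Sum>i\<in>UNIV. w x * lorentz (pderiv_at i (dual i) x) Z) + (\<Sum>i\<in>UNIV. pderiv_at i w x * lorentz (dual i x) Z)" for Z
    by (simp add: V_def d lorentz.sum_left lorentz.add_left lorentz.scaleR_left sum.distrib)
  have "V - (w x * real CARD('n)) *\<^sub>R X x = 0"
  proof (rule zero_if_orthogonal[OF x \<nu>])
    have n: "lorentz (P j x) \<nu> = 0" "lorentz (X x) \<nu> = 0" for j
      using \<nu> by (simp_all add: unit_normal_at_def lorentz_commute)
    have dn: "lorentz (dual i x) \<nu> = 0" for i
      by (simp add: dual_def lorentz.sum_left lorentz.scaleR_left n)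
    \<comment> \<open>The derivatives of \<open>Gi\<close> multiply tangent vectors, which
      \<open>\<nu>\<close> annihilates; summing over \<open>i\<close> leaves the expression in
      \<open>minimal\<close>.\<close>
    have pd: "lorentz (pderiv_at i (dual i) x) \<nu> = (\<Sum>j\<in>UNIV. Gi x $ i $ j * lorentz (pderiv_at i (P j) x) \<nu>)" for i
    proof -
      have "pderiv_at i (dual i) x = (\<Sum>j\<in>UNIV. pderiv_at i (\<lambda>y. Gi y $ i $ j *\<^sub>R P j y) x)"
        unfolding dual_def[abs_def]
        by (rule pderiv_at_sum, rule C1_on_differentiable[OF C1_on_bounded_bilinear[OF bounded_bilinear_scaleR C1_Gi C1_P] x])
      also have "\<dots> = (\<Sum>j\<in>UNIV. Gi x $ i $ j *\<^sub>R pderiv_at i (P j) x + pderiv_at i (\<lambda>y. Gi y $ i $ j) x *\<^sub>R P j x)"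
        by (intro sum.cong refl pderiv_at_scaleR C1_on_differentiable[OF C1_Gi x] diff_P[OF x])
      finally show ?thesis
        by (simp add: lorentz.sum_left lorentz.add_left lorentz.scaleR_left n)
    qed
    have "lorentz V \<nu> = w x * (\<Sum>i\<in>UNIV. \<Sum>j\<in>UNIV. Gi x $ i $ j * lorentz (pderiv_at i (P j) x) \<nu>)"
      by (simp add: V pd dn sum_distrib_left)
    then show "lorentz (V - (w x * real CARD('n)) *\<^sub>R X x) \<nu> = 0"
      using minimal by (simp add: lorentz.diff_left lorentz.scaleR_left n)
    \<comment> \<open>Each of the n dual vectors contributes \<open>- w x\<close>, and the
      right-hand side matches because \<open>lorentz (X x) (X x) = - 1\<close>.\<close>
    show "lorentz (V - (w x * real CARD('n)) *\<^sub>R X x) (X x) = 0"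
      by (simp add: lorentz.diff_left lorentz.scaleR_left V lorentz_pderiv_dual_X[OF x] lorentz_dual_X[OF x] lorentz_X_X[OF x]
          sum_negf)
    fix k
    \<comment> \<open>The tangential component cancels: symmetry of second derivatives identifies
      the contribution of the dual frame with the derivative of \<open>w\<close>.\<close>
    have "lorentz V (P k x) = - (\<Sum>i\<in>UNIV. w x * lorentz (dual i x) (pderiv_at i (P k) x)) + pderiv_at k w x"
      by (simp add: V lorentz_pderiv_dual_P[OF x] lorentz_dual_P[OF x] sum_negf if_distrib sum.delta cong: if_cong)
    also have "\<dots> = 0"
      by (simp add: pderiv_w[OF x] sum_distrib_left pderiv_P_commute[OF x, of _ k])
    finally show "lorentz (V - (w x * real CARD('n)) *\<^sub>R X x) (P k x) = 0"
      using lorentz_P_X[OF x, of k] by (simp add: lorentz.diff_left lorentz.scaleR_left lorentz_commute[of "X x"])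
  qed
  then show ?thesis by (simp add: V_def)
qed

text \<open>The contravariant components of the gradient of \<open>ln u\<close>, weighted by the
  volume density. With this weight the plain coordinate divergence equals the density times the
  Riemannian divergence.\<close>

definition log_height_field :: "'n \<Rightarrow> real^'n \<Rightarrow> real" where
  "log_height_field i x = w x * snd (dual i x) * inverse (u x)"

lemma C1_u: "C1_on (\<lambda>x. u x) \<Omega>"
  by (rule C1_on_bounded_linear[OF bounded_linear_snd C1_X])

lemma C1_snd_dual: "C1_on (\<lambda>x. w x * snd (dual i x)) \<Omega>"
  by (intro C1_on_mult C1_w C1_on_bounded_linear[OF bounded_linear_snd C1_dual])

lemma C1_inverse_u: "C1_on (\<lambda>x. inverse (u x)) \<Omega>"
  by (rule C1_on_inverse[OF C1_u]) (use u_pos in force)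

lemma C1_log_height_field: "C1_on (log_height_field i) \<Omega>"
  unfolding log_height_field_def[abs_def] by (rule C1_on_mult[OF C1_snd_dual C1_inverse_u])

lemma snd_dual: "snd (dual i x) = (Gi x *v du x) $ i"
  by (simp add: dual_def snd_sum matrix_vector_mult_def)

lemma log_height_field_eq: "log_height_field i x = w x * ((Gi x *v du x) $ i / u x)"
  by (simp add: log_height_field_def snd_dual divide_inverse)

text \<open>Product rule for the weighted gradient of \<open>u\<close> and
  \<open>inverse (u x)\<close>: the time component of \<open>laplace_X\<close> supplies the
  dimension term, the derivative of the inverse the quadratic gradient term.\<close>

lemma divergence_log_height_field:
  assumes x: "x \<in> \<Omega>" and \<nu>: "unit_normal_at x \<nu>"
    and minimal: "(\<Sum>i\<in>UNIV. \<Sum>j\<in>UNIV. Gi x $ i $ j * lorentz (pderiv_at i (P j) x) \<nu>) = 0"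
  shows "(\<Sum>i\<in>UNIV. pderiv_at i (log_height_field i) x) = w x * (real CARD('n) - (du x \<bullet> (Gi x *v du x)) / (u x)\<^sup>2)"
proof -
  have up: "u x > 0" by (rule u_pos[OF x])
  have du: "pderiv_at i (\<lambda>y. u y) x = du x $ i" for i
    by (simp add: pderiv_at_linear[OF bounded_linear_snd diff_X[OF x]])
  have inv: "pderiv_at i (\<lambda>y. inverse (u y)) x = - (du x $ i / (u x)\<^sup>2)" for i
  proof -
    have "pderiv_at i (\<lambda>y. u y * inverse (u y)) x = pderiv_at i (\<lambda>y. 1) x"
      by (rule pderiv_at_cong[OF open_\<Omega> x _ C1_on_differentiable[OF C1_on_mult[OF C1_u C1_inverse_u] x]])
        (use u_pos in force)
    then have "u x * pderiv_at i (\<lambda>y. inverse (u y)) x + du x $ i * inverse (u x) = 0"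
      using pderiv_at_mult[OF C1_on_differentiable[OF C1_u x] C1_on_differentiable[OF C1_inverse_u x], of i]
      by (simp add: pderiv_at_const du)
    then show ?thesis using up by (simp add: field_simps power2_eq_square) 
  qed
  have "pderiv_at i (log_height_field i) x = (w x * snd (dual i x)) * - (du x $ i / (u x)\<^sup>2) +
      snd (pderiv_at i (\<lambda>y. w y *\<^sub>R dual i y) x) * inverse (u x)" for i
  proof -
    have "pderiv_at i (\<lambda>y. w y * snd (dual i y)) x = pderiv_at i (\<lambda>y. snd (w y *\<^sub>R dual i y)) x" by simp
    also have "\<dots> = snd (pderiv_at i (\<lambda>y. w y *\<^sub>R dual i y) x)"
      by (rule pderiv_at_linear[OF bounded_linear_snd])
        (rule C1_on_differentiable[OF C1_on_bounded_bilinear[OF bounded_bilinear_scaleR C1_w C1_dual] x])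
    finally show ?thesis
      using pderiv_at_mult[OF C1_on_differentiable[OF C1_snd_dual x] C1_on_differentiable[OF C1_inverse_u x], of i i]
      by (simp only: log_height_field_def[abs_def] inv)
  qed
  then have "(\<Sum>i\<in>UNIV. pderiv_at i (log_height_field i) x) =
     (\<Sum>i\<in>UNIV. (w x * snd (dual i x)) * - (du x $ i / (u x)\<^sup>2)) + snd (\<Sum>i\<in>UNIV. pderiv_at i (\<lambda>y. w y *\<^sub>R dual i y) x) * inverse (u x)"
    by (simp only: sum.distrib snd_sum sum_distrib_right)
  also have "snd (\<Sum>i\<in>UNIV. pderiv_at i (\<lambda>y. w y *\<^sub>R dual i y) x) * inverse (u x) = w x * real CARD('n)"
    using up by (simp add: laplace_X[OF x \<nu> minimal])
  also have "(\<Sum>i\<in>UNIV. (w x * snd (dual i x)) * - (du x $ i / (u x)\<^sup>2)) = - (w x * (du x \<bullet> (Gi x *v du x)) / (u x)\<^sup>2)"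
    by (simp add: snd_dual inner_vec_def sum_negf sum_distrib_left sum_divide_distrib mult_ac)
  finally show ?thesis by (simp add: algebra_simps)
qed

end

section \<open>Change of variables\<close>

text \<open>The change of variables theorem of the library asks for a well-ordered index type; the type \<open>'a wo\<close>
  is a copy of \<open>'a\<close> with an arbitrary well-order.\<close>

typedef 'a wo = "UNIV :: 'a set" by simp

instance wo :: (finite) finite
proof
  have "finite (range (Abs_wo :: 'a \<Rightarrow> 'a wo))" by simp
  then show "finite (UNIV :: 'a wo set)"
    using type_definition.Abs_image[OF type_definition_wo] by metis
qed

definition wo_index :: "'a::finite wo \<Rightarrow> nat" where
  "wo_index = (SOME f. inj f)"

lemma inj_wo_index: "inj (wo_index :: 'a::finite wo \<Rightarrow> nat)"
proof -
  have "\<exists>f :: 'a wo \<Rightarrow> nat. inj f" using finite_imp_inj_to_nat_seg[of "UNIV :: 'a wo set"] by blast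
  then show ?thesis unfolding wo_index_def by (rule someI_ex)
qed

instantiation wo :: (finite) wellorder
begin

definition less_eq_wo :: "'a wo \<Rightarrow> 'a wo \<Rightarrow> bool" where "x \<le> y \<longleftrightarrow> wo_index x \<le> wo_index y"
definition less_wo :: "'a wo \<Rightarrow> 'a wo \<Rightarrow> bool" where "x < y \<longleftrightarrow> wo_index x < wo_index y"

instance
proof
  fix x y z :: "'a wo"
  show "x < y \<longleftrightarrow> x \<le> y \<and> \<not> y \<le> x" "x \<le> x" "x \<le> y \<or> y \<le> x"
    by (auto simp: less_eq_wo_def less_wo_def)
  show "x \<le> z" if "x \<le> y" "y \<le> z" using that by (simp add: less_eq_wo_def)
  show "x = y" if "x \<le> y" "y \<le> x" using that inj_wo_index by (auto simp: less_eq_wo_def inj_def)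
  show "P a" if "\<And>x. (\<And>y. y < x \<Longrightarrow> P y) \<Longrightarrow> P x" for P and a :: "'a wo"
  proof (induction a rule: measure_induct_rule[of wo_index])
    case (less x)
    show ?case
    proof (rule that)
      fix y assume "y < x"
      then show "P y" using less[of y] by (simp add: less_wo_def)
    qed
  qed
qed

end

lemma bij_Rep_wo: "bij Rep_wo"
  by (metis Abs_wo_inverse Rep_wo_inverse UNIV_I bijI')

lemma Rep_Abs_wo[simp]: "Rep_wo (Abs_wo x) = x" by (simp add: Abs_wo_inverse)
lemma Abs_Rep_wo[simp]: "Abs_wo (Rep_wo x) = x" by (rule Rep_wo_inverse)

definition to_wo :: "real^'n::finite \<Rightarrow> real^('n wo)" where "to_wo v = (\<chi> i. v $ Rep_wo i)"
definition of_wo :: "real^('n::finite wo) \<Rightarrow> real^'n" where "of_wo v = (\<chi> i. v $ Abs_wo i)"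

lemma to_of_wo[simp]: "to_wo (of_wo v) = v" and of_to_wo[simp]: "of_wo (to_wo w) = w"
  by (simp_all add: to_wo_def of_wo_def vec_eq_iff)

lemma linear_to_wo: "linear to_wo" and linear_of_wo: "linear of_wo"
  by (auto intro!: linearI simp: to_wo_def of_wo_def vec_eq_iff)

lemma bounded_linear_to_wo: "bounded_linear to_wo" and bounded_linear_of_wo: "bounded_linear of_wo"
  using linear_to_wo linear_of_wo by (simp_all add: linear_conv_bounded_linear)

lemma measurable_wo[measurable]: "to_wo \<in> borel_measurable borel" "of_wo \<in> borel_measurable borel"
  by (auto intro!: borel_measurable_continuous_onI linear_continuous_on bounded_linear_to_wo bounded_linear_of_wo)

lemma of_wo_vimage_box: "of_wo -` box l u = box (to_wo l) (to_wo u)"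
proof -
  have "(\<forall>i. l $ i < x $ Abs_wo i \<and> x $ Abs_wo i < u $ i) \<longleftrightarrow>
      (\<forall>i. l $ Rep_wo i < x $ i \<and> x $ i < u $ Rep_wo i)" for x
    by (metis Abs_Rep_wo Rep_Abs_wo)
  then show ?thesis by (simp add: set_eq_iff mem_box_cart of_wo_def to_wo_def)
qed

lemma lborel_distr_of_wo: "distr lborel borel of_wo = (lborel :: (real^'n::finite) measure)"
proof (rule lborel_eqI[symmetric])
  fix l u :: "real^'n" assume le: "\<And>b. b \<in> Basis \<Longrightarrow> l \<bullet> b \<le> u \<bullet> b"
  have le': "l $ i \<le> u $ i" for i using le[of "axis i 1"] by (simp add: axis_in_Basis_iff inner_axis)
  have pr: "(\<Prod>b\<in>Basis. (v - w) \<bullet> b) = (\<Prod>i\<in>UNIV. v $ i - w $ i)" for v w :: "real^'k::finite"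
    by (simp add: Basis_vec_def UNION_singleton_eq_range prod.reindex inj_on_def axis_eq_axis inner_axis)
  have "emeasure (distr lborel borel of_wo) (box l u) = emeasure lborel (box (to_wo l) (to_wo u))"
    by (simp add: emeasure_distr of_wo_vimage_box)
  also have "\<dots> = (\<Prod>b\<in>Basis. (to_wo u - to_wo l) \<bullet> b)"
    by (rule emeasure_lborel_box) (auto simp: Basis_vec_def inner_axis to_wo_def le')
  also have "(\<Prod>b\<in>Basis. (to_wo u - to_wo l) \<bullet> b) = (\<Prod>b\<in>Basis. (u - l) \<bullet> b)"
    unfolding pr to_wo_def by (simp add: prod.reindex_bij_betw[OF bij_Rep_wo, of "\<lambda>i. u $ i - l $ i"])
  finally show "emeasure (distr lborel borel of_wo) (box l u) = (\<Prod>b\<in>Basis. (u - l) \<bullet> b)" .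
qed simp

text \<open>Conjugation by a bijection relabels each transposition and keeps their number. Hence
  signs of permutations, and with them determinants, are unaffected by renaming the index
  type.\<close>

lemma swapidseq_conj:
  assumes "swapidseq n p" "bij f"
  shows "swapidseq n (f \<circ> p \<circ> inv f)"
  using assms
proof (induction rule: swapidseq.induct)
  case id
  then have e: "f \<circ> id \<circ> inv f = id" by (simp add: fun_eq_iff bij_is_surj surj_f_inv_f)
  show ?case unfolding e by (rule swapidseq.id)
next
  case (comp_Suc n p a b)
  have "f \<circ> (Transposition.transpose a b \<circ> p) \<circ> inv f = Transposition.transpose (f a) (f b) \<circ> (f \<circ> p \<circ> inv f)"
    using \<open>bij f\<close> by (auto simp: fun_eq_iff Transposition.transpose_def bij_def inj_def)
  moreover have "f a \<noteq> f b" using comp_Suc \<open>bij f\<close> by (auto simp: bij_def inj_def)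
  ultimately show ?case using comp_Suc swapidseq.comp_Suc by metis
qed

lemma sign_conj:
  fixes p :: "'a::finite \<Rightarrow> 'a"
  assumes "p permutes UNIV" "bij f"
  shows "sign (f \<circ> p \<circ> inv f) = sign p"
proof -
  have "permutation p" using assms(1) finite permutation_permutes by blast
  then obtain n where n: "swapidseq n p" by (auto simp: permutation_def)
  then have "evenperm (f \<circ> p \<circ> inv f) = evenperm p"
    using evenperm_unique[OF n] evenperm_unique[OF swapidseq_conj[OF n assms(2)]] by metis
  then show ?thesis by (simp add: sign_def)
qed

lemma det_to_wo: "det (\<chi> i j. A $ Rep_wo i $ Rep_wo j) = det (A :: real^'n::finite^'n)"
proof -
  let ?c = "\<lambda>p. Abs_wo \<circ> p \<circ> Rep_wo :: 'n wo \<Rightarrow> 'n wo"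
  have inv: "inv (Abs_wo :: 'n \<Rightarrow> 'n wo) = Rep_wo" by (rule inv_equality) auto
  have bij: "bij (Abs_wo :: 'n \<Rightarrow> 'n wo)" by (metis Abs_Rep_wo Rep_Abs_wo bijI')
  have perm: "p permutes UNIV \<longleftrightarrow> bij p" for p :: "'k \<Rightarrow> 'k" by (simp add: bij_iff permutes_def)
  have bb: "bij_betw ?c {p. p permutes UNIV} {p. p permutes UNIV}"
  proof (rule bij_betw_byWitness[where f'="\<lambda>q. Rep_wo \<circ> q \<circ> Abs_wo"])
    show "?c ` {p. p permutes UNIV} \<subseteq> {p. p permutes UNIV}"
      using bij bij_Rep_wo by (auto simp: perm intro!: bij_comp)
    show "(\<lambda>q. Rep_wo \<circ> q \<circ> Abs_wo) ` {p. p permutes UNIV} \<subseteq> {p. p permutes (UNIV :: 'n set)}"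
      using bij bij_Rep_wo by (auto simp: perm intro!: bij_comp)
  qed (auto simp: fun_eq_iff)
  have "det (\<chi> i j. A $ Rep_wo i $ Rep_wo j) =
      (\<Sum>p\<in>{p. p permutes UNIV}. of_int (sign (?c p)) * (\<Prod>i\<in>UNIV. A $ Rep_wo i $ Rep_wo (?c p i)))"
    unfolding det_def by (subst sum.reindex_bij_betw[OF bb, symmetric]) simp
  also have "\<dots> = (\<Sum>p\<in>{p. p permutes UNIV}. of_int (sign p) * (\<Prod>i\<in>UNIV. A $ i $ p i))"
  proof (intro sum.cong refl arg_cong2[where f="(*)"])
    fix p :: "'n \<Rightarrow> 'n" assume "p \<in> {p. p permutes UNIV}"
    then show "of_int (sign (?c p)) = (of_int (sign p) :: real)"
      using sign_conj[OF _ bij, of p] by (simp add: inv)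
    show "(\<Prod>i\<in>UNIV. A $ Rep_wo i $ Rep_wo (?c p i)) = (\<Prod>i\<in>UNIV. A $ i $ p i)"
      by (simp add: prod.reindex_bij_betw[OF bij_Rep_wo, of "\<lambda>i. A $ i $ p i"])
  qed
  finally show ?thesis by (simp add: det_def)
qed

section \<open>The transformation formula for nonnegative functions\<close>

text \<open>A bridge from gauge integrals, used in the transformation formula, to nonnegative
  Lebesgue integrals. The value \<infinity> encodes failure of integrability, so two sides can be
  compared before either is known to be finite.\<close>

lemma nn_integral_eq_integral_if:
  fixes g :: "'a::euclidean_space \<Rightarrow> real"
  assumes meas: "(\<lambda>x. indicator S x * g x) \<in> borel_measurable borel" and nonneg: "\<And>x. x \<in> S \<Longrightarrow> 0 \<le> g x"
  shows "(\<integral>\<^sup>+x. ennreal (indicator S x * g x) \<partial>lborel) =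
    (if g absolutely_integrable_on S then ennreal (integral S g) else \<infinity>)"
proof -
  let ?h = "\<lambda>x. indicator S x * g x"
  have h0: "0 \<le> ?h x" for x using nonneg by (auto simp: indicator_def)
  have hm: "?h \<in> borel_measurable lborel" using meas by simp
  have iff: "g absolutely_integrable_on S \<longleftrightarrow> integrable lborel ?h"
    using integrable_completion[OF hm] by (simp add: set_integrable_def)
  show ?thesis
  proof (cases "g absolutely_integrable_on S")
    case True
    have "integral S g = (\<integral>x. ?h x \<partial>lebesgue)"
      using set_lebesgue_integral_eq_integral(2)[OF True] by (simp add: set_lebesgue_integral_def)
    also have "\<dots> = (\<integral>x. ?h x \<partial>lborel)" by (rule integral_completion[OF hm])
    finally show ?thesis using True iff nn_integral_eq_integral[of lborel ?h] h0 by simp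
  next
    case False
    then have "\<not> (\<integral>\<^sup>+x. ennreal (norm (?h x)) \<partial>lborel) < \<infinity>"
      using iff hm by (simp add: integrable_iff_bounded)
    then show ?thesis using False h0 by (simp add: not_less top_unique)
  qed
qed

text \<open>The equivalence for every value \<open>b\<close> transfers integrability as well as the
  integral. If one side is not integrable, neither is the other, and both nonnegative integrals are
  \<infinity>.\<close>

lemma nn_integral_change_of_variables_wellorder:
  fixes T :: "real^'m::{finite,wellorder} \<Rightarrow> real^'m::_" and f :: "real^'m::_ \<Rightarrow> real"
  assumes S: "S \<in> sets borel"
    and T: "\<And>x. x \<in> S \<Longrightarrow> (T has_derivative T' x) (at x)" and inj: "inj_on T S"
    and nonneg: "\<And>y. y \<in> T ` S \<Longrightarrow> 0 \<le> f y"
    and m1: "(\<lambda>y. indicator (T ` S) y * f y) \<in> borel_measurable borel"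
    and m2: "(\<lambda>x. indicator S x * (\<bar>det (matrix (T' x))\<bar> * f (T x))) \<in> borel_measurable borel"
  shows "(\<integral>\<^sup>+x. ennreal (indicator S x * (\<bar>det (matrix (T' x))\<bar> * f (T x))) \<partial>lborel) =
    (\<integral>\<^sup>+y. ennreal (indicator (T ` S) y * f y) \<partial>lborel)"
proof -
  let ?g = "\<lambda>x. \<bar>det (matrix (T' x))\<bar> * f (T x)"
  \<comment> \<open>The formula is applied to vector-valued functions, so the scalar integrand is
    wrapped as a vector in \<open>real^1\<close>.\<close>
  have iff: "(\<lambda>x. \<bar>det (matrix (T' x))\<bar> *\<^sub>R (vec (f (T x)) :: real^1)) absolutely_integrable_on S \<and>
      integral S (\<lambda>x. \<bar>det (matrix (T' x))\<bar> *\<^sub>R (vec (f (T x)) :: real^1)) = b \<longleftrightarrow>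
      (\<lambda>y. vec (f y) :: real^1) absolutely_integrable_on (T ` S) \<and> integral (T ` S) (\<lambda>y. vec (f y)) = b" for b
    by (rule has_absolute_integral_change_of_variables) (use S T inj in \<open>auto intro: has_derivative_at_withinI\<close>)
  have iff': "?g absolutely_integrable_on S \<and> integral S ?g = b \<longleftrightarrow>
      f absolutely_integrable_on (T ` S) \<and> integral (T ` S) f = b" for b
    using iff[of "vec b"] by (simp add: absolutely_integrable_on_1_iff integral_on_1_eq vec_eq_iff)
  have "(\<integral>\<^sup>+x. ennreal (indicator S x * ?g x) \<partial>lborel) = (if ?g absolutely_integrable_on S then ennreal (integral S ?g) else \<infinity>)"
    by (rule nn_integral_eq_integral_if[OF m2]) (use nonneg in auto)
  moreover have "(\<integral>\<^sup>+y. ennreal (indicator (T ` S) y * f y) \<partial>lborel) = (if f absolutely_integrable_on (T ` S) then ennreal (integral (T ` S) f) else \<infinity>)"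
    by (rule nn_integral_eq_integral_if[OF m1 nonneg])
  ultimately show ?thesis using iff'[of "integral S ?g"] iff'[of "integral (T ` S) f"] by auto
qed

text \<open>Conjugating \<open>T\<close> with the relabelling of coordinates preserves Lebesgue
  measure and the Jacobian determinant, which reduces the claim to a well-ordered index
  type.\<close>

lemma nn_integral_change_of_variables:
  fixes T :: "real^'n::finite \<Rightarrow> real^'n" and f :: "real^'n \<Rightarrow> real"
  assumes S: "S \<in> sets borel"
    and T: "\<And>x. x \<in> S \<Longrightarrow> (T has_derivative T' x) (at x)" and inj: "inj_on T S"
    and nonneg: "\<And>y. y \<in> T ` S \<Longrightarrow> 0 \<le> f y"
    and m1[measurable]: "(\<lambda>y. indicator (T ` S) y * f y) \<in> borel_measurable borel"
    and m2[measurable]: "(\<lambda>x. indicator S x * (\<bar>det (matrix (T' x))\<bar> * f (T x))) \<in> borel_measurable borel"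
  shows "(\<integral>\<^sup>+x. ennreal (indicator S x * (\<bar>det (matrix (T' x))\<bar> * f (T x))) \<partial>lborel) =
    (\<integral>\<^sup>+y. ennreal (indicator (T ` S) y * f y) \<partial>lborel)"
proof -
  define S2 where "S2 = of_wo -` S"
  define T2 where "T2 = to_wo \<circ> T \<circ> of_wo"
  define T2' where "T2' y = to_wo \<circ> T' (of_wo y) \<circ> of_wo" for y
  have tr: "(\<integral>\<^sup>+x. h x \<partial>lborel) = (\<integral>\<^sup>+y. h (of_wo y) \<partial>lborel)" if "h \<in> borel_measurable borel" for h :: "real^'n \<Rightarrow> ennreal"
    using nn_integral_distr[of of_wo lborel borel h] that by (simp add: lborel_distr_of_wo)
  have detT: "det (matrix (T2' y)) = det (matrix (T' (of_wo y)))" for y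
  proof -
    have ax: "of_wo (axis j 1) = axis (Rep_wo j) 1" for j :: "'n wo"
      by (auto simp: of_wo_def axis_def vec_eq_iff)
    have "matrix (T2' y) = (\<chi> i j. matrix (T' (of_wo y)) $ Rep_wo i $ Rep_wo j)"
      by (simp add: matrix_def T2'_def vec_eq_iff to_wo_def ax)
    then show ?thesis by (simp add: det_to_wo)
  qed
  have img: "indicator (T2 ` S2) y = (indicator (T ` S) (of_wo y) :: real)" for y
  proof -
    have "y \<in> T2 ` S2" if "of_wo y \<in> T ` S"
    proof -
      from that obtain x where "x \<in> S" "of_wo y = T x" by blast
      then have "y = T2 (to_wo x)" "to_wo x \<in> S2"
        using to_of_wo[of y] by (simp_all add: T2_def S2_def)
      then show ?thesis by blast
    qed
    then have "y \<in> T2 ` S2 \<longleftrightarrow> of_wo y \<in> T ` S" by (auto simp: T2_def S2_def)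
    then show ?thesis by (simp add: indicator_def)
  qed
  have indS: "indicator S2 y = (indicator S (of_wo y) :: real)" for y by (simp add: S2_def indicator_def)
  have fT: "f (of_wo (T2 y)) = f (T (of_wo y))" for y by (simp add: T2_def)
  have c1: "(\<lambda>y. indicator (T ` S) (of_wo y) * f (of_wo y)) \<in> borel_measurable borel"
    using measurable_compose[OF measurable_wo(2) m1] .
  have c2: "(\<lambda>y. indicator S (of_wo y) * (\<bar>det (matrix (T' (of_wo y)))\<bar> * f (T (of_wo y)))) \<in> borel_measurable borel"
    using measurable_compose[OF measurable_wo(2) m2] .
  have "(\<integral>\<^sup>+y. ennreal (indicator S2 y * (\<bar>det (matrix (T2' y))\<bar> * f (of_wo (T2 y)))) \<partial>lborel) =
    (\<integral>\<^sup>+y. ennreal (indicator (T2 ` S2) y * f (of_wo y)) \<partial>lborel)"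
  proof (rule nn_integral_change_of_variables_wellorder[of S2 T2 T2' "\<lambda>y. f (of_wo y)"])
    show "S2 \<in> sets borel" unfolding S2_def using measurable_sets_borel[OF measurable_wo(2) S] by simp
    show "(T2 has_derivative T2' y) (at y)" if "y \<in> S2" for y
    proof -
      have "(T has_derivative T' (of_wo y)) (at (of_wo y))" using T that by (simp add: S2_def)
      then have "((T \<circ> of_wo) has_derivative (T' (of_wo y) \<circ> of_wo)) (at y)"
        by (intro diff_chain_at bounded_linear_imp_has_derivative bounded_linear_of_wo)
      then show ?thesis
        unfolding T2_def T2'_def o_assoc[symmetric]
        using bounded_linear.has_derivative[OF bounded_linear_to_wo] by (simp add: o_def)
    qed
    show "inj_on T2 S2"
    proof (rule inj_onI)
      fix x y assume "x \<in> S2" "y \<in> S2" "T2 x = T2 y"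
      then have "of_wo x \<in> S" "of_wo y \<in> S" "to_wo (T (of_wo x)) = to_wo (T (of_wo y))"
        by (simp_all add: S2_def T2_def)
      moreover from this(3) have "T (of_wo x) = T (of_wo y)" by (metis of_to_wo)
      ultimately have "of_wo x \<in> S" "of_wo y \<in> S" "T (of_wo x) = T (of_wo y)" by simp_all
      then have "of_wo x = of_wo y" using inj by (simp add: inj_on_def)
      then show "x = y" using to_of_wo by metis
    qed
    show "0 \<le> f (of_wo y)" if "y \<in> T2 ` S2" for y using that nonneg by (auto simp: T2_def S2_def)
    show "(\<lambda>y. indicator (T2 ` S2) y * f (of_wo y)) \<in> borel_measurable borel" unfolding img by (rule c1)
    show "(\<lambda>y. indicator S2 y * (\<bar>det (matrix (T2' y))\<bar> * f (of_wo (T2 y)))) \<in> borel_measurable borel"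
      unfolding indS detT fT by (rule c2)
  qed
  then show ?thesis unfolding img indS detT fT by (subst (1 2) tr) simp_all
qed

section \<open>Charts and the volume measure\<close>

locale hypersurface =
  fixes \<A> :: "('p::{second_countable_topology, t2_space}, 'n::finite) chart set"
    and F :: "'p \<Rightarrow> (real^'m::finite) \<times> real"
  assumes immersed: "immersed_hypersurface \<A> F"
begin

abbreviation param :: "('p, 'n) chart \<Rightarrow> real^'n \<Rightarrow> (real^'m) \<times> real" where
  "param c \<equiv> F \<circ> chart_inv c"
abbreviation region :: "('p, 'n) chart \<Rightarrow> (real^'n) set" where
  "region c \<equiv> snd c ` fst c"
abbreviation density_at :: "('p, 'n) chart \<Rightarrow> real^'n \<Rightarrow> real" where
  "density_at c x \<equiv> sqrt (det (metric_matrix (param c) x))"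
abbreviation transition :: "('p, 'n) chart \<Rightarrow> ('p, 'n) chart \<Rightarrow> real^'n \<Rightarrow> real^'n" where
  "transition c d \<equiv> snd d \<circ> chart_inv c"
abbreviation overlap :: "('p, 'n) chart \<Rightarrow> ('p, 'n) chart \<Rightarrow> (real^'n) set" where
  "overlap c d \<equiv> snd c ` (fst c \<inter> fst d)"

lemma atlas: "smooth_atlas \<A>" using immersed by (simp add: immersed_hypersurface_def)

lemma chart_open: "c \<in> \<A> \<Longrightarrow> open (fst c)" and region_open: "c \<in> \<A> \<Longrightarrow> open (region c)"
  using atlas by (auto simp: smooth_atlas_def)

lemma chart_homeomorphism: "c \<in> \<A> \<Longrightarrow> homeomorphism (fst c) (region c) (snd c) (chart_inv c)"
  using atlas by (auto simp: smooth_atlas_def)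

lemma chart_inv_chart: "c \<in> \<A> \<Longrightarrow> p \<in> fst c \<Longrightarrow> chart_inv c (snd c p) = p"
  using chart_homeomorphism by (simp add: homeomorphism_def)

lemma chart_chart_inv: "c \<in> \<A> \<Longrightarrow> x \<in> region c \<Longrightarrow> snd c (chart_inv c x) = x"
  using chart_homeomorphism unfolding homeomorphism_def by blast

lemma chart_inv_in: "c \<in> \<A> \<Longrightarrow> x \<in> region c \<Longrightarrow> chart_inv c x \<in> fst c"
  using chart_homeomorphism unfolding homeomorphism_def by blast

lemma chart_continuous: "c \<in> \<A> \<Longrightarrow> continuous_on (fst c) (snd c)"
  and chart_inv_continuous: "c \<in> \<A> \<Longrightarrow> continuous_on (region c) (chart_inv c)"
  using chart_homeomorphism by (auto simp: homeomorphism_def)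

lemma chart_image_eq: "c \<in> \<A> \<Longrightarrow> B \<subseteq> fst c \<Longrightarrow> snd c ` B = region c \<inter> chart_inv c -` B"
proof (intro equalityI subsetI)
  show "x \<in> region c \<inter> chart_inv c -` B" if "c \<in> \<A>" "B \<subseteq> fst c" "x \<in> snd c ` B" for x
    using that chart_inv_chart[of c] by auto
  show "x \<in> snd c ` B" if "c \<in> \<A>" "x \<in> region c \<inter> chart_inv c -` B" for x
    using that chart_chart_inv[of c x] by (metis IntE image_eqI vimageE)
qed

lemma overlap_open:
  assumes "c \<in> \<A>" "d \<in> \<A>" shows "open (overlap c d)"
proof -
  have "overlap c d = region c \<inter> chart_inv c -` (fst c \<inter> fst d)"
    by (rule chart_image_eq) (use assms in auto)
  moreover have "open (region c \<inter> chart_inv c -` (fst c \<inter> fst d))"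
    by (rule continuous_open_preimage[OF chart_inv_continuous region_open]) (intro assms open_Int chart_open)+
  ultimately show ?thesis by simp
qed

lemma transition_smooth: "c \<in> \<A> \<Longrightarrow> d \<in> \<A> \<Longrightarrow> Ck_on k (transition c d) (overlap c d)"
  using atlas by (auto simp: smooth_atlas_def smooth_on_def)

lemma parametrization: "c \<in> \<A> \<Longrightarrow> hyperbolic_parametrization (param c) (region c)"
  using immersed region_open by (auto simp: immersed_hypersurface_def hyperbolic_parametrization_def smooth_on_def)

lemma transition_in:
  assumes "c \<in> \<A>" "d \<in> \<A>" "x \<in> overlap c d"
  shows "x \<in> region c" "transition c d x \<in> overlap d c" "transition c d x \<in> region d"
    "param c x = param d (transition c d x)" "transition d c (transition c d x) = x"
  using assms by (auto simp: chart_inv_chart)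

lemma differentiable_transition:
  fixes \<Phi> :: "'p \<Rightarrow> 'b::real_normed_vector"
  assumes c: "c \<in> \<A>" and d: "d \<in> \<A>" and x: "x \<in> overlap c d"
    and \<Phi>: "\<Phi> \<circ> chart_inv d differentiable at (transition c d x)"
  shows "\<Phi> \<circ> chart_inv c differentiable at x"
    and "frechet_derivative (\<Phi> \<circ> chart_inv c) (at x) =
      frechet_derivative (\<Phi> \<circ> chart_inv d) (at (transition c d x)) \<circ> frechet_derivative (transition c d) (at x)"
proof -
  have dT: "transition c d differentiable at x"
    by (rule C1_on_differentiable[OF Ck_on_2D(1)[OF transition_smooth[OF c d]] x])
  have eq: "((\<Phi> \<circ> chart_inv d) \<circ> transition c d) y = (\<Phi> \<circ> chart_inv c) y" if "y \<in> overlap c d" for y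
    using that chart_inv_chart[OF c] chart_inv_chart[OF d] by auto
  have "((\<Phi> \<circ> chart_inv d) \<circ> transition c d has_derivative
      frechet_derivative (\<Phi> \<circ> chart_inv d) (at (transition c d x)) \<circ> frechet_derivative (transition c d) (at x)) (at x)"
    using dT \<Phi> by (intro diff_chain_at) (simp_all add: frechet_derivative_works)
  then have D: "(\<Phi> \<circ> chart_inv c has_derivative
      frechet_derivative (\<Phi> \<circ> chart_inv d) (at (transition c d x)) \<circ> frechet_derivative (transition c d) (at x)) (at x)"
    by (rule has_derivative_transform_within_open[OF _ overlap_open[OF c d] x eq])
  then show "\<Phi> \<circ> chart_inv c differentiable at x" by (rule differentiableI)
  show "frechet_derivative (\<Phi> \<circ> chart_inv c) (at x) =
      frechet_derivative (\<Phi> \<circ> chart_inv d) (at (transition c d x)) \<circ> frechet_derivative (transition c d) (at x)"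
    by (rule frechet_derivative_at[OF D, symmetric])
qed

lemma pderiv_transition:
  fixes \<Phi> :: "'p \<Rightarrow> 'b::real_normed_vector"
  assumes "c \<in> \<A>" "d \<in> \<A>" "x \<in> overlap c d" "\<Phi> \<circ> chart_inv d differentiable at (transition c d x)"
  shows "pderiv_at i (\<Phi> \<circ> chart_inv c) x =
    (\<Sum>a\<in>UNIV. pderiv_at i (transition c d) x $ a *\<^sub>R pderiv_at a (\<Phi> \<circ> chart_inv d) (transition c d x))"
  unfolding pderiv_at_def[of i] differentiable_transition(2)[OF assms]
  using frechet_derivative_sum_pderiv[OF assms(4)] by simp

lemma pderiv_param_transition:
  assumes c: "c \<in> \<A>" and d: "d \<in> \<A>" and x: "x \<in> overlap c d"
  shows "pderiv_at i (param c) x =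
    (\<Sum>a\<in>UNIV. pderiv_at i (transition c d) x $ a *\<^sub>R pderiv_at a (param d) (transition c d x))"
  by (rule pderiv_transition[OF assms])
    (rule hyperbolic_parametrization.diff_X[OF parametrization[OF d] transition_in(3)[OF c d x]])

lemma metric_transition:
  assumes c: "c \<in> \<A>" and d: "d \<in> \<A>" and x: "x \<in> overlap c d"
  defines "J \<equiv> matrix (frechet_derivative (transition c d) (at x))"
  shows "metric_matrix (param c) x = transpose J ** metric_matrix (param d) (transition c d x) ** J"
proof -
  interpret d: hyperbolic_parametrization "param d" "region d" by (rule parametrization[OF d])
  have J: "J $ a $ i = pderiv_at i (transition c d) x $ a" for a i
    by (simp add: J_def matrix_def pderiv_at_def)
  have "metric_matrix (param c) x $ i $ j =
      (\<Sum>b\<in>UNIV. (\<Sum>a\<in>UNIV. J $ a $ i * metric_matrix (param d) (transition c d x) $ a $ b) * J $ b $ j)" for i j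
  proof -
    have "metric_matrix (param c) x $ i $ j = (\<Sum>b\<in>UNIV. \<Sum>a\<in>UNIV. J $ b $ j * (J $ a $ i *
        lorentz (pderiv_at a (param d) (transition c d x)) (pderiv_at b (param d) (transition c d x))))"
      by (simp only: metric_matrix_def vec_lambda_beta pderiv_param_transition[OF c d x] lorentz.sum_left lorentz.sum_right
          lorentz.scaleR_left lorentz.scaleR_right J[symmetric] real_scaleR_def sum_distrib_left)
    also have "\<dots> = (\<Sum>b\<in>UNIV. (\<Sum>a\<in>UNIV. J $ a $ i * metric_matrix (param d) (transition c d x) $ a $ b) * J $ b $ j)"
      by (simp add: metric_matrix_def sum_distrib_left mult_ac)
    finally show ?thesis .
  qed
  then show ?thesis by (simp add: vec_eq_iff matrix_matrix_mult_def transpose_def)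
qed

text \<open>Determinants in the congruence \<open>metric_transition\<close> give the square of the
  Jacobian determinant; its root is the factor required by the transformation formula.\<close>

lemma density_transition:
  assumes c: "c \<in> \<A>" and d: "d \<in> \<A>" and x: "x \<in> overlap c d"
  shows "density_at c x = \<bar>det (matrix (frechet_derivative (transition c d) (at x)))\<bar> * density_at d (transition c d x)"
proof -
  let ?J = "matrix (frechet_derivative (transition c d) (at x))"
  have "det (metric_matrix (param c) x) = (det ?J)\<^sup>2 * det (metric_matrix (param d) (transition c d x))"
    unfolding metric_transition[OF c d x] det_mul det_transpose by (simp add: power2_eq_square)
  then show ?thesis by (simp only: real_sqrt_mult real_sqrt_abs)
qed

lemma density_pos: "c \<in> \<A> \<Longrightarrow> x \<in> region c \<Longrightarrow> density_at c x > 0"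
  using hyperbolic_parametrization.w_pos[OF parametrization] by blast

lemma density_continuous: "c \<in> \<A> \<Longrightarrow> continuous_on (region c) (density_at c)"
  using C1_onD(3)[OF hyperbolic_parametrization.C1_w[OF parametrization]] by blast

lemma density_measurable:
  assumes "c \<in> \<A>" "S \<in> sets borel" "S \<subseteq> region c"
  shows "(\<lambda>x. indicator S x * density_at c x) \<in> borel_measurable borel"
  using borel_measurable_continuous_on_indicator[OF assms(2) continuous_on_subset[OF density_continuous[OF assms(1)] assms(3)]]
  by simp

lemma chart_image_borel:
  assumes c: "c \<in> \<A>" and B: "B \<in> sets borel" "B \<subseteq> fst c"
  shows "snd c ` B \<in> sets borel"
proof -
  have "chart_inv c \<in> borel_measurable (restrict_space borel (region c))"
    using chart_inv_continuous[OF c] by (rule borel_measurable_continuous_on_restrict)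
  from measurable_sets[OF this B(1)]
  have "chart_inv c -` B \<inter> region c \<in> sets (restrict_space borel (region c))" by (simp add: space_restrict_space)
  moreover have "region c \<in> sets borel" using region_open[OF c] by simp
  ultimately have "chart_inv c -` B \<inter> region c \<in> sets borel"
    by (simp add: sets_restrict_space_iff)
  then show ?thesis by (simp add: chart_image_eq[OF c B(2)] Int_commute)
qed

section \<open>Construction of the volume measure\<close>

definition chart_volume :: "('p, 'n) chart \<Rightarrow> 'p set \<Rightarrow> ennreal" where
  "chart_volume c B = (\<integral>\<^sup>+x\<in>snd c ` B. ennreal (density_at c x) \<partial>lborel)"

lemma chart_volume_indicator:
  "chart_volume c B = (\<integral>\<^sup>+x. ennreal (indicator (snd c ` B) x * density_at c x) \<partial>lborel)"
  unfolding chart_volume_def by (intro nn_integral_cong) (auto simp: indicator_def)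

text \<open>The transformation formula for the transition map, together with
  \<open>density_transition\<close>. This consistency on overlaps is what makes the measures of
  different charts fit together.\<close>

lemma chart_volume_independent:
  assumes c: "c \<in> \<A>" and d: "d \<in> \<A>" and B: "B \<in> sets borel" "B \<subseteq> fst c \<inter> fst d"
  shows "chart_volume c B = chart_volume d B"
proof -
  let ?S = "snd c ` B" and ?T = "transition c d"
  let ?T' = "\<lambda>x. frechet_derivative ?T (at x)"
  have SO: "?S \<subseteq> overlap c d" using B by auto
  have TS: "?T ` ?S = snd d ` B" using B chart_inv_chart[OF c] by (force simp: image_iff)
  have dens: "indicator ?S x * (\<bar>det (matrix (?T' x))\<bar> * density_at d (?T x)) = indicator ?S x * density_at c x" for x
    using density_transition[OF c d, of x] SO by (auto simp: indicator_def)
  have "(\<integral>\<^sup>+x. ennreal (indicator ?S x * (\<bar>det (matrix (?T' x))\<bar> * density_at d (?T x))) \<partial>lborel) =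
      (\<integral>\<^sup>+y. ennreal (indicator (?T ` ?S) y * density_at d y) \<partial>lborel)"
  proof (rule nn_integral_change_of_variables)
    show "?S \<in> sets borel" by (rule chart_image_borel[OF c]) (use B in auto)
    show "(?T has_derivative ?T' x) (at x)" if "x \<in> ?S" for x
      using C1_onD(1)[OF Ck_on_2D(1)[OF transition_smooth[OF c d]]] that SO by blast
    show "inj_on ?T ?S" using transition_in(5)[OF c d] SO by (intro inj_on_inverseI[where g="transition d c"]) blast
    show "0 \<le> density_at d y" if "y \<in> ?T ` ?S" for y
      using that B density_pos[OF d, of y] unfolding TS by force
    show "(\<lambda>y. indicator (?T ` ?S) y * density_at d y) \<in> borel_measurable borel"
      unfolding TS by (rule density_measurable[OF d chart_image_borel[OF d]]) (use B in auto)
    show "(\<lambda>x. indicator ?S x * (\<bar>det (matrix (?T' x))\<bar> * density_at d (?T x))) \<in> borel_measurable borel"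
      unfolding dens by (rule density_measurable[OF c chart_image_borel[OF c]]) (use B in auto)
  qed
  then show ?thesis unfolding dens TS chart_volume_indicator .
qed

text \<open>A total version of \<open>chart_inv\<close>, constant off the coordinate region, so that
  it is Borel and a measure can be pushed forward along it.\<close>

definition local_inv :: "('p, 'n) chart \<Rightarrow> real^'n \<Rightarrow> 'p" where
  "local_inv c x = (if x \<in> region c then chart_inv c x else undefined)"

lemma measurable_local_inv:
  assumes c: "c \<in> \<A>" shows "local_inv c \<in> borel_measurable borel"
proof -
  have "{x \<in> space borel. x \<in> region c} \<in> sets borel" using region_open[OF c] by simp
  moreover have "chart_inv c \<in> borel_measurable (restrict_space borel {x. x \<in> region c})"
    using borel_measurable_continuous_on_restrict[OF chart_inv_continuous[OF c]] by simp
  ultimately show ?thesis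
    unfolding local_inv_def[abs_def] by (simp add: measurable_If_restrict_space_iff)
qed

definition chart_measure :: "('p, 'n) chart \<Rightarrow> 'p measure" where
  "chart_measure c = distr (density lborel (\<lambda>x. ennreal (indicator (region c) x * density_at c x))) borel (local_inv c)"

lemma sets_chart_measure[simp]: "sets (chart_measure c) = sets borel"
  by (simp add: chart_measure_def)

lemma emeasure_chart_measure:
  assumes c: "c \<in> \<A>" and B[measurable]: "B \<in> sets borel"
  shows "emeasure (chart_measure c) B = chart_volume c (B \<inter> fst c)"
proof -
  have [measurable]: "local_inv c \<in> borel_measurable borel" by (rule measurable_local_inv[OF c])
  have m[measurable]: "(\<lambda>x. indicator (region c) x * density_at c x) \<in> borel_measurable borel"
    by (rule density_measurable[OF c]) (use region_open[OF c] in auto)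
  have pre[measurable]: "local_inv c -` B \<in> sets borel"
    using measurable_sets_borel[OF measurable_local_inv[OF c] B] by simp
  have img: "snd c ` (B \<inter> fst c) = region c \<inter> local_inv c -` B"
    by (subst chart_image_eq[OF c]) (auto simp: local_inv_def chart_inv_in[OF c])
  have "emeasure (chart_measure c) B = emeasure (density lborel (\<lambda>x. ennreal (indicator (region c) x * density_at c x))) (local_inv c -` B)"
    unfolding chart_measure_def by (subst emeasure_distr) auto
  also have "\<dots> = (\<integral>\<^sup>+x. ennreal (indicator (region c) x * density_at c x) * indicator (local_inv c -` B) x \<partial>lborel)"
    by (rule emeasure_density) auto
  also have "\<dots> = chart_volume c (B \<inter> fst c)"
    unfolding chart_volume_indicator img by (intro nn_integral_cong) (auto simp: indicator_def)
  finally show ?thesis .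
qed

text \<open>A countable subfamily of charts that still covers, available by second countability.
  Enumeration by \<open>nat\<close> allows the domains to be made disjoint.\<close>

definition cover :: "nat \<Rightarrow> ('p, 'n) chart" where
  "cover = (SOME C. range C \<subseteq> \<A> \<and> (\<Union>k. fst (C k)) = UNIV)"

lemma cover: "cover k \<in> \<A>" "(\<Union>k. fst (cover k)) = UNIV"
proof -
  have "\<And>S. S \<in> fst ` \<A> \<Longrightarrow> open S" using chart_open by auto
  then obtain \<F> where \<F>: "\<F> \<subseteq> fst ` \<A>" "countable \<F>" "\<Union>\<F> = \<Union>(fst ` \<A>)" by (rule Lindelof)
  have U: "\<Union>(fst ` \<A>) = UNIV" using atlas by (simp add: smooth_atlas_def)
  obtain \<C> where \<C>: "\<C> \<subseteq> \<A>" "countable \<C>" "fst ` \<C> = \<F>"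
    using \<F>(1,2) by (metis countable_subset_image)
  have "\<C> \<noteq> {}" using \<C> \<F> U by auto
  then have "range (from_nat_into \<C>) = \<C>" using \<C>(2) by (simp add: range_from_nat_into)
  moreover from this have "(\<Union>k. fst (from_nat_into \<C> k)) = \<Union>\<F>" using \<C>(3) by (metis image_image)
  ultimately have "range (from_nat_into \<C>) \<subseteq> \<A> \<and> (\<Union>k. fst (from_nat_into \<C> k)) = UNIV"
    using \<C>(1) \<F>(3) U by simp
  then have "\<exists>C :: nat \<Rightarrow> _. range C \<subseteq> \<A> \<and> (\<Union>k. fst (C k)) = UNIV"
    by (rule exI[where x="from_nat_into \<C>" and P="\<lambda>C. range C \<subseteq> \<A> \<and> (\<Union>k. fst (C k)) = UNIV"])
  then have "range cover \<subseteq> \<A> \<and> (\<Union>k. fst (cover k)) = UNIV" unfolding cover_def by (rule someI_ex)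
  then show "cover k \<in> \<A>" "(\<Union>k. fst (cover k)) = UNIV" by auto
qed

abbreviation part :: "nat \<Rightarrow> 'p set" where "part \<equiv> disjointed (\<lambda>k. fst (cover k))"

lemma part_sets[measurable]: "part k \<in> sets borel"
proof -
  have "range (\<lambda>k. fst (cover k)) \<subseteq> sets borel" using chart_open[OF cover(1)] by (intro image_subsetI borel_open)
  from sets.range_disjointed_sets[OF this] show ?thesis by blast
qed

lemma part_subset: "part k \<subseteq> fst (cover k)" by (rule disjointed_subset)

lemma part_UN: "(\<Union>k. part k) = UNIV" using UN_disjointed_eq[of "\<lambda>k. fst (cover k)"] cover(2) by simp

lemma emeasure_parts:
  assumes "sets M = sets borel" "B \<in> sets borel"
  shows "emeasure M B = (\<Sum>k. emeasure M (B \<inter> part k))"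
proof -
  have "(\<Sum>k. emeasure M (B \<inter> part k)) = emeasure M (\<Union>k. B \<inter> part k)"
  proof (rule suminf_emeasure)
    show "range (\<lambda>k. B \<inter> part k) \<subseteq> sets M"
      using assms part_sets by (intro image_subsetI) simp
    show "disjoint_family (\<lambda>k. B \<inter> part k)"
      using disjoint_family_disjointed[of "\<lambda>k. fst (cover k)"] by (auto simp: disjoint_family_on_def)
  qed
  also have "(\<Union>k. B \<inter> part k) = B" using part_UN by auto
  finally show ?thesis by simp
qed

text \<open>The witness for the description in \<open>volume_measure\<close>: each disjoint
  \<open>part\<close> carries the measure of the chart that contains it.\<close>

definition glued_measure :: "'p measure" where
  "glued_measure = measure_of UNIV (sets borel) (\<lambda>B. \<Sum>k. emeasure (chart_measure (cover k)) (B \<inter> part k))"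

lemma sets_glued_measure: "sets glued_measure = sets borel"
  using sets.sigma_sets_eq[of "borel :: 'p measure"] by (simp add: glued_measure_def sets_measure_of)

lemma emeasure_glued_measure:
  assumes "B \<in> sets borel"
  shows "emeasure glued_measure B = (\<Sum>k. emeasure (chart_measure (cover k)) (B \<inter> part k))"
proof (rule emeasure_measure_of[OF glued_measure_def])
  show "sets borel \<subseteq> Pow (UNIV :: 'p set)" by simp
  show "positive (sets glued_measure) (\<lambda>B. \<Sum>k. emeasure (chart_measure (cover k)) (B \<inter> part k))"
    by (simp add: positive_def)
  show "countably_additive (sets glued_measure) (\<lambda>B. \<Sum>k. emeasure (chart_measure (cover k)) (B \<inter> part k))"
    unfolding countably_additive_def sets_glued_measure
  proof (intro allI impI)
    fix B :: "nat \<Rightarrow> 'p set" assume B: "range B \<subseteq> sets borel" "disjoint_family B"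
    let ?e = "\<lambda>i k. emeasure (chart_measure (cover k)) (B i \<inter> part k)"
    \<comment> \<open>The double series of nonnegative terms is rearranged by reading one of the
      sums as an integral over the counting measure.\<close>
    have "(\<Sum>i. \<Sum>k. ?e i k) = (\<Sum>i. \<integral>\<^sup>+k. ?e i k \<partial>count_space UNIV)"
      by (simp add: nn_integral_count_space_nat)
    also have "\<dots> = (\<integral>\<^sup>+k. (\<Sum>i. ?e i k) \<partial>count_space UNIV)"
      by (rule nn_integral_suminf[symmetric]) simp
    also have "\<dots> = (\<Sum>k. \<Sum>i. ?e i k)" by (simp add: nn_integral_count_space_nat)
    also have "\<dots> = (\<Sum>k. emeasure (chart_measure (cover k)) (\<Union>i. B i \<inter> part k))"
      by (intro suminf_cong suminf_emeasure)
        (use B in \<open>auto simp: disjoint_family_on_def\<close>)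
    also have "\<dots> = (\<Sum>k. emeasure (chart_measure (cover k)) ((\<Union>i. B i) \<inter> part k))"
    proof -
      have "(\<Union>i. B i \<inter> part k) = (\<Union>i. B i) \<inter> part k" for k by blast
      then show ?thesis by simp
    qed
    finally show "(\<Sum>i. \<Sum>k. ?e i k) = (\<Sum>k. emeasure (chart_measure (cover k)) ((\<Union>i. B i) \<inter> part k))" .
  qed
  show "B \<in> sets glued_measure" using assms by (simp add: sets_glued_measure)
qed

text \<open>On each \<open>part\<close> the covering chart can be exchanged for \<open>c\<close> by
  chart independence; countable additivity of the single measure of \<open>c\<close> then
  reassembles \<open>B\<close>.\<close>

lemma glued_measure_chart:
  assumes c: "c \<in> \<A>" and B: "B \<in> sets borel" "B \<subseteq> fst c"
  shows "emeasure glued_measure B = chart_volume c B"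
proof -
  have "emeasure (chart_measure (cover k)) (B \<inter> part k) = emeasure (chart_measure c) (B \<inter> part k)" for k
  proof -
    have "emeasure (chart_measure (cover k)) (B \<inter> part k) = chart_volume (cover k) (B \<inter> part k)"
      using part_subset[of k] B by (subst emeasure_chart_measure[OF cover(1)]) (auto simp: Int_absorb2 le_infI2)
    also have "\<dots> = chart_volume c (B \<inter> part k)"
      by (rule chart_volume_independent[OF cover(1) c]) (use B part_subset[of k] in auto)
    also have "\<dots> = emeasure (chart_measure c) (B \<inter> part k)"
      using B by (subst emeasure_chart_measure[OF c]) (auto simp: Int_absorb2 le_infI1)
    finally show ?thesis .
  qed
  then have "emeasure glued_measure B = (\<Sum>k. emeasure (chart_measure c) (B \<inter> part k))"
    by (simp add: emeasure_glued_measure[OF B(1)])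
  also have "\<dots> = emeasure (chart_measure c) B"
    by (rule emeasure_parts[symmetric]) (use B in auto)
  also have "\<dots> = chart_volume c B"
    using B by (simp add: emeasure_chart_measure[OF c] Int_absorb2)
  finally show ?thesis .
qed

text \<open>Existence is \<open>glued_measure_chart\<close>. For uniqueness, two candidates agree on
  the pieces of a Borel set in the disjoint parts, since every piece lies in one chart.\<close>

lemma volume_measure_eq: "volume_measure \<A> F = glued_measure"
  unfolding volume_measure_def
proof (rule the_equality, intro conjI ballI impI)
  show "sets glued_measure = sets borel" by (rule sets_glued_measure)
  show "emeasure glued_measure B = (\<integral>\<^sup>+x\<in>snd c ` B. ennreal (density_at c x) \<partial>lborel)"
    if "c \<in> \<A>" "B \<in> sets borel" "B \<subseteq> fst c" for c B
    using glued_measure_chart[OF that] by (simp add: chart_volume_def)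
  fix M :: "'p measure"
  assume M: "sets M = sets borel \<and> (\<forall>c\<in>\<A>. \<forall>B\<in>sets borel. B \<subseteq> fst c \<longrightarrow>
      emeasure M B = (\<integral>\<^sup>+x\<in>snd c ` B. ennreal (density_at c x) \<partial>lborel))"
  show "M = glued_measure"
  proof (rule measure_eqI)
    show "sets M = sets glued_measure" using M by (simp add: sets_glued_measure)
    fix B assume "B \<in> sets M"
    then have B: "B \<in> sets borel" using M by simp
    have "emeasure M (B \<inter> part k) = emeasure glued_measure (B \<inter> part k)" for k
    proof -
      have "B \<inter> part k \<in> sets borel" "B \<inter> part k \<subseteq> fst (cover k)" using B part_subset[of k] by auto
      then show ?thesis
        using M cover(1)[of k] glued_measure_chart[OF cover(1)] by (simp add: chart_volume_def)
    qed
    then show "emeasure M B = emeasure glued_measure B"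
      using emeasure_parts[of M B] emeasure_parts[of glued_measure B] B M by (simp add: sets_glued_measure)
  qed
qed

abbreviation vol :: "'p measure" where "vol \<equiv> volume_measure \<A> F"

lemma sets_vol[simp, measurable_cong]: "sets vol = sets borel"
  by (simp add: volume_measure_eq sets_glued_measure)

lemma emeasure_vol_chart:
  "c \<in> \<A> \<Longrightarrow> B \<in> sets borel \<Longrightarrow> B \<subseteq> fst c \<Longrightarrow> emeasure vol B = chart_volume c B"
  by (simp add: volume_measure_eq glued_measure_chart)

section \<open>Null sets and integrals in a chart\<close>

lemma chart_measure_eq_density:
  assumes c: "c \<in> \<A>"
  shows "chart_measure c = density vol (indicator (fst c))"
proof (rule measure_eqI)
  fix B assume "B \<in> sets (chart_measure c)"
  then have B: "B \<in> sets borel" by simp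
  have o: "fst c \<in> sets borel" using chart_open[OF c] by simp
  have "emeasure (density vol (indicator (fst c))) B = emeasure vol (fst c \<inter> B)"
    using B o by (subst emeasure_density) (auto simp: nn_integral_indicator[symmetric] indicator_inter_arith intro!: nn_integral_cong)
  also have "\<dots> = chart_volume c (B \<inter> fst c)"
    using emeasure_vol_chart[OF c, of "fst c \<inter> B"] B o by (simp add: Int_commute)
  finally show "emeasure (chart_measure c) B = emeasure (density vol (indicator (fst c))) B"
    by (simp add: emeasure_chart_measure[OF c B])
qed simp

lemma chart_null_set:
  assumes c: "c \<in> \<A>" and Z: "Z \<in> null_sets lborel"
  shows "{p \<in> fst c. snd c p \<in> Z} \<in> null_sets vol"
proof -
  have Zb: "Z \<in> sets borel" using Z by auto
  have "snd c \<in> borel_measurable (restrict_space borel (fst c))"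
    using chart_continuous[OF c] by (rule borel_measurable_continuous_on_restrict)
  from measurable_sets[OF this Zb]
  have "snd c -` Z \<inter> fst c \<in> sets (restrict_space borel (fst c))" by (simp add: space_restrict_space)
  moreover have "fst c \<in> sets borel" using chart_open[OF c] by simp
  ultimately have b: "{p \<in> fst c. snd c p \<in> Z} \<in> sets borel"
    by (simp add: sets_restrict_space_iff vimage_def Int_def conj_commute)
  have "chart_volume c {p \<in> fst c. snd c p \<in> Z} = (\<integral>\<^sup>+x. 0 \<partial>(lborel :: (real^'n) measure))"
    unfolding chart_volume_indicator
    by (rule nn_integral_cong_AE) (use AE_not_in[OF Z] in \<open>auto elim!: eventually_mono simp: indicator_def\<close>)
  then show ?thesis using b emeasure_vol_chart[OF c b] by (auto simp: null_sets_def)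
qed

lemma AE_vol_chart:
  assumes c: "c \<in> \<A>" and ae: "AE x in lborel. x \<in> region c \<longrightarrow> R x"
  shows "AE p in vol. p \<in> fst c \<longrightarrow> R (snd c p)"
proof -
  obtain Z where Z: "{x. \<not> (x \<in> region c \<longrightarrow> R x)} \<subseteq> Z" "Z \<in> null_sets lborel"
  proof -
    from ae obtain N where "{x \<in> space lborel. \<not> (x \<in> region c \<longrightarrow> R x)} \<subseteq> N" "emeasure lborel N = 0" "N \<in> sets lborel"
      by (rule AE_E)
    then show thesis by (intro that[of N]) (simp_all add: null_sets_def)
  qed
  show ?thesis
    by (rule AE_I'[OF chart_null_set[OF c Z(2)]]) (use Z(1) in auto)
qed

lemma AE_vol:
  assumes "\<And>c. c \<in> \<A> \<Longrightarrow> AE p in vol. p \<in> fst c \<longrightarrow> Q p"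
  shows "AE p in vol. Q p"
proof -
  have "AE p in vol. \<forall>k. p \<in> fst (cover k) \<longrightarrow> Q p"
    unfolding AE_all_countable using assms cover(1) by blast
  then show ?thesis by eventually_elim (use cover(2) in blast)
qed

text \<open>Division by the density compensates the density in the volume measure. With a coordinate
  divergence for \<open>H\<close>, the quotient \<open>h\<close> is the Riemannian divergence, so a
  vanishing coordinate integral becomes a vanishing integral over the hypersurface.\<close>

lemma integral_vol_chart:
  assumes c: "c \<in> \<A>" and H: "integrable lborel H" and supp: "\<And>x. x \<notin> region c \<Longrightarrow> H x = 0"
  defines "h \<equiv> (\<lambda>p. if p \<in> fst c then H (snd c p) / density_at c (snd c p) else (0::real))"
  shows "integrable vol h" "(\<integral>p. h p \<partial>vol) = (\<integral>x. H x \<partial>lborel)"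
proof -
  let ?w = "\<lambda>x. indicator (region c) x * density_at c x"
  have o[measurable]: "fst c \<in> sets borel" "region c \<in> sets borel" using chart_open[OF c] region_open[OF c] by simp_all
  have [measurable]: "local_inv c \<in> borel_measurable borel" by (rule measurable_local_inv[OF c])
  have m[measurable]: "?w \<in> borel_measurable borel"
    by (rule density_measurable[OF c]) auto
  have w0: "0 \<le> ?w x" for x using density_pos[OF c, of x] by (auto simp: indicator_def)
  have Hm[measurable]: "H \<in> borel_measurable borel" using H by auto
  have hm[measurable]: "h \<in> borel_measurable borel"
  proof -
    have "(\<lambda>p. H (snd c p) / density_at c (snd c p)) \<in> borel_measurable (restrict_space borel (fst c))"
    proof -
      have s: "snd c \<in> borel_measurable (restrict_space borel (fst c))"
        using chart_continuous[OF c] by (rule borel_measurable_continuous_on_restrict)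
      have "(\<lambda>p. H (snd c p) / ?w (snd c p)) \<in> borel_measurable (restrict_space borel (fst c))"
        using measurable_compose[OF s Hm] measurable_compose[OF s m] by (rule borel_measurable_divide)
      then show ?thesis
        by (rule measurable_cong[THEN iffD1, rotated]) (auto simp: space_restrict_space)
    qed
    then show ?thesis unfolding h_def
      by (subst measurable_If_restrict_space_iff) auto
  qed
  have hH: "?w x * h (local_inv c x) = H x" for x
  proof (cases "x \<in> region c")
    case True
    then show ?thesis
      using density_pos[OF c True] chart_inv_in[OF c True] chart_chart_inv[OF c True]
      by (simp add: h_def local_inv_def)
  qed (simp add: supp)
  have ih: "indicator (fst c) p *\<^sub>R h p = h p" for p by (simp add: h_def)
  have iden: "ennreal (indicator (fst c) p) = indicator (fst c) p" for p by (simp add: indicator_def)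
  have meq: "chart_measure c = density vol (\<lambda>p. ennreal (indicator (fst c) p))"
    using chart_measure_eq_density[OF c] by (simp add: iden)
  have i1: "integrable (chart_measure c) h \<longleftrightarrow> integrable vol h"
    unfolding meq by (subst integrable_density) (auto simp: ih[unfolded real_scaleR_def])
  have e1: "(\<integral>p. h p \<partial>chart_measure c) = (\<integral>p. h p \<partial>vol)"
    unfolding meq by (subst integral_density) (auto simp: ih[unfolded real_scaleR_def])
  have i2: "integrable (chart_measure c) h \<longleftrightarrow> integrable lborel H"
    unfolding chart_measure_def
    by (subst integrable_distr_eq, simp, simp, subst integrable_density) (auto simp: w0 hH)
  have e2: "(\<integral>p. h p \<partial>chart_measure c) = (\<integral>x. H x \<partial>lborel)"
    unfolding chart_measure_def
    by (subst integral_distr, simp, simp, subst integral_density) (auto simp: w0 hH)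
  show "integrable vol h" using i1 i2 H by blast
  show "(\<integral>p. h p \<partial>vol) = (\<integral>x. H x \<partial>lborel)" using e1 e2 by simp
qed

end

section \<open>Locally Lipschitz functions and gradients\<close>

lemma matrix_inner_transpose:
  fixes A :: "real^'n::finite^'n"
  shows "(transpose A *v a) \<bullet> b = a \<bullet> (A *v b)"
  by (metis dot_lmul_matrix transpose_matrix_vector)

lemma sum_sum_eq_trace:
  fixes A B :: "real^'n::finite^'n"
  shows "(\<Sum>i\<in>UNIV. \<Sum>j\<in>UNIV. A $ i $ j * B $ i $ j) = trace (A ** transpose B)"
  by (simp add: trace_def matrix_matrix_mult_def transpose_def)

text \<open>A finite subcover of \<open>K\<close> has a Lebesgue number \<open>e\<close>. Points
  closer than \<open>e\<close>, one of them in \<open>K\<close>, lie in a common ball with a local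
  constant; for points farther apart the global bound \<open>B\<close> on \<open>g\<close> suffices.
  The balls may reach outside \<open>K\<close>, so the transition to the zero region is
  included.\<close>

lemma lipschitz_extension_by_zero:
  fixes g :: "'a::euclidean_space \<Rightarrow> real"
  assumes K: "compact K" and zero: "\<And>x. x \<notin> K \<Longrightarrow> g x = 0"
    and loc: "\<And>x. x \<in> K \<Longrightarrow> \<exists>r>0. \<exists>L. \<forall>y\<in>ball x r. \<forall>z\<in>ball x r. \<bar>g y - g z\<bar> \<le> L * norm (y - z)"
  obtains L R where "lipschitz_bounded_support g L R"
proof -
  obtain r L where rL: "\<And>x. x \<in> K \<Longrightarrow> r x > 0"
    "\<And>x y z. x \<in> K \<Longrightarrow> y \<in> ball x (r x) \<Longrightarrow> z \<in> ball x (r x) \<Longrightarrow> \<bar>g y - g z\<bar> \<le> L x * norm (y - z)"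
    using loc by metis
  have "K \<subseteq> (\<Union>x\<in>K. ball x (r x))" using rL(1) by auto
  then obtain C where C: "C \<subseteq> K" "finite C" "K \<subseteq> (\<Union>x\<in>C. ball x (r x))"
    by (rule compactE_image[OF K, rotated]) auto
  obtain e where e: "e > 0" "\<And>x. x \<in> K \<Longrightarrow> \<exists>B\<in>(\<lambda>x. ball x (r x)) ` C. ball x e \<subseteq> B"
    using Heine_Borel_lemma[OF K C(3)] by auto
  define L1 where "L1 = (\<Sum>x\<in>C. \<bar>L x\<bar>)"
  have L1: "L x \<le> L1" if "x \<in> C" for x
    using member_le_sum[of x C "\<lambda>x. \<bar>L x\<bar>"] that C(2) by (auto simp: L1_def)
  define B where "B = (\<Sum>x\<in>C. \<bar>g x\<bar> + L1 * r x)"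
  have L1_0: "L1 \<ge> 0" by (simp add: L1_def sum_nonneg)
  have r0: "r x > 0" if "x \<in> C" for x using rL(1) C(1) that by blast
  have gB: "\<bar>g y\<bar> \<le> B" for y
  proof (cases "y \<in> K")
    case True
    then obtain x where x: "x \<in> C" "y \<in> ball x (r x)" using C(3) by blast
    have "\<bar>g y - g x\<bar> \<le> L x * norm (y - x)" using rL(2)[of x y x] x C(1) r0[of x] by auto
    also have "\<dots> \<le> L1 * r x"
      using x L1[OF x(1)] L1_0 by (intro mult_mono) (auto simp: dist_norm norm_minus_commute)
    finally have "\<bar>g y\<bar> \<le> \<bar>g x\<bar> + L1 * r x" by linarith
    also have "\<dots> \<le> B" unfolding B_def
      using member_le_sum[of x C "\<lambda>x. \<bar>g x\<bar> + L1 * r x"] x C(2) L1_0 r0 by (auto simp: less_imp_le)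
    finally show ?thesis .
  next
    case False
    have "B \<ge> 0" unfolding B_def using L1_0 r0 by (intro sum_nonneg) (auto simp: less_imp_le)
    then show ?thesis using zero[OF False] by simp
  qed
  have B0: "B \<ge> 0" using gB[of undefined] by linarith
  \<comment> \<open>\<open>L1\<close> dominates all local constants; \<open>2 * B / e\<close> serves
    pairs at distance at least \<open>e\<close>.\<close>
  define M where "M = L1 + 2 * B / e"
  have M0: "M \<ge> 0" using L1_0 B0 e by (simp add: M_def)
  have one: "\<bar>g x - g y\<bar> \<le> M * norm (x - y)" if xK: "x \<in> K" for x y
  proof (cases "dist x y < e")
    case True
    obtain z where z: "z \<in> C" "ball x e \<subseteq> ball z (r z)" using e(2)[OF xK] by auto
    then have "x \<in> ball z (r z)" "y \<in> ball z (r z)" using True e(1) by (auto simp: subset_iff)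
    then have "\<bar>g x - g y\<bar> \<le> L z * norm (x - y)" using rL(2)[of z] z C(1) by blast
    also have "\<dots> \<le> M * norm (x - y)"
      using L1[OF z(1)] B0 e(1) by (intro mult_right_mono) (auto simp: M_def add_increasing2)
    finally show ?thesis .
  next
    case False
    have "\<bar>g x - g y\<bar> \<le> 2 * B" using gB[of x] gB[of y] by linarith
    also have "\<dots> = (2 * B / e) * e" using e(1) by simp
    also have "\<dots> \<le> (2 * B / e) * norm (x - y)"
      using False B0 e(1) by (intro mult_left_mono) (auto simp: dist_norm)
    also have "\<dots> \<le> M * norm (x - y)"
      using L1_0 by (intro mult_right_mono) (auto simp: M_def)
    finally show ?thesis .
  qed
  have lip: "\<bar>g x - g y\<bar> \<le> M * norm (x - y)" for x y
  proof (cases "x \<in> K \<or> y \<in> K")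
    case True
    then show ?thesis using one[of x y] one[of y x] by (auto simp: abs_minus_commute norm_minus_commute)
  next
    case False
    then show ?thesis using zero M0 by simp
  qed
  obtain R where "\<And>x. x \<in> K \<Longrightarrow> norm x \<le> R"
    using compact_imp_bounded[OF K] by (auto simp: bounded_iff)
  then have "lipschitz_bounded_support g M R"
    using lip zero by unfold_locales force+
  then show thesis by (rule that)
qed

definition lipschitz_near :: "('a::real_normed_vector \<Rightarrow> real) \<Rightarrow> 'a \<Rightarrow> bool" where
  "lipschitz_near g x \<longleftrightarrow> (\<exists>r>0. \<exists>L\<ge>0. \<forall>y\<in>ball x r. \<forall>z\<in>ball x r. \<bar>g y - g z\<bar> \<le> L * norm (y - z))"

lemma lipschitz_nearI:
  assumes "r > 0" "\<And>y z. y \<in> ball x r \<Longrightarrow> z \<in> ball x r \<Longrightarrow> \<bar>g y - g z\<bar> \<le> L * norm (y - z)"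
  shows "lipschitz_near g x"
  unfolding lipschitz_near_def
proof (intro exI conjI ballI)
  show "r > 0" "0 \<le> \<bar>L\<bar>" by (use assms in auto)
  fix y z assume "y \<in> ball x r" "z \<in> ball x r"
  then show "\<bar>g y - g z\<bar> \<le> \<bar>L\<bar> * norm (y - z)"
    by (intro order_trans[OF assms(2)]) (simp_all add: mult_right_mono)
qed

lemma lipschitz_nearE:
  assumes "lipschitz_near g x"
  obtains r L where "r > 0" "L \<ge> 0"
    "\<And>y z. y \<in> ball x r \<Longrightarrow> z \<in> ball x r \<Longrightarrow> \<bar>g y - g z\<bar> \<le> L * norm (y - z)"
  using assms unfolding lipschitz_near_def by blast

lemma lipschitz_near_cong:
  assumes g: "lipschitz_near g x" and S: "open S" "x \<in> S" "\<And>y. y \<in> S \<Longrightarrow> h y = g y"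
  shows "lipschitz_near h x"
proof -
  obtain r L where r: "r > 0" "\<And>y z. y \<in> ball x r \<Longrightarrow> z \<in> ball x r \<Longrightarrow> \<bar>g y - g z\<bar> \<le> L * norm (y - z)"
    by (rule lipschitz_nearE[OF g]) blast
  obtain e where e: "e > 0" "ball x e \<subseteq> S" using S open_contains_ball by blast
  show ?thesis
  proof (rule lipschitz_nearI[of "min r e"])
    fix y z assume "y \<in> ball x (min r e)" "z \<in> ball x (min r e)"
    then show "\<bar>h y - h z\<bar> \<le> L * norm (y - z)" using r(2)[of y z] e S(3) by (auto simp: subset_iff)
  qed (use r e in auto)
qed

lemma lipschitz_near_bounded:
  assumes "lipschitz_near g x"
  obtains r L B where "r > 0" "L \<ge> 0" "B \<ge> 0" "\<And>y. y \<in> ball x r \<Longrightarrow> \<bar>g y\<bar> \<le> B"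
    "\<And>y z. y \<in> ball x r \<Longrightarrow> z \<in> ball x r \<Longrightarrow> \<bar>g y - g z\<bar> \<le> L * norm (y - z)"
proof -
  obtain r L where r: "r > 0" "L \<ge> 0" "\<And>y z. y \<in> ball x r \<Longrightarrow> z \<in> ball x r \<Longrightarrow> \<bar>g y - g z\<bar> \<le> L * norm (y - z)"
    by (rule lipschitz_nearE[OF assms]) blast
  have "\<bar>g y\<bar> \<le> \<bar>g x\<bar> + L * r" if "y \<in> ball x r" for y
  proof -
    have "\<bar>g y - g x\<bar> \<le> L * norm (y - x)" using r that by auto
    also have "\<dots> \<le> L * r" using r(2) that by (intro mult_left_mono) (auto simp: dist_norm norm_minus_commute)
    finally show ?thesis by linarith
  qed
  then show thesis using r by (intro that[of r L "\<bar>g x\<bar> + L * r"]) auto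
qed

lemma lipschitz_near_mult:
  assumes "lipschitz_near g x" "lipschitz_near h x"
  shows "lipschitz_near (\<lambda>y. g y * h y) x"
proof -
  obtain r L B where g: "r > 0" "L \<ge> 0" "B \<ge> 0" "\<And>y. y \<in> ball x r \<Longrightarrow> \<bar>g y\<bar> \<le> B"
    "\<And>y z. y \<in> ball x r \<Longrightarrow> z \<in> ball x r \<Longrightarrow> \<bar>g y - g z\<bar> \<le> L * norm (y - z)"
    using lipschitz_near_bounded[OF assms(1)] by metis
  obtain r' L' B' where h: "r' > 0" "L' \<ge> 0" "B' \<ge> 0" "\<And>y. y \<in> ball x r' \<Longrightarrow> \<bar>h y\<bar> \<le> B'"
    "\<And>y z. y \<in> ball x r' \<Longrightarrow> z \<in> ball x r' \<Longrightarrow> \<bar>h y - h z\<bar> \<le> L' * norm (y - z)"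
    using lipschitz_near_bounded[OF assms(2)] by metis
  show ?thesis
  proof (rule lipschitz_nearI[of "min r r'"])
    fix y z assume yz: "y \<in> ball x (min r r')" "z \<in> ball x (min r r')"
    have "g y * h y - g z * h z = g y * (h y - h z) + (g y - g z) * h z" by (simp add: algebra_simps)
    then have "\<bar>g y * h y - g z * h z\<bar> \<le> \<bar>g y\<bar> * \<bar>h y - h z\<bar> + \<bar>g y - g z\<bar> * \<bar>h z\<bar>"
      by (metis abs_mult abs_triangle_ineq)
    also have "\<dots> \<le> B * (L' * norm (y - z)) + (L * norm (y - z)) * B'"
      using yz g h by (intro add_mono mult_mono) auto
    finally show "\<bar>g y * h y - g z * h z\<bar> \<le> (B * L' + L * B') * norm (y - z)" by (simp add: algebra_simps)
  qed (use g h in auto)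
qed

lemma lipschitz_near_diff:
  assumes "lipschitz_near g x" "lipschitz_near h x"
  shows "lipschitz_near (\<lambda>y. g y - h y) x"
proof -
  obtain r L where g: "r > 0" "\<And>y z. y \<in> ball x r \<Longrightarrow> z \<in> ball x r \<Longrightarrow> \<bar>g y - g z\<bar> \<le> L * norm (y - z)"
    by (rule lipschitz_nearE[OF assms(1)]) blast
  obtain r' L' where h: "r' > 0" "\<And>y z. y \<in> ball x r' \<Longrightarrow> z \<in> ball x r' \<Longrightarrow> \<bar>h y - h z\<bar> \<le> L' * norm (y - z)"
    by (rule lipschitz_nearE[OF assms(2)]) blast
  show ?thesis
  proof (rule lipschitz_nearI[of "min r r'"])
    fix y z assume yz: "y \<in> ball x (min r r')" "z \<in> ball x (min r r')"
    have "\<bar>g y - g z\<bar> \<le> L * norm (y - z)" "\<bar>h y - h z\<bar> \<le> L' * norm (y - z)" using yz g(2) h(2) by auto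
    then show "\<bar>(g y - h y) - (g z - h z)\<bar> \<le> (L + L') * norm (y - z)" by (simp add: distrib_right)
  qed (use g h in auto)
qed

lemma lipschitz_near_const: "lipschitz_near (\<lambda>_. c) x"
  by (rule lipschitz_nearI[of 1 _ _ 0]) auto

lemma lipschitz_near_C1:
  fixes g :: "'a::euclidean_space \<Rightarrow> real"
  assumes "C1_on g S" "open S" "x \<in> S"
  shows "lipschitz_near g x"
proof -
  obtain e where e: "e > 0" "cball x e \<subseteq> S" using assms open_contains_cball by blast
  obtain L where "\<And>y z. y \<in> cball x e \<Longrightarrow> z \<in> cball x e \<Longrightarrow> norm (g y - g z) \<le> L * norm (y - z)"
    using C1_on_lipschitz_compact[OF assms(1) compact_cball convex_cball e(2)] by metis
  then show ?thesis using e(1) by (intro lipschitz_nearI[of e x g L]) auto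
qed

lemma lipschitz_near_compose_C1:
  fixes T :: "'a::euclidean_space \<Rightarrow> 'b::euclidean_space"
  assumes g: "lipschitz_near g (T x)" and T: "C1_on T S" "open S" "x \<in> S"
  shows "lipschitz_near (g \<circ> T) x"
proof -
  obtain r L where r: "r > 0" "L \<ge> 0" "\<And>y z. y \<in> ball (T x) r \<Longrightarrow> z \<in> ball (T x) r \<Longrightarrow> \<bar>g y - g z\<bar> \<le> L * norm (y - z)"
    by (rule lipschitz_nearE[OF g]) blast
  obtain e where e: "e > 0" "cball x e \<subseteq> S" using T open_contains_cball by blast
  obtain M where M: "M \<ge> 0" "\<And>y z. y \<in> cball x e \<Longrightarrow> z \<in> cball x e \<Longrightarrow> norm (T y - T z) \<le> M * norm (y - z)"
    using C1_on_lipschitz_compact[OF T(1) compact_cball convex_cball e(2)] by metis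
  define d where "d = min e (r / (M + 1))"
  have d: "d > 0" "d \<le> e" "d \<le> r / (M + 1)" using e r M by (auto simp: d_def)
  have in_ball: "T y \<in> ball (T x) r" if "y \<in> ball x d" for y
  proof -
    have "norm (T x - T y) \<le> M * norm (x - y)" using that d e by (intro M(2)) auto
    also have "\<dots> \<le> M * d" using that M(1) by (intro mult_left_mono) (auto simp: dist_norm)
    also have "\<dots> < (M + 1) * d" using d(1) by simp
    also have "\<dots> \<le> r" using d(3) M(1) by (simp add: field_simps)
    finally show ?thesis by (simp add: dist_norm)
  qed
  show ?thesis
  proof (rule lipschitz_nearI[OF d(1)])
    fix y z assume yz: "y \<in> ball x d" "z \<in> ball x d"
    have "\<bar>g (T y) - g (T z)\<bar> \<le> L * norm (T y - T z)" using in_ball yz r(3) by blast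
    also have "\<dots> \<le> L * (M * norm (y - z))" using yz d r(2) by (intro mult_left_mono M(2)) auto
    finally show "\<bar>(g \<circ> T) y - (g \<circ> T) z\<bar> \<le> (L * M) * norm (y - z)" by (simp add: mult.assoc)
  qed
qed

definition cutoff :: "'a::metric_space \<Rightarrow> real \<Rightarrow> 'a \<Rightarrow> real" where
  "cutoff a r x = max 0 (min 1 (2 - dist x a / r))"

lemma cutoff_eq_1: "r > 0 \<Longrightarrow> x \<in> ball a r \<Longrightarrow> cutoff a r x = 1"
  by (auto simp: cutoff_def dist_commute field_simps min_def)

lemma cutoff_eq_0: "r > 0 \<Longrightarrow> x \<notin> cball a (2 * r) \<Longrightarrow> cutoff a r x = 0"
  by (auto simp: cutoff_def dist_commute field_simps)

lemma lipschitz_near_cutoff: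
  fixes a :: "'a::real_normed_vector"
  assumes "r > 0" shows "lipschitz_near (cutoff a r) x"
proof (rule lipschitz_nearI[of 1 x _ "1 / r"])
  fix y z :: 'a
  have "\<bar>dist y a / r - dist z a / r\<bar> = \<bar>dist y a - dist z a\<bar> / r"
    using assms by (simp add: diff_divide_distrib[symmetric] abs_divide)
  also have "\<dots> \<le> dist y z / r"
    using assms dist_triangle[of y a z] dist_triangle[of z a y] by (intro divide_right_mono) (auto simp: dist_commute abs_le_iff)
  finally have "\<bar>dist y a / r - dist z a / r\<bar> \<le> 1 / r * norm (y - z)" by (simp add: dist_norm)
  then show "\<bar>cutoff a r y - cutoff a r z\<bar> \<le> 1 / r * norm (y - z)"
    unfolding cutoff_def by linarith
qed simp

text \<open>Localises Rademacher's theorem: multiplication by a cutoff yields a globally Lipschitz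
  function with bounded support that agrees with \<open>g\<close> on a small ball, and countably
  many such balls cover \<open>S\<close>.\<close>

lemma AE_differentiable_of_lipschitz_near:
  fixes g :: "'a::euclidean_space \<Rightarrow> real"
  assumes "open S" and lip: "\<And>x. x \<in> S \<Longrightarrow> lipschitz_near g x"
  shows "AE x in lborel. x \<in> S \<longrightarrow> g differentiable at x"
proof -
  have loc: "\<exists>r>0. AE y in lborel. y \<in> ball x r \<longrightarrow> g differentiable at y" if "x \<in> S" for x
  proof -
    obtain R where R: "R > 0" "cball x R \<subseteq> S"
      using \<open>open S\<close> \<open>x \<in> S\<close> open_contains_cball by blast
    define r where "r = R / 2"
    have r: "r > 0" "cball x (2 * r) \<subseteq> S" using R by (auto simp: r_def)
    define h where "h y = g y * cutoff x r y" for y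
    have h_loc: "\<exists>\<rho>>0. \<exists>L. \<forall>y\<in>ball z \<rho>. \<forall>w\<in>ball z \<rho>. \<bar>h y - h w\<bar> \<le> L * norm (y - w)" if "z \<in> cball x (2 * r)" for z
    proof -
      have "lipschitz_near h z"
        unfolding h_def[abs_def] by (intro lipschitz_near_mult lip lipschitz_near_cutoff r) (use that r in auto)
      then show ?thesis unfolding lipschitz_near_def by blast
    qed
    have h_zero: "h y = 0" if "y \<notin> cball x (2 * r)" for y
      using cutoff_eq_0[OF r(1) that] by (simp add: h_def)
    obtain L B where "lipschitz_bounded_support h L B"
      by (rule lipschitz_extension_by_zero[OF compact_cball h_zero h_loc]) blast
    then have "AE y in lborel. h differentiable at y" by (rule lipschitz_bounded_support.AE_differentiable)
    then have "AE y in lborel. y \<in> ball x r \<longrightarrow> g differentiable at y"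
    proof eventually_elim
      case (elim y)
      show ?case
      proof
        assume y: "y \<in> ball x r"
        obtain h' where "(h has_derivative h') (at y)" using elim by (auto simp: differentiable_def)
        then have "(g has_derivative h') (at y)"
          by (rule has_derivative_transform_within_open[OF _ open_ball y]) (simp add: h_def cutoff_eq_1[OF r(1)])
        then show "g differentiable at y" by (rule differentiableI)
      qed
    qed
    then show ?thesis using r(1) by blast
  qed
  then obtain r where r: "\<And>x. x \<in> S \<Longrightarrow> r x > 0" "\<And>x. x \<in> S \<Longrightarrow> AE y in lborel. y \<in> ball x (r x) \<longrightarrow> g differentiable at y"
    by metis
  obtain \<F> where \<F>: "\<F> \<subseteq> (\<lambda>x. ball x (r x)) ` S" "countable \<F>" "\<Union>\<F> = (\<Union>x\<in>S. ball x (r x))"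
    using Lindelof[of "(\<lambda>x. ball x (r x)) ` S"] by auto
  have "AE y in lborel. \<forall>B\<in>\<F>. y \<in> B \<longrightarrow> g differentiable at y"
    using \<F>(1,2) r(2) by (subst AE_ball_countable) auto
  then show ?thesis
  proof eventually_elim
    case (elim y)
    show ?case
    proof
      assume "y \<in> S"
      then have "y \<in> \<Union>\<F>" unfolding \<F>(3) using r(1)[of y] by (intro UN_I) auto
      then show "g differentiable at y" using elim by blast
    qed
  qed
qed

section \<open>Gradients and bump functions on the hypersurface\<close>

context hypersurface
begin

lemma chart_at: "chart_at \<A> p \<in> \<A>" "p \<in> fst (chart_at \<A> p)"
proof -
  have "p \<in> (\<Union>c\<in>\<A>. fst c)" using atlas by (simp add: smooth_atlas_def)
  then have "\<exists>c. c \<in> \<A> \<and> p \<in> fst c" by blast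
  from someI_ex[OF this] show "chart_at \<A> p \<in> \<A>" "p \<in> fst (chart_at \<A> p)" by (simp_all add: chart_at_def)
qed

lemma jacobian_inverse:
  assumes c: "c \<in> \<A>" and d: "d \<in> \<A>" and x: "x \<in> overlap c d"
  defines "J \<equiv> matrix (frechet_derivative (transition c d) (at x))"
  shows "J ** matrix_inv J = mat 1" "matrix_inv J ** J = mat 1"
    "matrix_inv (metric_matrix (param c) x) =
      matrix_inv J ** matrix_inv (metric_matrix (param d) (transition c d x)) ** transpose (matrix_inv J)"
proof -
  let ?Gc = "metric_matrix (param c) x" and ?Gd = "metric_matrix (param d) (transition c d x)"
  have Gc: "?Gc = transpose J ** ?Gd ** J" unfolding J_def by (rule metric_transition[OF c d x])
  have dc: "det ?Gc \<noteq> 0" and dd: "det ?Gd \<noteq> 0"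
    using hyperbolic_parametrization.det_G_pos[OF parametrization[OF c] transition_in(1)[OF c d x]]
      hyperbolic_parametrization.det_G_pos[OF parametrization[OF d] transition_in(3)[OF c d x]] by auto
  \<comment> \<open>Invertibility of the Jacobian is read off from the nonzero determinant of the
    metric in the chart \<open>c\<close>.\<close>
  then have dJ: "det J \<noteq> 0" by (auto simp: Gc det_mul)
  show J: "J ** matrix_inv J = mat 1" "matrix_inv J ** J = mat 1" by (rule matrix_inv_inverse[OF dJ])+
  let ?B = "matrix_inv J ** matrix_inv ?Gd ** transpose (matrix_inv J)"
  have JT: "transpose (matrix_inv J) ** transpose J = mat 1"
    by (simp add: matrix_transpose_mul[symmetric] J transpose_mat)
  have "?B ** ?Gc = matrix_inv J ** matrix_inv ?Gd ** (transpose (matrix_inv J) ** transpose J) ** ?Gd ** J"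
    unfolding Gc by (simp add: matrix_mul_assoc)
  also have "\<dots> = matrix_inv J ** (matrix_inv ?Gd ** ?Gd) ** J"
    by (simp add: JT matrix_mul_assoc)
  also have "\<dots> = mat 1" by (simp only: matrix_inv_inverse[OF dd] J matrix_mul_rid)
  finally have "?B ** ?Gc = mat 1" .
  then have "?B ** ?Gc ** matrix_inv ?Gc = matrix_inv ?Gc" by simp
  then show "matrix_inv ?Gc = ?B"
    by (simp add: matrix_mul_assoc[symmetric] matrix_inv_inverse[OF dc])
qed

definition coord_grad :: "('p, 'n) chart \<Rightarrow> ('p \<Rightarrow> real) \<Rightarrow> real^'n \<Rightarrow> real^'n" where
  "coord_grad c f x = (\<chi> i. pderiv_at i (f \<circ> chart_inv c) x)"

abbreviation metric_inv :: "('p, 'n) chart \<Rightarrow> real^'n \<Rightarrow> real^'n^'n" where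
  "metric_inv c x \<equiv> matrix_inv (metric_matrix (param c) x)"

definition grad_inner :: "('p \<Rightarrow> real) \<Rightarrow> ('p \<Rightarrow> real) \<Rightarrow> 'p \<Rightarrow> real" where
  "grad_inner f g p = (let c = chart_at \<A> p; x = snd c p in coord_grad c f x \<bullet> (metric_inv c x *v coord_grad c g x))"

definition diff_at :: "('p \<Rightarrow> real) \<Rightarrow> 'p \<Rightarrow> bool" where
  "diff_at f p \<longleftrightarrow> (let c = chart_at \<A> p in f \<circ> chart_inv c differentiable at (snd c p))"

lemma diff_at_chart:
  assumes c: "c \<in> \<A>" "p \<in> fst c"
  shows "diff_at f p \<longleftrightarrow> f \<circ> chart_inv c differentiable at (snd c p)"
proof -
  let ?d = "chart_at \<A> p"
  have x: "snd c p \<in> overlap c ?d" "transition c ?d (snd c p) = snd ?d p"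
    using c chart_at by (auto simp: chart_inv_chart)
  have y: "snd ?d p \<in> overlap ?d c" "transition ?d c (snd ?d p) = snd c p"
    using c chart_at by (auto simp: chart_inv_chart)
  show ?thesis
    using differentiable_transition(1)[OF c(1) chart_at(1) x(1), of f, unfolded x(2)]
      differentiable_transition(1)[OF chart_at(1) c(1) y(1), of f, unfolded y(2)]
    unfolding diff_at_def Let_def by blast
qed

lemma coord_grad_transition:
  assumes c: "c \<in> \<A>" and d: "d \<in> \<A>" and x: "x \<in> overlap c d"
    and f: "f \<circ> chart_inv d differentiable at (transition c d x)"
  shows "coord_grad c f x = transpose (matrix (frechet_derivative (transition c d) (at x))) *v coord_grad d f (transition c d x)"
  by (simp add: coord_grad_def vec_eq_iff pderiv_transition[OF c d x f] matrix_vector_mult_def transpose_def matrix_def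
      pderiv_at_def[of _ "transition c d"])

text \<open>Coordinate gradients transform with the transposed Jacobian and the inverse metric with
  the inverse Jacobians, so everything cancels. This frees \<open>grad_inner\<close> from the chart
  chosen by \<open>chart_at\<close>.\<close>

lemma grad_inner_chart:
  assumes c: "c \<in> \<A>" "p \<in> fst c" and f: "diff_at f p" and g: "diff_at g p"
  shows "grad_inner f g p = coord_grad c f (snd c p) \<bullet> (metric_inv c (snd c p) *v coord_grad c g (snd c p))"
proof -
  let ?d = "chart_at \<A> p"
  let ?x = "snd c p"
  have x: "?x \<in> overlap c ?d" "transition c ?d ?x = snd ?d p"
    using c chart_at by (auto simp: chart_inv_chart)
  let ?J = "matrix (frechet_derivative (transition c ?d) (at ?x))"
  have fd: "f \<circ> chart_inv ?d differentiable at (transition c ?d ?x)" "g \<circ> chart_inv ?d differentiable at (transition c ?d ?x)"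
    using f g unfolding x(2) by (simp_all add: diff_at_def Let_def)
  let ?a = "coord_grad ?d f (transition c ?d ?x)" and ?b = "coord_grad ?d g (transition c ?d ?x)"
  have JT: "transpose (matrix_inv ?J) *v (transpose ?J *v v) = v" for v
    by (simp only: matrix_vector_mul_assoc matrix_transpose_mul[symmetric] jacobian_inverse(1)[OF c(1) chart_at(1) x(1)]
        transpose_mat matrix_vector_mul_lid)
  have "coord_grad c f ?x \<bullet> (metric_inv c ?x *v coord_grad c g ?x) =
      (transpose ?J *v ?a) \<bullet> (matrix_inv ?J *v (metric_inv ?d (transition c ?d ?x) *v (transpose (matrix_inv ?J) *v (transpose ?J *v ?b))))"
    unfolding coord_grad_transition[OF c(1) chart_at(1) x(1) fd(1)] coord_grad_transition[OF c(1) chart_at(1) x(1) fd(2)]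
      jacobian_inverse(3)[OF c(1) chart_at(1) x(1)]
    by (simp add: matrix_vector_mul_assoc[symmetric])
  also have "\<dots> = ?a \<bullet> (?J *v (matrix_inv ?J *v (metric_inv ?d (transition c ?d ?x) *v ?b)))"
    by (simp only: JT matrix_inner_transpose)
  also have "\<dots> = ?a \<bullet> (metric_inv ?d (transition c ?d ?x) *v ?b)"
    by (simp add: matrix_vector_mul_assoc matrix_mul_assoc jacobian_inverse[OF c(1) chart_at(1) x(1)])
  finally show ?thesis by (simp only: grad_inner_def Let_def x(2))
qed

abbreviation height :: "'p \<Rightarrow> real" where "height p \<equiv> snd (F p)"

lemma diff_at_height: "diff_at height p"
proof -
  let ?c = "chart_at \<A> p"
  have "C1_on (\<lambda>x. snd (param ?c x)) (region ?c)"
    by (rule hyperbolic_parametrization.C1_u[OF parametrization[OF chart_at(1)]])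
  from C1_on_differentiable[OF this, of "snd ?c p"] show ?thesis
    using chart_at(2)[of p] by (simp add: diff_at_def Let_def o_def)
qed

lemma coord_grad_height:
  assumes "c \<in> \<A>" "x \<in> region c"
  shows "coord_grad c height x = (\<chi> i. snd (pderiv_at i (param c) x))"
proof -
  have "pderiv_at i (\<lambda>y. snd (param c y)) x = snd (pderiv_at i (param c) x)" for i
    by (rule pderiv_at_linear[OF bounded_linear_snd hyperbolic_parametrization.diff_X[OF parametrization[OF assms(1)] assms(2)]])
  then show ?thesis by (simp add: coord_grad_def o_def)
qed

text \<open>The divergence of \<open>f\<close> times the gradient of \<open>ln height\<close>, provided that the hypersurface is minimal.\<close>

definition twisted_divergence :: "('p \<Rightarrow> real) \<Rightarrow> 'p \<Rightarrow> real" where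
  "twisted_divergence f p = grad_inner f height p / height p +
    f p * (real CARD('n) - grad_inner height height p / (height p)\<^sup>2)"

definition chart_field :: "('p, 'n) chart \<Rightarrow> 'n \<Rightarrow> real^'n \<Rightarrow> real" where
  "chart_field c = hyperbolic_parametrization.log_height_field (param c)"

text \<open>A condition in coordinates rather than through \<open>riemannian_dist\<close>: it is
  local and stable under products, as needed for the square of the test function and for
  multiplication by bump functions.\<close>

definition locally_lipschitz :: "('p \<Rightarrow> real) \<Rightarrow> bool" where
  "locally_lipschitz f \<longleftrightarrow> (\<forall>c\<in>\<A>. \<forall>x\<in>region c. lipschitz_near (f \<circ> chart_inv c) x)"

lemma locally_lipschitz_mult: "locally_lipschitz f \<Longrightarrow> locally_lipschitz g \<Longrightarrow> locally_lipschitz (\<lambda>p. f p * g p)"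
  unfolding locally_lipschitz_def by (auto simp: o_def intro!: lipschitz_near_mult)

lemma locally_lipschitz_diff: "locally_lipschitz f \<Longrightarrow> locally_lipschitz g \<Longrightarrow> locally_lipschitz (\<lambda>p. f p - g p)"
  unfolding locally_lipschitz_def by (auto simp: o_def intro!: lipschitz_near_diff)

lemma locally_lipschitz_const: "locally_lipschitz (\<lambda>_. a)"
  unfolding locally_lipschitz_def by (auto simp: o_def intro!: lipschitz_near_const)

lemma AE_diff_at:
  assumes "locally_lipschitz f" shows "AE p in vol. diff_at f p"
proof (rule AE_vol)
  fix c assume c: "c \<in> \<A>"
  have "AE x in lborel. x \<in> region c \<longrightarrow> f \<circ> chart_inv c differentiable at x"
    by (rule AE_differentiable_of_lipschitz_near[OF region_open[OF c]])
      (use assms c in \<open>auto simp: locally_lipschitz_def\<close>)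
  from AE_vol_chart[OF c this] show "AE p in vol. p \<in> fst c \<longrightarrow> diff_at f p"
    by eventually_elim (use diff_at_chart[OF c] in blast)
qed

text \<open>A coordinate cutoff extended by 0. The extension is Lipschitz near every point because
  the compact set \<open>K\<close> is closed in the Hausdorff space and lies inside the chart
  domain.\<close>

lemma bump_function:
  obtains V K c \<psi> where "open V" "p \<in> V" "c \<in> \<A>" "compact K" "K \<subseteq> fst c"
    "locally_lipschitz \<psi>" "\<And>q. q \<in> V \<Longrightarrow> \<psi> q = 1" "\<And>q. q \<notin> K \<Longrightarrow> \<psi> q = 0"
proof -
  define c where "c = chart_at \<A> p"
  have c: "c \<in> \<A>" "p \<in> fst c" using chart_at by (simp_all add: c_def)
  define a where "a = snd c p"
  have a: "a \<in> region c" using c by (simp add: a_def)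
  then obtain R where R: "R > 0" "cball a R \<subseteq> region c" using region_open[OF c(1)] open_contains_cball by blast
  define r where "r = R / 2"
  have r: "r > 0" "cball a (2 * r) \<subseteq> region c" using R by (auto simp: r_def)
  define V where "V = fst c \<inter> snd c -` ball a r"
  define K where "K = chart_inv c ` cball a (2 * r)"
  define \<psi> where "\<psi> q = (if q \<in> fst c then cutoff a r (snd c q) else 0)" for q
  have "compact K" unfolding K_def
    by (rule compact_continuous_image[OF continuous_on_subset[OF chart_inv_continuous[OF c(1)] r(2)]]) simp
  have K_sub: "K \<subseteq> fst c" using r(2) chart_inv_in[OF c(1)] by (auto simp: K_def)
  have \<psi>0: "\<psi> q = 0" if "q \<notin> K" for q
  proof (cases "q \<in> fst c")
    case True
    then have "snd c q \<notin> cball a (2 * r)" using that chart_inv_chart[OF c(1) True] unfolding K_def by (metis image_eqI)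
    then show ?thesis using cutoff_eq_0[OF r(1), of "snd c q" a] by (simp add: \<psi>_def)
  qed (simp add: \<psi>_def)
  have "locally_lipschitz \<psi>"
    unfolding locally_lipschitz_def
  proof (intro ballI)
    fix d x assume d: "d \<in> \<A>" and x: "x \<in> region d"
    show "lipschitz_near (\<psi> \<circ> chart_inv d) x"
    proof (cases "chart_inv d x \<in> fst c")
      case True
      then have xo: "x \<in> overlap d c" using x chart_inv_in[OF d x] chart_chart_inv[OF d x] by (metis IntI image_eqI)
      have "lipschitz_near (cutoff a r \<circ> transition d c) x"
        by (rule lipschitz_near_compose_C1[OF lipschitz_near_cutoff[OF r(1)] Ck_on_2D(1)[OF transition_smooth[OF d c(1)]]
            overlap_open[OF d c(1)] xo])
      then show ?thesis
        by (rule lipschitz_near_cong[OF _ overlap_open[OF d c(1)] xo]) (auto simp: \<psi>_def chart_inv_chart[OF d])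
    next
      \<comment> \<open>A point outside the chart domain is outside the closed set \<open>K\<close>,
        so \<open>\<psi>\<close> vanishes on a whole neighbourhood.\<close>
      case False
      then have xK: "x \<in> region d \<inter> chart_inv d -` (- K)" using x K_sub by auto
      have "open (region d \<inter> chart_inv d -` (- K))"
        by (rule continuous_open_preimage[OF chart_inv_continuous[OF d] region_open[OF d]])
          (use compact_imp_closed[OF \<open>compact K\<close>] in auto)
      then show ?thesis
        by (rule lipschitz_near_cong[OF lipschitz_near_const[of 0] _ xK]) (simp add: \<psi>0)
    qed
  qed
  moreover have "open V" unfolding V_def
    by (rule continuous_open_preimage[OF chart_continuous[OF c(1)] chart_open[OF c(1)] open_ball])
  moreover have "p \<in> V" using c r by (simp add: V_def a_def)
  moreover have "\<psi> q = 1" if "q \<in> V" for q using that cutoff_eq_1[OF r(1), of "snd c q" a] by (simp add: V_def \<psi>_def)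
  ultimately show thesis using that \<open>compact K\<close> K_sub \<psi>0 c(1) by blast
qed

end

section \<open>Divergences and stability\<close>

context hypersurface
begin

section \<open>Minimality in an arbitrary chart\<close>

lemma pderiv_compose_transition:
  fixes \<Phi> :: "real^'n \<Rightarrow> 'b::real_normed_vector"
  assumes c: "c \<in> \<A>" and d: "d \<in> \<A>" and x: "x \<in> overlap c d"
    and \<Phi>: "\<Phi> differentiable at (transition c d x)"
  shows "pderiv_at i (\<lambda>y. \<Phi> (transition c d y)) x =
    (\<Sum>b\<in>UNIV. pderiv_at i (transition c d) x $ b *\<^sub>R pderiv_at b \<Phi> (transition c d x))"
proof -
  have dT: "transition c d differentiable at x"
    by (rule C1_on_differentiable[OF Ck_on_2D(1)[OF transition_smooth[OF c d]] x])
  have "frechet_derivative (\<Phi> \<circ> transition c d) (at x) =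
      frechet_derivative \<Phi> (at (transition c d x)) \<circ> frechet_derivative (transition c d) (at x)"
    by (rule frechet_derivative_compose[OF dT \<Phi>])
  moreover have "(\<lambda>y. \<Phi> (transition c d y)) = \<Phi> \<circ> transition c d" by (simp add: fun_eq_iff)
  ultimately show ?thesis
    unfolding pderiv_at_def[of i] using frechet_derivative_sum_pderiv[OF \<Phi>] by simp
qed

text \<open>The second derivatives of the transition map only multiply tangent vectors, and these
  are orthogonal to \<open>\<nu>\<close>. What remains transforms as a tensor.\<close>

lemma second_derivative_transition:
  assumes c: "c \<in> \<A>" and d: "d \<in> \<A>" and x: "x \<in> overlap c d"
    and \<nu>: "\<And>a. lorentz (pderiv_at a (param d) (transition c d x)) \<nu> = 0"
  defines "J \<equiv> matrix (frechet_derivative (transition c d) (at x))"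
  shows "(\<chi> i j. lorentz (pderiv_at i (pderiv_at j (param c)) x) \<nu>) =
    transpose J ** (\<chi> i j. lorentz (pderiv_at i (pderiv_at j (param d)) (transition c d x)) \<nu>) ** J"
proof -
  interpret pc: hyperbolic_parametrization "param c" "region c" by (rule parametrization[OF c])
  interpret pd: hyperbolic_parametrization "param d" "region d" by (rule parametrization[OF d])
  let ?T = "transition c d"
  have Tx: "?T x \<in> region d" by (rule transition_in(3)[OF c d x])
  have J: "J $ a $ i = pderiv_at i ?T x $ a" for a i
    by (simp add: J_def matrix_def pderiv_at_def)
  have C2T: "Ck_on 2 ?T (overlap c d)" by (rule transition_smooth[OF c d])
  have dT: "pderiv_at j ?T differentiable at x" for j
    using C1_on_differentiable[OF Ck_on_2D(2)[OF C2T] x] by (simp add: pderiv_at_def[abs_def])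
  have dTa: "(\<lambda>z. pderiv_at j ?T z $ a) differentiable at x" for j a
    by (rule differentiable_bounded_linear[OF bounded_linear_vec_nth dT])
  have dPT: "(\<lambda>z. pd.P a (?T z)) differentiable at x" for a
    using differentiable_chain_at[OF C1_on_differentiable[OF Ck_on_2D(1)[OF C2T] x] pd.diff_P[OF Tx, of a]]
    by (simp add: o_def)
  have dterm: "(\<lambda>z. pderiv_at j ?T z $ a *\<^sub>R pd.P a (?T z)) differentiable at x" for j a
    by (rule differentiable_bounded_bilinear[OF bounded_bilinear_scaleR dTa dPT])
  have "lorentz (pderiv_at i (pc.P j) x) \<nu> =
      (\<Sum>a\<in>UNIV. \<Sum>b\<in>UNIV. J $ a $ j * (J $ b $ i * lorentz (pderiv_at b (pd.P a) (?T x)) \<nu>))" for i j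
  proof -
    have "pderiv_at i (pc.P j) x = pderiv_at i (\<lambda>z. \<Sum>a\<in>UNIV. pderiv_at j ?T z $ a *\<^sub>R pd.P a (?T z)) x"
      by (rule pderiv_at_cong[OF overlap_open[OF c d] x pderiv_param_transition[OF c d] pc.diff_P[OF transition_in(1)[OF c d x]]])
    also have "\<dots> = (\<Sum>a\<in>UNIV. pderiv_at i (\<lambda>z. pderiv_at j ?T z $ a *\<^sub>R pd.P a (?T z)) x)"
      by (rule pderiv_at_sum[OF dterm])
    also have "\<dots> = (\<Sum>a\<in>UNIV. pderiv_at j ?T x $ a *\<^sub>R pderiv_at i (\<lambda>z. pd.P a (?T z)) x +
        pderiv_at i (\<lambda>z. pderiv_at j ?T z $ a) x *\<^sub>R pd.P a (?T x))"
      by (intro sum.cong refl pderiv_at_scaleR dTa dPT)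
    also have "\<dots> = (\<Sum>a\<in>UNIV. pderiv_at j ?T x $ a *\<^sub>R (\<Sum>b\<in>UNIV. pderiv_at i ?T x $ b *\<^sub>R pderiv_at b (pd.P a) (?T x)) +
        pderiv_at i (\<lambda>z. pderiv_at j ?T z $ a) x *\<^sub>R pd.P a (?T x))"
      by (simp only: pderiv_compose_transition[OF c d x pd.diff_P[OF Tx]])
    finally show ?thesis
      by (simp only: lorentz.sum_left lorentz.add_left lorentz.scaleR_left \<nu> J[symmetric] real_scaleR_def
          mult_zero_right add_0_right sum_distrib_left)
  qed
  also have "(\<Sum>a\<in>UNIV. \<Sum>b\<in>UNIV. J $ a $ j * (J $ b $ i * lorentz (pderiv_at b (pd.P a) (?T x)) \<nu>)) =
      (\<Sum>a\<in>UNIV. (\<Sum>b\<in>UNIV. J $ b $ i * lorentz (pderiv_at b (pd.P a) (?T x)) \<nu>) * J $ a $ j)" for i j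
    by (simp add: sum_distrib_left mult.commute)
  finally show ?thesis
    by (simp add: vec_eq_iff matrix_matrix_mult_def transpose_def)
qed

text \<open>\<open>minimal_hypersurface\<close> speaks only of the chart selected at each point. The
  trace of the second fundamental form is invariant under the change of chart because the Jacobians
  cancel cyclically; the normal of the selected chart is kept, which avoids any comparison of
  signs.\<close>

lemma minimal_in_chart:
  assumes minimal: "minimal_hypersurface \<A> F" and c: "c \<in> \<A>" and x: "x \<in> region c"
  obtains \<nu> where "hyperbolic_parametrization.unit_normal_at (param c) x \<nu>"
    "(\<Sum>i\<in>UNIV. \<Sum>j\<in>UNIV. metric_inv c x $ i $ j * lorentz (pderiv_at i (pderiv_at j (param c)) x) \<nu>) = 0"
proof -
  define p where "p = chart_inv c x"
  define d where "d = chart_at \<A> p"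
  have d: "d \<in> \<A>" "p \<in> fst d" using chart_at by (simp_all add: d_def)
  have pc: "p \<in> fst c" "snd c p = x" using chart_inv_in[OF c x] chart_chart_inv[OF c x] by (simp_all add: p_def)
  then have xo: "x \<in> overlap c d" using d by (metis IntI image_eqI)
  interpret pc: hyperbolic_parametrization "param c" "region c" by (rule parametrization[OF c])
  interpret pd: hyperbolic_parametrization "param d" "region d" by (rule parametrization[OF d(1)])
  let ?T = "transition c d"
  define y where "y = ?T x"
  have y: "y = snd d p" by (simp add: y_def p_def)
  have yr: "y \<in> region d" using d by (simp add: y)
  define \<nu> where "\<nu> = unit_normal (param d) y"
  have n: "pd.unit_normal_at y \<nu>" unfolding \<nu>_def by (rule pd.unit_normal_exists[OF yr])
  then have nP: "lorentz (pd.P a y) \<nu> = 0" "lorentz (param d y) \<nu> = 0" for a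
    by (auto simp: pd.unit_normal_at_def lorentz_commute)
  define H where "H c x = (\<chi> i j. lorentz (pderiv_at i (pderiv_at j (param c)) x) \<nu>)" for c x
  \<comment> \<open>\<open>hyp_proj\<close> adds a multiple of the position vector, which is
    orthogonal to \<open>\<nu>\<close>.\<close>
  have ff: "second_ff (param d) y = H d y"
    by (simp add: vec_eq_iff second_ff_def H_def hyp_proj_def lorentz.add_left lorentz.scaleR_left nP[unfolded o_def] \<nu>_def[symmetric])
  have "(\<Sum>i\<in>UNIV. \<Sum>j\<in>UNIV. metric_inv d y $ i $ j * second_ff (param d) y $ i $ j) = 0"
    using minimal unfolding minimal_hypersurface_def metric_at_def second_ff_at_def Let_def
    by (auto simp: y d_def[symmetric] dest!: spec[of _ p])
  then have "(\<Sum>i\<in>UNIV. \<Sum>j\<in>UNIV. metric_inv d y $ i $ j * H d y $ i $ j) = 0" unfolding ff .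
  then have tr: "trace (metric_inv d y ** transpose (H d y)) = 0" by (simp only: sum_sum_eq_trace)
  let ?J = "matrix (frechet_derivative ?T (at x))" and ?K = "matrix_inv (matrix (frechet_derivative ?T (at x)))"
  have Hc: "H c x = transpose ?J ** H d y ** ?J"
    unfolding H_def y_def by (rule second_derivative_transition[OF c d(1) xo]) (use nP in \<open>simp add: y_def\<close>)
  have JK: "transpose ?K ** transpose ?J = mat 1"
    by (simp only: matrix_transpose_mul[symmetric] jacobian_inverse(1)[OF c d(1) xo] transpose_mat)
  have "(\<Sum>i\<in>UNIV. \<Sum>j\<in>UNIV. metric_inv c x $ i $ j * H c x $ i $ j) = trace (metric_inv c x ** transpose (H c x))"
    by (rule sum_sum_eq_trace)
  also have "metric_inv c x ** transpose (H c x) =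
      ?K ** metric_inv d y ** (transpose ?K ** transpose ?J) ** transpose (H d y) ** ?J"
    unfolding Hc jacobian_inverse(3)[OF c d(1) xo] y_def[symmetric]
    by (simp only: matrix_transpose_mul transpose_transpose matrix_mul_assoc)
  also have "\<dots> = ?K ** (metric_inv d y ** transpose (H d y) ** ?J)"
    unfolding JK by (simp only: matrix_mul_rid matrix_mul_assoc)
  also have "trace \<dots> = trace (metric_inv d y ** transpose (H d y) ** ?J ** ?K)"
    by (rule trace_mul_sym)
  also have "\<dots> = 0"
    using tr by (simp only: matrix_mul_assoc[symmetric] jacobian_inverse(1)[OF c d(1) xo] matrix_mul_rid)
  finally have m: "(\<Sum>i\<in>UNIV. \<Sum>j\<in>UNIV. metric_inv c x $ i $ j * lorentz (pderiv_at i (pderiv_at j (param c)) x) \<nu>) = 0"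
    by (simp only: H_def vec_lambda_beta)
  have "pc.unit_normal_at x \<nu>"
    unfolding pc.unit_normal_at_def
  proof (intro conjI allI)
    show "lorentz \<nu> \<nu> = 1" using n by (simp add: pd.unit_normal_at_def)
    show "lorentz \<nu> (param c x) = 0"
      unfolding transition_in(4)[OF c d(1) xo] using nP(2) by (simp only: y_def[symmetric] lorentz_commute)
    show "lorentz \<nu> (pc.P i x) = 0" for i
      unfolding pderiv_param_transition[OF c d(1) xo] y_def[symmetric]
      using nP(1) by (simp only: lorentz.sum_right lorentz.scaleR_right lorentz_commute[of \<nu>] scaleR_zero_right sum.neutral_const)
  qed
  then show thesis using m by (rule that)
qed

section \<open>Vanishing total divergence\<close>

text \<open>Integrability and the value of the integral are recorded for a representative
  \<open>\<theta>\<close>, since \<open>twisted_divergence\<close> takes arbitrary values where the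
  function is not differentiable.\<close>

definition zero_total_divergence :: "('p \<Rightarrow> real) \<Rightarrow> bool" where
  "zero_total_divergence f \<longleftrightarrow> (\<exists>\<theta>. integrable vol \<theta> \<and> (\<integral>p. \<theta> p \<partial>vol) = 0 \<and>
     (AE p in vol. twisted_divergence f p = \<theta> p))"

lemma grad_inner_add:
  assumes "diff_at f p" "diff_at g p"
  shows "grad_inner (\<lambda>q. f q + g q) h p = grad_inner f h p + grad_inner g h p"
proof -
  let ?c = "chart_at \<A> p" let ?x = "snd ?c p"
  have "pderiv_at i ((\<lambda>q. f q + g q) \<circ> chart_inv ?c) ?x = pderiv_at i (f \<circ> chart_inv ?c) ?x + pderiv_at i (g \<circ> chart_inv ?c) ?x" for i
  proof -
    have D: "(f \<circ> chart_inv ?c has_derivative frechet_derivative (f \<circ> chart_inv ?c) (at ?x)) (at ?x)"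
        "(g \<circ> chart_inv ?c has_derivative frechet_derivative (g \<circ> chart_inv ?c) (at ?x)) (at ?x)"
      using assms unfolding diff_at_def Let_def by (simp_all only: frechet_derivative_works[symmetric])
    from fun_cong[OF frechet_derivative_at[OF has_derivative_add[OF D], symmetric], of "axis i 1"]
    show ?thesis by (simp add: pderiv_at_def o_def)
  qed
  then have "coord_grad ?c (\<lambda>q. f q + g q) ?x = coord_grad ?c f ?x + coord_grad ?c g ?x"
    by (simp add: coord_grad_def vec_eq_iff)
  then show ?thesis by (simp add: grad_inner_def Let_def inner_add_left)
qed

lemma coord_grad_mult:
  assumes "c \<in> \<A>" "f \<circ> chart_inv c differentiable at x" "g \<circ> chart_inv c differentiable at x"
  shows "coord_grad c (\<lambda>q. f q * g q) x = f (chart_inv c x) *\<^sub>R coord_grad c g x + g (chart_inv c x) *\<^sub>R coord_grad c f x"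
  using pderiv_at_mult[OF assms(2,3)] by (simp add: coord_grad_def vec_eq_iff o_def mult.commute)

lemma grad_inner_local_zero:
  assumes "open V" "p \<in> V" "\<And>q. q \<in> V \<Longrightarrow> f q = 0"
  shows "grad_inner f h p = 0" "diff_at f p"
proof -
  let ?c = "chart_at \<A> p" let ?x = "snd ?c p"
  let ?W = "region ?c \<inter> chart_inv ?c -` V"
  have W: "open ?W"
    by (rule continuous_open_preimage[OF chart_inv_continuous[OF chart_at(1)] region_open[OF chart_at(1)] assms(1)])
  have x: "?x \<in> ?W" using chart_at[of p] assms(2) by (simp add: chart_inv_chart)
  have "((\<lambda>_. 0) has_derivative (\<lambda>_. 0)) (at ?x)" by simp
  then have D: "(f \<circ> chart_inv ?c has_derivative (\<lambda>_. 0)) (at ?x)"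
    by (rule has_derivative_transform_within_open[OF _ W x]) (simp add: assms(3))
  then show "diff_at f p" unfolding diff_at_def Let_def by (rule differentiableI)
  have "coord_grad ?c f ?x = 0"
    using fun_cong[OF frechet_derivative_at[OF D, symmetric]] by (simp add: coord_grad_def vec_eq_iff pderiv_at_def)
  then show "grad_inner f h p = 0" by (simp add: grad_inner_def Let_def)
qed

lemma zero_total_divergence_add:
  assumes f: "zero_total_divergence f" "locally_lipschitz f" and g: "zero_total_divergence g" "locally_lipschitz g"
  shows "zero_total_divergence (\<lambda>p. f p + g p)"
proof -
  obtain \<theta> where \<theta>: "integrable vol \<theta>" "(\<integral>p. \<theta> p \<partial>vol) = 0" "AE p in vol. twisted_divergence f p = \<theta> p"
    using f(1) by (auto simp: zero_total_divergence_def)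
  obtain \<eta> where \<eta>: "integrable vol \<eta>" "(\<integral>p. \<eta> p \<partial>vol) = 0" "AE p in vol. twisted_divergence g p = \<eta> p"
    using g(1) by (auto simp: zero_total_divergence_def)
  have "AE p in vol. twisted_divergence (\<lambda>p. f p + g p) p = \<theta> p + \<eta> p"
    using \<theta>(3) \<eta>(3) AE_diff_at[OF f(2)] AE_diff_at[OF g(2)]
    by eventually_elim (auto simp: twisted_divergence_def grad_inner_add add_divide_distrib algebra_simps)
  then show ?thesis unfolding zero_total_divergence_def
    using \<theta> \<eta> by (intro exI[of _ "\<lambda>p. \<theta> p + \<eta> p"]) auto
qed

text \<open>This identifies \<open>twisted_divergence\<close> as a divergence: the product rule
  combines the gradient term with \<open>divergence_log_height_field\<close>, and the density
  factors out of both.\<close>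

lemma divergence_in_chart:
  assumes minimal: "minimal_hypersurface \<A> F" and c: "c \<in> \<A>" and p: "p \<in> fst c" and f: "diff_at f p"
  shows "(\<Sum>i\<in>UNIV. pderiv_at i (\<lambda>y. (f \<circ> chart_inv c) y * chart_field c i y) (snd c p)) =
    density_at c (snd c p) * twisted_divergence f p"
proof -
  interpret pc: hyperbolic_parametrization "param c" "region c" by (rule parametrization[OF c])
  define x where "x = snd c p"
  have x: "x \<in> region c" "chart_inv c x = p" using p by (simp_all add: x_def chart_inv_chart[OF c])
  have hx: "snd (param c x) = height p" by (simp add: x)
  have du: "pc.du x = coord_grad c height x" using coord_grad_height[OF c x(1)] by simp
  have fd: "f \<circ> chart_inv c differentiable at x" using f diff_at_chart[OF c p] by (simp add: x_def)
  have Yd: "chart_field c i differentiable at x" for i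
    unfolding chart_field_def by (rule C1_on_differentiable[OF pc.C1_log_height_field x(1)])
  have Y: "chart_field c i x = density_at c x * ((metric_inv c x *v coord_grad c height x) $ i / height p)" for i
    unfolding chart_field_def pc.log_height_field_eq du hx ..
  obtain \<nu> where \<nu>: "pc.unit_normal_at x \<nu>"
    "(\<Sum>i\<in>UNIV. \<Sum>j\<in>UNIV. metric_inv c x $ i $ j * lorentz (pderiv_at i (pderiv_at j (param c)) x) \<nu>) = 0"
    using minimal_in_chart[OF minimal c x(1)] by blast
  have div: "(\<Sum>i\<in>UNIV. pderiv_at i (chart_field c i) x) =
      density_at c x * (real CARD('n) - (coord_grad c height x \<bullet> (metric_inv c x *v coord_grad c height x)) / (height p)\<^sup>2)"
    using pc.divergence_log_height_field[OF x(1) \<nu>] unfolding chart_field_def du hx .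
  have gi: "grad_inner f height p = coord_grad c f x \<bullet> (metric_inv c x *v coord_grad c height x)"
    "grad_inner height height p = coord_grad c height x \<bullet> (metric_inv c x *v coord_grad c height x)"
    unfolding x_def by (rule grad_inner_chart[OF c p]; simp add: f diff_at_height)+
  have "(\<Sum>i\<in>UNIV. pderiv_at i (\<lambda>y. (f \<circ> chart_inv c) y * chart_field c i y) x) =
      (\<Sum>i\<in>UNIV. f p * pderiv_at i (chart_field c i) x + pderiv_at i (f \<circ> chart_inv c) x * chart_field c i x)"
    using pderiv_at_mult[OF fd Yd] by (simp add: x)
  also have "\<dots> = f p * (\<Sum>i\<in>UNIV. pderiv_at i (chart_field c i) x) + (\<Sum>i\<in>UNIV. coord_grad c f x $ i * chart_field c i x)"
    by (simp add: sum.distrib sum_distrib_left coord_grad_def)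
  also have "(\<Sum>i\<in>UNIV. coord_grad c f x $ i * chart_field c i x) =
      density_at c x * (coord_grad c f x \<bullet> (metric_inv c x *v coord_grad c height x) / height p)"
    by (simp add: Y inner_vec_def sum_distrib_left sum_divide_distrib mult_ac)
  finally show ?thesis
    unfolding div gi[symmetric] by (simp add: twisted_divergence_def x_def algebra_simps)
qed

text \<open>The components of \<open>f\<close> times the weighted field extend by zero to Lipschitz
  functions on the whole coordinate space. Their forward derivatives integrate to 0, and division by
  the density turns their sum into the representative on the hypersurface.\<close>

lemma zero_total_divergence_chart:
  assumes minimal: "minimal_hypersurface \<A> F" and c: "c \<in> \<A>" and K: "compact K" "K \<subseteq> fst c"
    and f: "locally_lipschitz f" and supp: "\<And>p. p \<notin> K \<Longrightarrow> f p = 0"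
  shows "zero_total_divergence f"
proof -
  interpret pc: hyperbolic_parametrization "param c" "region c" by (rule parametrization[OF c])
  define g where "g i y = (if y \<in> region c then (f \<circ> chart_inv c) y * chart_field c i y else 0)" for i y
  define K' where "K' = snd c ` K"
  have K': "compact K'" "K' \<subseteq> region c"
    unfolding K'_def by (rule compact_continuous_image[OF continuous_on_subset[OF chart_continuous[OF c] K(2)] K(1)]) (use K in auto)
  have g0: "g i y = 0" if "y \<notin> K'" for i y
  proof (cases "y \<in> region c")
    case True
    then have "chart_inv c y \<notin> K" using that chart_chart_inv[OF c True] unfolding K'_def by (metis image_eqI)
    then show ?thesis by (simp add: g_def supp)
  qed (simp add: g_def)
  have loc: "\<exists>r>0. \<exists>L. \<forall>y\<in>ball x r. \<forall>z\<in>ball x r. \<bar>g i y - g i z\<bar> \<le> L * norm (y - z)" if "x \<in> K'" for i x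
  proof -
    have x: "x \<in> region c" using that K' by blast
    have "lipschitz_near (\<lambda>y. (f \<circ> chart_inv c) y * chart_field c i y) x"
    proof (rule lipschitz_near_mult)
      show "lipschitz_near (f \<circ> chart_inv c) x" using f c x unfolding locally_lipschitz_def by blast
      show "lipschitz_near (chart_field c i) x"
        unfolding chart_field_def by (rule lipschitz_near_C1[OF pc.C1_log_height_field region_open[OF c] x])
    qed
    then have "lipschitz_near (g i) x"
      by (rule lipschitz_near_cong[OF _ region_open[OF c] x]) (simp add: g_def)
    then show ?thesis unfolding lipschitz_near_def by blast
  qed
  have "\<exists>L R. lipschitz_bounded_support (g i) L R" for i
    by (rule lipschitz_extension_by_zero[of K' "g i", OF K'(1) g0 loc]) blast+
  then obtain L R where lbs: "\<And>i. lipschitz_bounded_support (g i) (L i) (R i)" by metis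
  \<comment> \<open>Forward derivatives are used because they are integrable functions on the whole
    space; they are the partial derivatives wherever the components are differentiable.\<close>
  define H where "H y = (\<Sum>i\<in>UNIV. forward_derivative (g i) (axis i 1) y)" for y
  have H_int: "integrable lborel H" unfolding H_def[abs_def]
    by (intro Bochner_Integration.integrable_sum lipschitz_bounded_support.integrable_forward[OF lbs])
  have H_0: "(\<integral>y. H y \<partial>lborel) = 0" unfolding H_def
    by (subst Bochner_Integration.integral_sum)
      (simp_all add: lipschitz_bounded_support.integrable_forward[OF lbs] lipschitz_bounded_support.integral_forward_derivative[OF lbs])
  have H_pderiv: "H y = (\<Sum>i\<in>UNIV. pderiv_at i (g i) y)" if "\<And>i. g i differentiable at y" for y
    unfolding H_def pderiv_at_def
    by (intro sum.cong refl lipschitz_bounded_support.forward_derivative_eq_frechet[OF lbs that])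
  \<comment> \<open>Off the compact set \<open>K'\<close> the components vanish locally, so the
    forward derivatives are 0 at every such point, not just almost everywhere.\<close>
  have H_supp: "H y = 0" if "y \<notin> region c" for y
  proof -
    have "open (- K')" "y \<in> - K'" using compact_imp_closed[OF K'(1)] that K'(2) by auto
    have "((\<lambda>_. 0) has_derivative (\<lambda>_. 0)) (at y)" by simp
    then have D: "(g i has_derivative (\<lambda>_. 0)) (at y)" for i
      by (rule has_derivative_transform_within_open[OF _ \<open>open (- K')\<close> \<open>y \<in> - K'\<close>]) (simp add: g0)
    then show ?thesis
      using H_pderiv[of y] fun_cong[OF frechet_derivative_at[OF D, symmetric]]
      by (simp add: differentiableI[OF D] pderiv_at_def)
  qed
  define \<theta> where "\<theta> = (\<lambda>p. if p \<in> fst c then H (snd c p) / density_at c (snd c p) else 0)"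
  have eq: "twisted_divergence f p = \<theta> p" if d: "diff_at f p" for p
  proof (cases "p \<in> fst c")
    case True
    define x where "x = snd c p"
    have x: "x \<in> region c" using True by (simp add: x_def)
    have fd: "f \<circ> chart_inv c differentiable at x" using d diff_at_chart[OF c True] by (simp add: x_def)
    have Yd: "chart_field c i differentiable at x" for i
      unfolding chart_field_def by (rule C1_on_differentiable[OF pc.C1_log_height_field x])
    have pd: "(\<lambda>y. (f \<circ> chart_inv c) y * chart_field c i y) differentiable at x" for i
      by (rule differentiable_mult[OF fd Yd])
    have gd: "g i differentiable at x" for i
    proof -
      obtain D where "((\<lambda>y. (f \<circ> chart_inv c) y * chart_field c i y) has_derivative D) (at x)"
        using pd[of i] unfolding differentiable_def by blast
      then have "(g i has_derivative D) (at x)"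
        by (rule has_derivative_transform_within_open[OF _ region_open[OF c] x]) (simp add: g_def)
      then show ?thesis by (rule differentiableI)
    qed
    have "H x = (\<Sum>i\<in>UNIV. pderiv_at i (\<lambda>y. (f \<circ> chart_inv c) y * chart_field c i y) x)"
      unfolding H_pderiv[OF gd]
      by (intro sum.cong refl pderiv_at_cong[OF region_open[OF c] x _ gd]) (simp add: g_def)
    also have "\<dots> = density_at c x * twisted_divergence f p"
      unfolding x_def by (rule divergence_in_chart[OF minimal c True d])
    finally show ?thesis
      using True density_pos[OF c x] by (simp add: \<theta>_def x_def[symmetric])
  next
    \<comment> \<open>Away from the chart \<open>f\<close> vanishes near \<open>p\<close>, so the
      divergence is 0 there, in agreement with the default value of \<open>\<theta>\<close>.\<close>
    case False
    have "open (- K)" "p \<in> - K" using compact_imp_closed[OF K(1)] K(2) False by auto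
    then have "grad_inner f height p = 0" using grad_inner_local_zero(1)[of "- K" p f height] supp by blast
    then show ?thesis using supp[of p] \<open>p \<in> - K\<close> False by (simp add: twisted_divergence_def \<theta>_def)
  qed
  have "AE p in vol. twisted_divergence f p = \<theta> p"
    using AE_diff_at[OF f] by (rule eventually_mono) (rule eq)
  then show ?thesis
    unfolding zero_total_divergence_def
    using integral_vol_chart[OF c H_int H_supp] H_0 by (intro exI[of _ \<theta>]) (simp add: \<theta>_def)
qed

text \<open>Finitely many bump functions \<open>\<psi>\<close> cover the support; each is split off by \<open>f = f \<psi> + f (1 - \<psi>)\<close>.\<close>

lemma zero_total_divergence_compact:
  assumes minimal: "minimal_hypersurface \<A> F" and K: "compact K"
    and f: "locally_lipschitz f" and supp: "\<And>p. p \<notin> K \<Longrightarrow> f p = 0"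
  shows "zero_total_divergence f"
proof -
  \<comment> \<open>The data of a bump function are hidden in a property of the open set, so that
    the induction can run over a finite family of sets.\<close>
  define good where "good V \<longleftrightarrow> open V \<and> (\<exists>K c \<psi>. c \<in> \<A> \<and> compact K \<and> K \<subseteq> fst c \<and> locally_lipschitz \<psi> \<and>
      (\<forall>q\<in>V. \<psi> q = 1) \<and> (\<forall>q. q \<notin> K \<longrightarrow> \<psi> q = 0))" for V
  have ex: "\<exists>V. good V \<and> p \<in> V" for p
    by (rule bump_function[of p]) (unfold good_def, blast)
  have ind: "zero_total_divergence f"
    if "finite \<V>" "\<forall>V\<in>\<V>. good V" "compact K" "K \<subseteq> \<Union>\<V>" "locally_lipschitz f" "\<forall>p. p \<notin> K \<longrightarrow> f p = 0" for \<V> K f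
    using that
  proof (induction \<V> arbitrary: K f rule: finite_induct)
    case empty
    then have "f p = 0" for p by auto
    then have "twisted_divergence f p = 0" for p
      using grad_inner_local_zero(1)[of UNIV p f height] by (simp add: twisted_divergence_def)
    then show ?case unfolding zero_total_divergence_def by (intro exI[of _ "\<lambda>_. 0"]) simp
  next
    case (insert V \<V>)
    obtain K\<^sub>0 c \<psi> where \<psi>: "open V" "c \<in> \<A>" "compact K\<^sub>0" "K\<^sub>0 \<subseteq> fst c" "locally_lipschitz \<psi>"
        "\<And>q. q \<in> V \<Longrightarrow> \<psi> q = 1" "\<And>q. q \<notin> K\<^sub>0 \<Longrightarrow> \<psi> q = 0"
    proof -
      have "good V" using insert.prems(1) by blast
      then show thesis unfolding good_def by (elim conjE exE) (rule that, assumption+, blast+)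
    qed
    have l1: "locally_lipschitz (\<lambda>p. f p * \<psi> p)" by (rule locally_lipschitz_mult[OF insert.prems(4) \<psi>(5)])
    have l2: "locally_lipschitz (\<lambda>p. f p * (1 - \<psi> p))"
      by (rule locally_lipschitz_mult[OF insert.prems(4) locally_lipschitz_diff[OF locally_lipschitz_const \<psi>(5)]])
    have "zero_total_divergence (\<lambda>p. f p * \<psi> p)"
      by (rule zero_total_divergence_chart[OF minimal \<psi>(2,3,4) l1]) (simp add: \<psi>(7))
    moreover have "zero_total_divergence (\<lambda>p. f p * (1 - \<psi> p))"
    proof (rule insert.IH[OF _ _ _ l2])
      show "\<forall>V\<in>\<V>. good V" using insert.prems(1) by blast
      \<comment> \<open>Because \<open>\<psi>\<close> is 1 on the open set \<open>V\<close>, the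
        second summand is supported in \<open>K - V\<close>, which is compact and covered by the
        remaining sets.\<close>
      show "compact (K - V)" using insert.prems(2) \<psi>(1) by (rule compact_diff)
      show "K - V \<subseteq> \<Union>\<V>" using insert.prems(3) by blast
      show "\<forall>p. p \<notin> K - V \<longrightarrow> f p * (1 - \<psi> p) = 0" using insert.prems(5) \<psi>(6) by auto
    qed
    ultimately have "zero_total_divergence (\<lambda>p. f p * \<psi> p + f p * (1 - \<psi> p))"
      using l1 l2 by (intro zero_total_divergence_add)
    then show ?case by (simp add: algebra_simps)
  qed
  obtain V where V: "\<And>p. good (V p)" "\<And>p. p \<in> V p" using ex by metis
  have "K \<subseteq> (\<Union>p\<in>K. V p)" using V(2) by blast
  then obtain C where C: "C \<subseteq> K" "finite C" "K \<subseteq> (\<Union>p\<in>C. V p)"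
    using compactE_image[OF K, of K V] V(1) unfolding good_def by metis
  show ?thesis
    by (rule ind[of "V ` C" K]) (use C V(1) K f supp in auto)
qed

section \<open>Lipschitz functions of the Riemannian distance in charts\<close>

lemma lorentz_le_norm: "lorentz v v \<le> (norm v)\<^sup>2"
  by (simp add: lorentz_self norm_prod_def)

text \<open>Regularity of a curve is demanded in every chart that it meets, so the coordinate
  segment has to be followed through each transition map.\<close>

lemma piecewise_C1_chart_segment:
  assumes c: "c \<in> \<A>" and seg: "closed_segment y z \<subseteq> region c"
  shows "piecewise_C1_curve \<A> (chart_inv c \<circ> linepath y z)"
  unfolding piecewise_C1_curve_def
proof (intro conjI ballI allI impI)
  have img: "linepath y z t \<in> region c" if "t \<in> {0..1}" for t
    using seg that linepath_in_path by blast
  show "path (chart_inv c \<circ> linepath y z)"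
    unfolding path_def
    by (rule continuous_on_compose[OF _ continuous_on_subset[OF chart_inv_continuous[OF c]]])
      (use img in \<open>auto intro: continuous_on_linepath\<close>)
  fix d and a b :: real assume d: "d \<in> \<A>" and ab: "0 \<le> a \<and> a \<le> b \<and> b \<le> 1 \<and> (chart_inv c \<circ> linepath y z) ` {a..b} \<subseteq> fst d"
  let ?T = "transition c d"
  have T: "C1_on ?T (overlap c d)" by (rule Ck_on_2D(1)[OF transition_smooth[OF c d]])
  have inov: "linepath y z t \<in> overlap c d" if "t \<in> {a..b}" for t
  proof -
    have t: "linepath y z t \<in> region c" using img ab that by auto
    moreover have "chart_inv c (linepath y z t) \<in> fst d" using ab that by auto
    ultimately show ?thesis using chart_inv_in[OF c t] chart_chart_inv[OF c t] by (metis IntI image_eqI)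
  qed
  have "(?T \<circ> linepath y z) C1_differentiable_on {a..b}"
    unfolding C1_differentiable_on_def
  proof (intro exI conjI ballI)
    fix t assume t: "t \<in> {a..b}"
    have "(?T \<circ> linepath y z has_derivative
        (frechet_derivative ?T (at (linepath y z t)) \<circ> (\<lambda>h. h *\<^sub>R (z - y)))) (at t)"
      by (rule diff_chain_at)
        (use has_vector_derivative_linepath_within[of y z t UNIV] C1_onD(1)[OF T inov[OF t]] in \<open>simp_all add: has_vector_derivative_def\<close>)
    then show "(?T \<circ> linepath y z has_vector_derivative frechet_derivative ?T (at (linepath y z t)) (z - y)) (at t)"
      using linear_scale[OF has_derivative_linear[OF C1_onD(1)[OF T inov[OF t]]]]
      by (simp add: has_vector_derivative_def o_def)
  next
    show "continuous_on {a..b} (\<lambda>t. frechet_derivative ?T (at (linepath y z t)) (z - y))"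
      by (rule continuous_on_compose2[OF C1_onD(2)[OF T] continuous_on_linepath]) (use inov in auto)
  qed
  then show "(snd d \<circ> (chart_inv c \<circ> linepath y z)) piecewise_C1_differentiable_on {a..b}"
    unfolding o_assoc by (rule C1_differentiable_imp_piecewise)
qed

lemma curve_length_chart_segment:
  assumes c: "c \<in> \<A>" and seg: "closed_segment y z \<subseteq> region c"
    and B: "\<And>x. x \<in> closed_segment y z \<Longrightarrow> (\<Sum>i\<in>UNIV. norm (pderiv_at i (param c) x)) \<le> B"
  shows "curve_length F (chart_inv c \<circ> linepath y z) \<le> ennreal (B * norm (z - y))"
proof -
  interpret pc: hyperbolic_parametrization "param c" "region c" by (rule parametrization[OF c])
  have speed: "sqrt (lorentz (vector_derivative (F \<circ> (chart_inv c \<circ> linepath y z)) (at t))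
      (vector_derivative (F \<circ> (chart_inv c \<circ> linepath y z)) (at t))) \<le> B * norm (z - y)" if t: "t \<in> {0..1}" for t
  proof -
    define x where "x = linepath y z t"
    have xs: "x \<in> closed_segment y z" unfolding x_def by (rule linepath_in_path[OF t])
    then have x: "x \<in> region c" using seg by blast
    have D: "(param c has_derivative frechet_derivative (param c) (at x)) (at x)" by (rule C1_onD(1)[OF pc.C1_X x])
    have "(param c \<circ> linepath y z has_derivative (frechet_derivative (param c) (at x) \<circ> (\<lambda>h. h *\<^sub>R (z - y)))) (at t)"
      by (rule diff_chain_at)
        (use has_vector_derivative_linepath_within[of y z t UNIV] D in \<open>simp_all add: has_vector_derivative_def x_def\<close>)
    then have "(param c \<circ> linepath y z has_vector_derivative frechet_derivative (param c) (at x) (z - y)) (at t)"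
      using linear_scale[OF has_derivative_linear[OF D]] by (simp add: has_vector_derivative_def o_def)
    then have "vector_derivative (F \<circ> (chart_inv c \<circ> linepath y z)) (at t) = frechet_derivative (param c) (at x) (z - y)"
      by (simp add: o_assoc vector_derivative_at)
    also have "\<dots> = (\<Sum>i\<in>UNIV. (z - y) $ i *\<^sub>R pderiv_at i (param c) x)"
      by (rule frechet_derivative_sum_pderiv[OF pc.diff_X[OF x]])
    finally have v: "vector_derivative (F \<circ> (chart_inv c \<circ> linepath y z)) (at t) = (\<Sum>i\<in>UNIV. (z - y) $ i *\<^sub>R pderiv_at i (param c) x)" .
    have "sqrt (lorentz v v) \<le> norm v" for v :: "(real^'m) \<times> real"
      using real_sqrt_le_mono[OF lorentz_le_norm[of v]] by simp
    then have "sqrt (lorentz (vector_derivative (F \<circ> (chart_inv c \<circ> linepath y z)) (at t))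
      (vector_derivative (F \<circ> (chart_inv c \<circ> linepath y z)) (at t))) \<le> norm (\<Sum>i\<in>UNIV. (z - y) $ i *\<^sub>R pderiv_at i (param c) x)"
      unfolding v by blast
    also have "\<dots> \<le> (\<Sum>i\<in>UNIV. norm (z - y) * norm (pderiv_at i (param c) x))"
      by (rule order_trans[OF norm_sum]) (auto intro!: sum_mono mult_right_mono component_le_norm_cart simp: norm_scaleR simp del: vector_minus_component)
    also have "\<dots> = norm (z - y) * (\<Sum>i\<in>UNIV. norm (pderiv_at i (param c) x))" by (simp add: sum_distrib_left)
    also have "\<dots> \<le> norm (z - y) * B" by (intro mult_left_mono B xs) simp
    finally show ?thesis by (simp add: mult.commute)
  qed
  have "curve_length F (chart_inv c \<circ> linepath y z) \<le> (\<integral>\<^sup>+t. ennreal (B * norm (z - y)) * indicator {0..1} t \<partial>(lborel :: real measure))"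
    unfolding curve_length_def
    by (rule nn_integral_mono) (use speed in \<open>auto simp: indicator_def intro: ennreal_leI\<close>)
  also have "\<dots> = ennreal (B * norm (z - y))" by (simp add: nn_integral_cmult)
  finally show ?thesis .
qed

text \<open>The distance between nearby points is at most the length of the coordinate segment
  joining them, and on a compact ball the speed of such a segment is bounded by a constant times its
  Euclidean speed.\<close>

lemma locally_lipschitz_of_lipschitz_function:
  assumes "lipschitz_function \<A> F f"
  shows "locally_lipschitz f"
  unfolding locally_lipschitz_def
proof (intro ballI)
  fix c x assume c: "c \<in> \<A>" and x: "x \<in> region c"
  obtain L where L: "L \<ge> 0" "\<And>p q. ennreal \<bar>f p - f q\<bar> \<le> ennreal L * riemannian_dist \<A> F p q"
    using assms by (auto simp: lipschitz_function_def)
  interpret pc: hyperbolic_parametrization "param c" "region c" by (rule parametrization[OF c])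
  obtain R where R: "R > 0" "cball x R \<subseteq> region c" using region_open[OF c] x open_contains_cball by blast
  have "continuous_on (cball x R) (\<lambda>x. \<Sum>i\<in>UNIV. norm (pderiv_at i (param c) x))"
    by (intro continuous_intros continuous_on_subset[OF C1_onD(3)[OF pc.C1_P] R(2)])
  then have "bounded ((\<lambda>x. \<Sum>i\<in>UNIV. norm (pderiv_at i (param c) x)) ` cball x R)"
    by (intro compact_imp_bounded compact_continuous_image) auto
  then obtain B where B: "\<And>y. y \<in> cball x R \<Longrightarrow> norm (\<Sum>i\<in>UNIV. norm (pderiv_at i (param c) y)) \<le> B"
    unfolding bounded_iff by blast
  show "lipschitz_near (f \<circ> chart_inv c) x"
  proof (rule lipschitz_nearI[OF R(1)])
    fix y z assume yz: "y \<in> ball x R" "z \<in> ball x R"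
    then have seg: "closed_segment y z \<subseteq> cball x R" by (intro closed_segment_subset) auto
    let ?\<gamma> = "chart_inv c \<circ> linepath y z"
    have "riemannian_dist \<A> F (chart_inv c y) (chart_inv c z) \<le> curve_length F ?\<gamma>"
      unfolding riemannian_dist_def
      by (rule INF_lower) (use piecewise_C1_chart_segment[OF c] seg R(2) in \<open>auto simp: pathstart_def pathfinish_def linepath_def\<close>)
    also have "\<dots> \<le> ennreal (B * norm (z - y))"
      by (rule curve_length_chart_segment[OF c]) (use seg R(2) B in force)+
    finally have "ennreal L * riemannian_dist \<A> F (chart_inv c y) (chart_inv c z) \<le> ennreal L * ennreal (B * norm (z - y))"
      by (rule mult_left_mono) simp
    then have "ennreal \<bar>f (chart_inv c y) - f (chart_inv c z)\<bar> \<le> ennreal L * ennreal (B * norm (z - y))"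
      using L(2) order_trans by blast
    moreover have "0 \<le> B" using order_trans[OF norm_ge_zero B[of x]] R(1) by simp
    ultimately have "\<bar>f (chart_inv c y) - f (chart_inv c z)\<bar> \<le> L * (B * norm (z - y))"
      using L(1) by (simp add: ennreal_mult[symmetric] ennreal_le_iff)
    then show "\<bar>(f \<circ> chart_inv c) y - (f \<circ> chart_inv c) z\<bar> \<le> (L * B) * norm (y - z)"
      by (simp add: norm_minus_commute mult.assoc)
  qed
qed

section \<open>The pointwise inequality and stability\<close>

text \<open>With \<open>N = 2 * k + 1\<close>, the right side minus the left side is a sum of three
  nonnegative terms: the square of \<open>a + (k * f p / u) *\<^sub>R b\<close> in the inverse
  metric, the remainder \<open>k * (k + 1) * (f p)\<^sup>2 * (1 - s)\<close> controlled by
  \<open>gradient_bound\<close>, and \<open>(f p)\<^sup>2\<close> times the gap in the curvature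
  bound.\<close>

lemma stability_integrand_bound:
  assumes f: "diff_at f p" and A: "second_ff_normsq \<A> F p \<le> (real CARD('n) + 1)\<^sup>2 / 4"
  shows "- ((real CARD('n) - 1) / 2) * twisted_divergence (\<lambda>q. f q * f q) p \<le>
    grad_normsq \<A> F f p - (second_ff_normsq \<A> F p - real CARD('n)) * (f p)\<^sup>2"
proof -
  define c where "c = chart_at \<A> p"
  define x where "x = snd c p"
  have c: "c \<in> \<A>" "p \<in> fst c" using chart_at by (simp_all add: c_def)
  have x: "x \<in> region c" "chart_inv c x = p" using c by (simp_all add: x_def chart_inv_chart)
  interpret pc: hyperbolic_parametrization "param c" "region c" by (rule parametrization[OF c(1)])
  interpret G: positive_definite "metric_matrix (param c) x" by (rule pc.G_pos[OF x(1)])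
  define N where "N = real CARD('n)"
  define k where "k = (N - 1) / 2"
  define a where "a = coord_grad c f x"
  define b where "b = coord_grad c height x"
  define u where "u = height p"
  let ?g = "metric_inv c x"
  define q where "q = a \<bullet> (?g *v b) / u"
  define s where "s = b \<bullet> (?g *v b) / u\<^sup>2"
  have N1: "N \<ge> 1" unfolding N_def by (simp add: Suc_leI)
  have u0: "u > 0" using pc.u_pos[OF x(1)] x(2) by (simp add: u_def)
  have du: "pc.du x = b" using coord_grad_height[OF c(1) x(1)] by (simp add: b_def)
  have s1: "s \<le> 1"
    using pc.gradient_bound[OF x(1)] u0 x(2) unfolding du by (simp add: s_def u_def)
  have fd: "f \<circ> chart_inv c differentiable at x" using f by (simp add: diff_at_def Let_def c_def x_def)
  have ff: "coord_grad c (\<lambda>q. f q * f q) x = (2 * f p) *\<^sub>R a"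
    using coord_grad_mult[OF c(1) fd fd] by (simp add: a_def x(2) scaleR_left_distrib[symmetric])
  have Theta: "twisted_divergence (\<lambda>q. f q * f q) p = 2 * f p * q + (f p)\<^sup>2 * (N - s)"
    unfolding twisted_divergence_def grad_inner_def Let_def c_def[symmetric] x_def[symmetric] ff b_def[symmetric] u_def[symmetric]
    by (simp add: q_def s_def N_def power2_eq_square)
  have grad: "grad_normsq \<A> F f p = a \<bullet> (?g *v a)"
    using fd unfolding grad_normsq_def metric_at_def Let_def c_def[symmetric] x_def[symmetric]
    by (simp add: matrix_inner_expand a_def coord_grad_def)
  have "0 \<le> (a + (k * f p / u) *\<^sub>R b) \<bullet> (?g *v (a + (k * f p / u) *\<^sub>R b))" by (rule G.inv_nonneg)
  also have "\<dots> = a \<bullet> (?g *v a) + 2 * k * f p * q + k\<^sup>2 * (f p)\<^sup>2 * s"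
    using G.inv_inner_commute[of b a] u0
    by (simp add: matrix_vector_right_distrib matrix_vector_mult_scaleR inner_add_left inner_add_right q_def s_def power2_eq_square field_simps)
  finally have sq: "0 \<le> a \<bullet> (?g *v a) + 2 * k * f p * q + k\<^sup>2 * (f p)\<^sup>2 * s" .
  have k0: "k \<ge> 0" using N1 by (simp add: k_def)
  have "0 \<le> (k * (k + 1)) * ((f p)\<^sup>2 * (1 - s))" using k0 s1 by simp
  moreover have "(second_ff_normsq \<A> F p - N) * (f p)\<^sup>2 \<le> k\<^sup>2 * (f p)\<^sup>2"
  proof (rule mult_right_mono)
    have "second_ff_normsq \<A> F p - N \<le> (N + 1)\<^sup>2 / 4 - N" using A by (simp add: N_def)
    also have "\<dots> = k\<^sup>2" by (simp add: k_def power2_eq_square field_simps)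
    finally show "second_ff_normsq \<A> F p - N \<le> k\<^sup>2" .
  qed simp
  moreover have "N = 2 * k + 1" by (simp add: k_def field_simps)
  ultimately show ?thesis
    unfolding grad Theta N_def[symmetric] k_def[symmetric] using sq
    by (simp add: algebra_simps power2_eq_square)
qed

theorem stable_if_second_ff_bounded:
  assumes minimal: "minimal_hypersurface \<A> F"
    and A: "\<And>p. second_ff_normsq \<A> F p \<le> (real CARD('n) + 1)\<^sup>2 / 4"
  shows "stable_hypersurface \<A> F"
  unfolding stable_hypersurface_def
proof (intro allI impI)
  fix f assume f: "lipschitz_function \<A> F f \<and> compact (closure {p. f p \<noteq> 0})"
  let ?I = "\<lambda>p. grad_normsq \<A> F f p - (second_ff_normsq \<A> F p - real CARD('n)) * (f p)\<^sup>2"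
  have ll: "locally_lipschitz f" using f locally_lipschitz_of_lipschitz_function by blast
  have "zero_total_divergence (\<lambda>p. f p * f p)"
  proof (rule zero_total_divergence_compact[OF minimal])
    show "compact (closure {p. f p \<noteq> 0})" using f by blast
    show "locally_lipschitz (\<lambda>p. f p * f p)" by (rule locally_lipschitz_mult[OF ll ll])
    show "f p * f p = 0" if "p \<notin> closure {p. f p \<noteq> 0}" for p
      using that closure_subset[of "{p. f p \<noteq> 0}"] by auto
  qed
  then obtain \<theta> where \<theta>: "integrable vol \<theta>" "(\<integral>p. \<theta> p \<partial>vol) = 0"
    "AE p in vol. twisted_divergence (\<lambda>p. f p * f p) p = \<theta> p"
    unfolding zero_total_divergence_def by blast
  let ?k = "(real CARD('n) - 1) / 2"
  show "0 \<le> (\<integral>p. ?I p \<partial>vol)"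
  proof (cases "integrable vol ?I")
    case True
    \<comment> \<open>The comparison function \<open>- ?k * \<theta> p\<close> has integral 0 and
      lies below the integrand almost everywhere, namely where \<open>f\<close> is differentiable
      and \<open>\<theta>\<close> represents the divergence.\<close>
    have "(\<integral>p. - ?k * \<theta> p \<partial>vol) \<le> (\<integral>p. ?I p \<partial>vol)"
    proof (rule integral_mono_AE)
      show "integrable vol (\<lambda>p. - ?k * \<theta> p)" using \<theta>(1) by (rule integrable_mult_right)
      show "AE p in vol. - ?k * \<theta> p \<le> ?I p"
        using \<theta>(3) AE_diff_at[OF ll] by eventually_elim (use stability_integrand_bound[OF _ A] in metis)
    qed (rule True)
    then show ?thesis using \<theta>(2) by simp
  next
    case False
    \<comment> \<open>The Bochner integral of a non-integrable function is \<open>0\<close>.\<close>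
    then show ?thesis by (simp add: not_integrable_integral_eq)
  qed
qed

end

theorem theorem3p1:
  fixes \<A> :: "('p::{second_countable_topology, t2_space}, 'n::finite) chart set"
    and F :: "'p \<Rightarrow> (real^'m::finite) \<times> real"
  assumes "immersed_hypersurface \<A> F"
    and "complete_hypersurface \<A> F"
    and "minimal_hypersurface \<A> F"
    and "\<And>p. second_ff_normsq \<A> F p \<le> (real CARD('n) + 1)\<^sup>2 / 4"
  shows "stable_hypersurface \<A> F"
  using hypersurface.stable_if_second_ff_bounded[OF hypersurface.intro[OF assms(1)] assms(3,4)] .

end
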